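(* Let $n\ge 3$ be a square-free integer and $r\ge 1$ an integer. Let $\mathcal{R}=\{j\in\mathbb{Z}:1\le j\le n/2,\ (j,n)=1\}$. Then $$\widehat{\mathrm{ct}}^{(r)}_1=\begin{cases}\displaystyle\sum_{j\in\mathcal{R}}\widehat{B}^{(r)}_{j,1}\,\widehat{s}_j, & \text{if } r \text{ is odd};\\[2mm] \displaystyle\sum_{j\in\mathcal{R}}\widehat{B}^{(r)}_{j,1}\,\widehat{c}_j, & \text{if } r \text{ is even}.\end{cases}$$
   Context: For $j\in\mathbb{Z}$ with $(j,n)=1$, $j^*$ denotes the inverse of $j$ mod $n$, $jj^*\equiv1\pmod n$, $1\le j^*\le n$. Put $\zeta_n=e^{2\pi i/n}$. Inverse cotangent numbers: for $(j,n)=1$, $\widehat{\mathrm{ct}}^{(r)}_j=\dfrac{-i^r\pi^r}{(r-1)!\,n^r}\,d^{(r)}_j$ with $d^{(r)}_j=\sum_{m\in\mathbb{Z},\,m\equiv j\,(\mathrm{mod}\,n)}\mu(|m|)/m^r$, where $\mu$ is the Möbius function; for $r=1$ the series is understood as $\lim_{k\to\infty}\sum_{|m|\le k}$. Generalized Bernoulli matrix: let $B^{(r)}(x)$ be the $r$th Bernoulli polynomial, and $\widetilde n=n-1$ if $r$ is odd, $\widetilde n=n$ if $r$ is even. For $1\le j\le n$, $(j,n)=1$, put $$\widetilde B^{(r)}_j=\frac{(-1)^r2^rn^{r-1}}{r}\sum_{d\mid n}\mu(d)\sum_{\substack{1\le k\le\widetilde n\\ (k,n)=d,\ k\equiv j\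 (\mathrm{mod}\ n/d)}}B^{(r)}(k/n).$$ Let $\widetilde B^{(r)}=(\widetilde B^{(r)}_{jk^*})_{j,k\in\mathcal{R}}$, where the subscript $jk^*$ means the representative of $jk^*$ mod $n$ in $\{1,\dots,n\}$. This matrix is invertible; $\widehat B^{(r)}=(\widehat B^{(r)}_{j,k})_{j,k\in\mathcal{R}}$ denotes its inverse. For $k\in\mathbb{Z}$, $(k,n)=1$, put $s_k=\zeta_n^k-\zeta_n^{-k}$, $c_k=\zeta_n^k+\zeta_n^{-k}$, $$\lambda(k)=|\{q\in\mathbb{Z}: q\ge 3,\ q\mid n,\ k\equiv 1\ (\mathrm{mod}\ q)\}|,$$ $\rho_n=2$ if $n$ is odd, $\rho_n=4$ if $n$ is even, and $$\widehat s_k=\frac{-1}{n}\sum_{l\in\mathcal{R}}(\lambda(kl)-\lambda(-kl))\,s_l,\qquad \widehat c_k=\frac1n\sum_{l\in\mathcal{R}}(\lambda(kl)+\lambda(-kl)+\rho_n)\,c_l.$$ *)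

theory Defs
  imports
    "HOL-Analysis.Analysis"
    "HOL-Number_Theory.Number_Theory"
    "HOL-Computational_Algebra.Computational_Algebra"
begin

definition moebius :: "nat \<Rightarrow> int" where
  "moebius m = (if squarefree m then (- 1) ^ card (prime_factors m) else 0)"

(* generating function: t exp(x t) / (exp t - 1) = (SUM r. bernoulli_poly r x * t^r / r!) *)
definition bernoulli_poly :: "nat \<Rightarrow> real \<Rightarrow> real" where
  "bernoulli_poly r x = fact r * fps_nth (fps_X * fps_exp x / (fps_exp 1 - 1)) r"

definition index_set :: "nat \<Rightarrow> int set" where
  "index_set n = {j. 1 \<le> j \<and> real_of_int j \<le> real n / 2 \<and> coprime j (int n)}"

(* For r = 1 the series converges only conditionally; it is summed symmetrically. *)
definition d_num :: "nat \<Rightarrow> nat \<Rightarrow> int \<Rightarrow> real" where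
  "d_num n r j =
     (if r = 1
      then lim (\<lambda>K::nat. \<Sum>m | \<bar>m\<bar> \<le> int K \<and> [m = j] (mod int n).
                    real_of_int (moebius (nat \<bar>m\<bar>)) / real_of_int m)
      else (\<Sum>\<^sub>\<infinity>m | [m = j] (mod int n).
              real_of_int (moebius (nat \<bar>m\<bar>)) / real_of_int m ^ r))"

definition ct_hat :: "nat \<Rightarrow> nat \<Rightarrow> int \<Rightarrow> complex" where
  "ct_hat n r j =
     - (\<i> ^ r * of_real pi ^ r) / (fact (r - 1) * of_nat n ^ r) * of_real (d_num n r j)"

definition n_tilde :: "nat \<Rightarrow> nat \<Rightarrow> nat" where
  "n_tilde n r = (if odd r then n - 1 else n)"

definition B_tilde :: "nat \<Rightarrow> nat \<Rightarrow> int \<Rightarrow> real" where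
  "B_tilde n r j =
     (- 1) ^ r * 2 ^ r * real n ^ (r - 1) / real r *
     (\<Sum>d | d dvd n. real_of_int (moebius d) *
        (\<Sum>k | k \<in> {1..n_tilde n r} \<and> gcd k n = d \<and> [int k = j] (mod int (n div d)).
           bernoulli_poly r (real k / real n)))"

(* For n \<ge> 3 and k coprime to n, the library's modular_inverse lies in {1..n-1}; so does the
   residue of j * modular_inverse k for j and k coprime to n. *)
definition B_tilde_mat :: "nat \<Rightarrow> nat \<Rightarrow> int \<Rightarrow> int \<Rightarrow> real" where
  "B_tilde_mat n r j k = B_tilde n r ((j * modular_inverse (int n) k) mod int n)"

(* Square matrices whose rows and columns are indexed by a finite set I. *)
definition is_mat_inverse :: "'i set \<Rightarrow> ('i \<Rightarrow> 'i \<Rightarrow> 'a :: semiring_1) \<Rightarrow> ('i \<Rightarrow> 'i \<Rightarrow> 'a) \<Rightarrow> bool" where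
  "is_mat_inverse I A B \<longleftrightarrow>
     (\<forall>i\<in>I. \<forall>j\<in>I. (\<Sum>l\<in>I. A i l * B l j) = (if i = j then 1 else 0)) \<and>
     (\<forall>i\<in>I. \<forall>j\<in>I. (\<Sum>l\<in>I. B i l * A l j) = (if i = j then 1 else 0))"

(* Entries outside I are set to 0, so that an inverse is unique as a function if it exists.
   Without an inverse the value is unspecified. *)
definition mat_inverse_on :: "'i set \<Rightarrow> ('i \<Rightarrow> 'i \<Rightarrow> 'a :: semiring_1) \<Rightarrow> 'i \<Rightarrow> 'i \<Rightarrow> 'a" where
  "mat_inverse_on I A =
     (THE B. is_mat_inverse I A B \<and> (\<forall>i j. i \<notin> I \<or> j \<notin> I \<longrightarrow> B i j = 0))"

definition B_hat :: "nat \<Rightarrow> nat \<Rightarrow> int \<Rightarrow> int \<Rightarrow> real" where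
  "B_hat n r = mat_inverse_on (index_set n) (B_tilde_mat n r)"

definition zeta_root :: "nat \<Rightarrow> complex" where
  "zeta_root n = exp (2 * of_real pi * \<i> / of_nat n)"

definition s_num :: "nat \<Rightarrow> int \<Rightarrow> complex" where
  "s_num n k = zeta_root n powi k - zeta_root n powi (- k)"

definition c_num :: "nat \<Rightarrow> int \<Rightarrow> complex" where
  "c_num n k = zeta_root n powi k + zeta_root n powi (- k)"

definition lam :: "nat \<Rightarrow> int \<Rightarrow> nat" where
  "lam n k = card {q::int. q \<ge> 3 \<and> q dvd int n \<and> [k = 1] (mod q)}"

definition rho :: "nat \<Rightarrow> nat" where
  "rho n = (if odd n then 2 else 4)"

definition s_hat :: "nat \<Rightarrow> int \<Rightarrow> complex" where
  "s_hat n k = - 1 / of_nat n *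
     (\<Sum>l\<in>index_set n. (of_nat (lam n (k * l)) - of_nat (lam n (- (k * l)))) * s_num n l)"

definition c_hat :: "nat \<Rightarrow> int \<Rightarrow> complex" where
  "c_hat n k = 1 / of_nat n *
     (\<Sum>l\<in>index_set n. of_nat (lam n (k * l) + lam n (- (k * l)) + rho n) * c_num n l)"

end

theory Submission
  imports Defs "HOL-Complex_Analysis.Complex_Analysis"
begin

text \<open>
  Write \<open>G\<close> for the units modulo \<open>n\<close>, \<open>e(x)\<close> for \<open>exp (2 \<pi> i x / n)\<close>, \<open>L a\<close> for the sum of \<open>m^-r\<close> and
  \<open>M a\<close> for the sum of \<open>\<mu>(|m|) m^-r\<close>, both over the non-zero integers \<open>m \<equiv> a (mod n)\<close>; up to a constant
  \<open>M a\<close> is the inverse cotangent number of \<open>a\<close>. Three identities on \<open>G\<close> carry the theorem.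

  \<^item> \<open>L\<close> and \<open>M\<close> are inverse to each other under multiplicative convolution, up to parity: the sum of
    \<open>L a * M b\<close> over \<open>a b = c\<close> is \<open>2\<close> at \<open>c = 1\<close>, \<open>2 (-1)^r\<close> at \<open>c = -1\<close> and \<open>0\<close> elsewhere
    (\<open>moebius_convolution\<close>). On characters this is \<open>L(r, \<psi>) * (\<Sum> \<mu>(m) \<psi>(m) m^-r) = 1\<close>.
  \<^item> The entries of the Bernoulli matrix are the values of the convolution of \<open>L\<close> with a finite exponential
    sum \<open>g\<close> (\<open>B_tilde_eq_beta\<close>). The discrete Fourier transform of the Bernoulli values \<open>B_r(k/n)\<close> is a
    multiple of \<open>L\<close>, by the partial fractions of the cotangent and its derivatives (\<open>bernoulli_dft\<close>); the
    alternating sum over the divisors \<open>d\<close> in the entry of the matrix turns the Fourier kernel into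
    \<open>g x = \<Sum>d. \<mu>(d) e(x k_d)\<close> with \<open>k_d \<equiv> 0 (mod d)\<close> and \<open>k_d \<equiv> 1 (mod n/d)\<close>. Equivalently, \<open>g x\<close> is the
    product over \<open>p dvd n\<close> of \<open>\<zeta>_p^x - 1\<close> for suitable primitive \<open>p\<close>-th roots of unity \<open>\<zeta>_p\<close>, so it vanishes
    off \<open>G\<close>.
  \<^item> \<open>g\<close> has an explicit inverse: the sum of \<open>g(x y) e(-x z)\<close> over \<open>x\<close> in \<open>G\<close> is \<open>n\<close> if \<open>y = z\<close> and \<open>0\<close>
    otherwise (\<open>moebius_exp_inversion\<close>). Also \<open>g(1/k)\<close> is the sum over \<open>l\<close> of \<open>e(l)\<close> times the number of
    divisors \<open>q\<close> of \<open>n\<close> with \<open>k l \<equiv> 1 (mod q)\<close> (\<open>moebius_exp_eq_divisor_count_sum\<close>), so that the numbers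
    \<open>s_hat\<close> and \<open>c_hat\<close> are the odd and the even part of \<open>g\<close> at the inverse of the argument.

  The first two identities give \<open>s_hat j = \<Sum>k. B_tilde(k/j) * ct_hat k\<close>, and likewise for \<open>c_hat\<close>. The first
  and the third produce an inverse of the Bernoulli matrix (\<open>is_mat_inverse_inv_mat\<close>), and applying this
  inverse isolates \<open>ct_hat 1\<close>.

  The analytic difficulty lies in the case \<open>r = 1\<close> of the first identity: the series \<open>\<Sum> \<mu>(m) \<psi>(m) / m\<close> for
  an odd character \<open>\<psi>\<close> has to converge, and to \<open>1 / L(1, \<psi>)\<close>. This has the strength of the prime number
  theorem for arithmetic progressions. It follows from Newman's Tauberian theorem (\<open>newman_tauberian\<close>) applied
  to \<open>1 / L(s, \<psi>)\<close>, once \<open>L(s, \<psi>)\<close> has no zero on the line \<open>Re s = 1\<close> (\<open>L_nonzero\<close>). For the latter, a zero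
  at \<open>1 + i \<tau>\<close> would cancel the pole of a Dirichlet series with non-negative coefficients built after
  Ramanujan, and by Landau's theorem (\<open>landau_nonneg_convergence\<close>) this series would converge too far to the
  left. This argument treats all real \<open>\<tau>\<close> at once, including \<open>\<tau> = 0\<close> with a real character.
\<close>

section \<open>Complex powers of natural numbers\<close>

text \<open>
  \<open>m\<close> to the power \<open>-s\<close>. The explicit exponential makes it entire in \<open>s\<close> for every \<open>m\<close>, without a branch of the
  logarithm.
\<close>

definition npow :: "nat \<Rightarrow> complex \<Rightarrow> complex" where
  "npow m s = exp (- (s * of_real (ln (real m))))"

lemma npow_add: "npow m (s + t) = npow m s * npow m t"
  by (simp add: npow_def exp_add [symmetric] algebra_simps)

lemma npow_one_left [simp]: "npow 1 s = 1" "npow (Suc 0) s = 1"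
  by (simp_all add: npow_def)

lemma npow_zero_right [simp]: "npow m 0 = 1"
  by (simp add: npow_def)

lemma npow_nonzero [simp]: "npow m s \<noteq> 0"
  by (simp add: npow_def)

lemma npow_mult: "m > 0 \<Longrightarrow> k > 0 \<Longrightarrow> npow (m * k) s = npow m s * npow k s"
  by (simp add: npow_def exp_add [symmetric] ln_mult algebra_simps)

lemma norm_npow: "m > 0 \<Longrightarrow> norm (npow m s) = real m powr (- Re s)"
  by (simp add: npow_def powr_def)

lemma npow_of_nat: "m > 0 \<Longrightarrow> npow m (of_nat r) = 1 / of_nat m ^ r"
proof -
  assume m: "m > 0"
  have "exp (complex_of_real (ln (real m))) = of_nat m"
    using m by (metis exp_ln exp_of_real of_nat_0_less_iff of_real_of_nat_eq)
  then show ?thesis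
    by (simp add: npow_def exp_minus exp_of_nat_mult inverse_eq_divide)
qed

lemma npow_one_right: "m > 0 \<Longrightarrow> npow m 1 = 1 / of_nat m"
  using npow_of_nat[of m 1] by simp

lemma holomorphic_npow [holomorphic_intros]:
  "f holomorphic_on S \<Longrightarrow> (\<lambda>s. npow m (f s)) holomorphic_on S"
  unfolding npow_def by (intro holomorphic_intros)

section \<open>Newman's Tauberian theorem\<close>

text \<open>
  The term of a Dirichlet series with bounded coefficients against a telescoping difference, which bounds
  its tails; the inequality \<open>1 + t \<le> exp t\<close> replaces the integral test.
\<close>

lemma powr_Suc_bound:
  assumes "m \<ge> 1" and x: "x > 0"
  shows "real (Suc m) powr (- (1 + x)) \<le> (real m powr (- x) - real (Suc m) powr (- x)) / x"
proof -
  let ?t = "ln (real (Suc m)) - ln (real m)"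
  have m: "real m > 0" using assms by simp
  have "ln (real m / real (Suc m)) \<le> real m / real (Suc m) - 1"
    using m by (intro ln_le_minus_one) auto
  also have "real m / real (Suc m) - 1 = - 1 / real (Suc m)"
    by (simp add: field_simps)
  finally have t: "1 / real (Suc m) \<le> ?t"
    using m by (simp add: ln_div)
  have "real m powr (- x) = real (Suc m) powr (- x) * exp (x * ?t)"
    using m by (simp add: powr_def exp_add [symmetric] algebra_simps)
  also have "\<dots> \<ge> real (Suc m) powr (- x) * (1 + x / real (Suc m))"
  proof (intro mult_left_mono)
    have "x / real (Suc m) \<le> x * ?t" using t x by (simp add: mult_left_mono divide_inverse)
    also have "1 + x * ?t \<le> exp (x * ?t)" by (rule exp_ge_add_one_self)
    finally show "1 + x / real (Suc m) \<le> exp (x * ?t)" by simp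
  qed simp
  finally have "real (Suc m) powr (- x) * (x / real (Suc m)) \<le> real m powr (- x) - real (Suc m) powr (- x)"
    by (simp add: algebra_simps)
  moreover have "real (Suc m) powr (- (1 + x)) = real (Suc m) powr (- x) / real (Suc m)"
    using powr_add[of "real (Suc m)" "-x" "-1"] by (simp add: powr_minus_divide add.commute)
  ultimately have "x * real (Suc m) powr (- (1 + x)) \<le> real m powr (- x) - real (Suc m) powr (- x)"
    by (simp add: mult.commute)
  then show ?thesis using x by (subst pos_le_divide_eq) (simp_all add: mult.commute)
qed

text \<open>
  Each term is at most a difference quotient of \<open>t powr y\<close> by the mean value theorem: with the interval to the
  left of the point if \<open>y \<le> 1\<close>, to its right if \<open>y \<ge> 1\<close>. The summand \<open>1 / N\<close> pays for the last term in the second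
  case.
\<close>

lemma sum_powr_bound:
  assumes "N \<ge> 1" and y: "y > 0"
  shows "(\<Sum>m<N. real (Suc m) powr (y - 1)) \<le> real N powr y * (1 / real N + 1 / y)"
proof -
  have mv: "\<exists>\<xi>. real m < \<xi> \<and> \<xi> < real (Suc m) \<and>
              real (Suc m) powr y - real m powr y = y * \<xi> powr (y - 1)" for m
  proof -
    have "\<exists>l \<xi>. real m < \<xi> \<and> \<xi> < real (Suc m) \<and> ((\<lambda>t. t powr y) has_real_derivative l) (at \<xi>) \<and>
       real (Suc m) powr y - real m powr y = (real (Suc m) - real m) * l"
    proof (rule MVT)
      show "continuous_on {real m..real (Suc m)} (\<lambda>t. t powr y)"
        using y by (intro continuous_on_powr') (auto intro!: continuous_intros)
      show "(\<lambda>t. t powr y) differentiable at x" if "real m < x" for x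
      proof -
        have "((\<lambda>t. t powr y) has_real_derivative y * x powr (y - 1)) (at x)"
          using that by (intro has_real_derivative_powr) auto
        then show ?thesis unfolding real_differentiable_def by blast
      qed
    qed simp
    then obtain l \<xi> where xi: "real m < \<xi>" "\<xi> < real (Suc m)"
       "((\<lambda>t. t powr y) has_real_derivative l) (at \<xi>)" "real (Suc m) powr y - real m powr y = l"
      by auto
    have "((\<lambda>t. t powr y) has_real_derivative y * \<xi> powr (y - 1)) (at \<xi>)"
      using xi by (intro has_real_derivative_powr) auto
    with xi have "l = y * \<xi> powr (y - 1)" using DERIV_unique by blast
    with xi show ?thesis by blast
  qed
  show ?thesis
  proof (cases "y \<le> 1")
    case True
    have "(\<Sum>m<N. real (Suc m) powr (y - 1)) \<le> (\<Sum>m<N. (real (Suc m) powr y - real m powr y) / y)"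
    proof (rule sum_mono)
      fix m
      obtain \<xi> where xi: "real m < \<xi>" "\<xi> < real (Suc m)"
          "real (Suc m) powr y - real m powr y = y * \<xi> powr (y - 1)" using mv by blast
      have "real (Suc m) powr (y - 1) \<le> \<xi> powr (y - 1)"
        using xi True by (intro powr_mono2') auto
      then show "real (Suc m) powr (y - 1) \<le> (real (Suc m) powr y - real m powr y) / y"
        using xi y by simp
    qed
    also have "\<dots> = real N powr y / y"
      using y by (subst sum_divide_distrib [symmetric], subst sum_lessThan_telescope) simp
    also have "\<dots> \<le> real N powr y * (1 / real N + 1 / y)"
      by (simp add: algebra_simps)
    finally show ?thesis .
  next
    case False
    from \<open>N \<ge> 1\<close> obtain M where N: "N = Suc M" by (cases N) auto
    have "(\<Sum>m<M. real (Suc m) powr (y - 1)) \<le> (\<Sum>m<M. (real (Suc (Suc m)) powr y - real (Suc m) powr y) / y)"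
    proof (rule sum_mono)
      fix m
      obtain \<xi> where xi: "real (Suc m) < \<xi>" "\<xi> < real (Suc (Suc m))"
          "real (Suc (Suc m)) powr y - real (Suc m) powr y = y * \<xi> powr (y - 1)" using mv by blast
      have "real (Suc m) powr (y - 1) \<le> \<xi> powr (y - 1)"
        using xi False by (intro powr_mono2) auto
      then show "real (Suc m) powr (y - 1) \<le> (real (Suc (Suc m)) powr y - real (Suc m) powr y) / y"
        using xi y by simp
    qed
    also have "\<dots> = (real N powr y - 1) / y"
      using y by (subst sum_divide_distrib [symmetric], subst sum_lessThan_telescope) (simp add: N)
    also have "\<dots> \<le> real N powr y / y" using y by (simp add: divide_right_mono)
    finally have "(\<Sum>m<N. real (Suc m) powr (y - 1)) \<le> real N powr y / y + real N powr (y - 1)"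
      by (simp add: N)
    also have "\<dots> = real N powr y * (1 / real N + 1 / y)"
      using N by (simp add: algebra_simps powr_diff)
    finally show ?thesis .
  qed
qed

lemma part_circlepath_shift:
  "part_circlepath z r (a + 2 * pi) (b + 2 * pi) = part_circlepath z r a b"
proof
  fix x
  have "exp (\<i> * of_real (linepath (a + 2 * pi) (b + 2 * pi) x)) =
        exp (\<i> * of_real (linepath a b x) + 2 * of_real pi * \<i>)"
    by (rule arg_cong[of _ _ exp]) (simp add: linepath_def algebra_simps)
  then show "part_circlepath z r (a + 2 * pi) (b + 2 * pi) x = part_circlepath z r a b x"
    by (simp add: part_circlepath_def exp_add)
qed

text \<open>
  The circle is cut at \<open>\<plusminus>iR\<close> so that the real part has constant sign on each half.
\<close>

lemma contour_integral_circle_halves: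
  assumes f: "continuous_on (sphere 0 R) f" and R: "R > 0"
  shows "contour_integral (circlepath 0 R) f =
    contour_integral (part_circlepath 0 R (-pi/2) (pi/2)) f +
    contour_integral (part_circlepath 0 R (pi/2) (3*pi/2)) f"
proof -
  define \<phi> where "\<phi> = (\<lambda>t. f (0 + of_real R * cis t) * of_real R * \<i> * cis t)"
  have cont: "continuous_on S \<phi>" for S
    unfolding \<phi>_def
    by (intro continuous_intros continuous_on_compose2[OF f]) (use R in \<open>auto simp: norm_mult\<close>)
  have int: "\<phi> integrable_on {a..b}" for a b
    by (intro integrable_continuous_real cont)
  have eq: "contour_integral (part_circlepath 0 R a b) f = integral {a..b} \<phi>" if "a < b" for a b
    unfolding \<phi>_def using contour_integral_part_circlepath_eq[OF that, of 0 R f] by simp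
  have "integral {3*pi/2..2*pi} \<phi> = integral {-pi/2..0} \<phi>"
    using part_circlepath_shift[of 0 R "-pi/2" 0] pi_gt_zero
      eq[of "3*pi/2" "2*pi"] eq[of "-pi/2" 0] by simp
  moreover have "integral {0..2*pi} \<phi> = integral {0..pi/2} \<phi> + integral {pi/2..2*pi} \<phi>"
    by (rule Henstock_Kurzweil_Integration.integral_combine [symmetric]) (use int pi_gt_zero in auto)
  moreover have "integral {pi/2..2*pi} \<phi> = integral {pi/2..3*pi/2} \<phi> + integral {3*pi/2..2*pi} \<phi>"
    by (rule Henstock_Kurzweil_Integration.integral_combine [symmetric]) (use int pi_gt_zero in auto)
  moreover have "integral {-pi/2..pi/2} \<phi> = integral {-pi/2..0} \<phi> + integral {0..pi/2} \<phi>"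
    by (rule Henstock_Kurzweil_Integration.integral_combine [symmetric]) (use int pi_gt_zero in auto)
  ultimately show ?thesis
    using pi_gt_zero by (simp add: eq circlepath_def)
qed

text \<open>
  On the circle \<open>1 / z\<close> is \<open>cnj z / R^2\<close>, so the kernel is a real multiple of \<open>Re z\<close>. It cancels the
  factor \<open>1 / Re z\<close> in the bounds for the tails and the partial sums of a Dirichlet series.
\<close>

lemma newman_kernel_norm:
  assumes "norm z = R" "R > 0"
  shows "norm (1 / z + z / of_real (R^2)) = 2 * \<bar>Re z\<bar> / R^2"
proof -
  have nz: "z \<noteq> 0" using assms by auto
  have zz: "z * cnj z = of_real (R^2)"
    using assms complex_norm_square[of z] by simp
  have "1 / z = cnj z / of_real (R^2)"
    using nz by (simp add: zz [symmetric] del: of_real_power)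
  then have "1 / z + z / of_real (R^2) = of_real (2 * Re z) / of_real (R^2)"
    using complex_add_cnj[of z] by (simp add: add_divide_distrib [symmetric] add.commute)
  then show ?thesis using assms by (simp add: norm_divide norm_mult norm_power)
qed


text \<open>
  Newman's contour argument, in the case where the limit function vanishes at \<open>1\<close>. The \<open>N\<close>-th partial sum
  at \<open>1\<close> is written, by Cauchy's formula, as an integral over the circle of radius \<open>R\<close> against
  \<open>N^z (1/z + z/R^2)\<close>. On the left half circle the partial sum itself is small, on the right half circle its
  difference to \<open>F\<close> is; both errors are \<open>O(1/R)\<close> by the choice of the kernel. The remaining integral
  of \<open>F\<close> over the right half circle can be moved to the imaginary axis, where it tends to \<open>0\<close> by partial
  integration as \<open>N\<close> grows. Since \<open>F 1 = 0\<close>, the integrand has no pole at the origin.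
\<close>

lemma newman_vanishing:
  fixes a :: "nat \<Rightarrow> complex"
  assumes bound: "\<And>m. norm (a m) \<le> C" and an: "F analytic_on {s. Re s \<ge> 1}"
    and sums: "\<And>s. Re s > 1 \<Longrightarrow> (\<lambda>m. a m * npow (Suc m) s) sums F s" and F1: "F 1 = 0"
  shows "(\<lambda>m. a m * npow (Suc m) 1) sums 0"
proof -
  have C: "C \<ge> 0" using bound[of 0] norm_ge_zero order_trans by blast
  define S where "S = (\<lambda>N z. \<Sum>m<N. a m * npow (Suc m) (1 + z))"
  define G where "G = (\<lambda>z. F (1 + z))"
  have Gan: "G analytic_on {z. Re z \<ge> 0}"
  proof -
    have "(F \<circ> (\<lambda>z. 1 + z)) analytic_on {z. Re z \<ge> 0}"
      by (intro analytic_on_compose_gen[OF _ an] analytic_intros) auto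
    then show ?thesis by (simp add: G_def o_def)
  qed
  \<comment> \<open>\<open>G z / z\<close>, with its removable singularity filled in.\<close>
  define H where "H = (\<lambda>z. if z = 0 then deriv G 0 else G z / z)"
  have Han: "H analytic_on {z. Re z \<ge> 0}"
    by (rule pole_theorem_analytic_0[OF Gan, of 0]) (auto simp: H_def G_def F1 intro!: exI[of _ 1])
  have S_hol: "S N holomorphic_on X" for N X
    unfolding S_def by (intro holomorphic_intros)
  have tail: "norm (G z - S N z) \<le> C * (real N powr (- Re z) / Re z)" if x: "Re z > 0" and N: "N \<ge> 1" for z N
  proof -
    let ?x = "Re z"
    let ?b = "\<lambda>m. C * ((real (m + N) powr (- ?x) - real (Suc m + N) powr (- ?x)) / ?x)"
    have "(\<lambda>m. a m * npow (Suc m) (1 + z)) sums G z"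
      unfolding G_def using x by (intro sums) simp
    then have 1: "(\<lambda>m. a (m + N) * npow (Suc (m + N)) (1 + z)) sums (G z - S N z)"
      unfolding S_def by (rule sums_split_initial_segment)
    have "(\<lambda>m. real m powr (- ?x)) \<longlonglongrightarrow> 0"
      using x by (intro tendsto_neg_powr filterlim_real_sequentially) auto
    then have "(\<lambda>m. real (m + N) powr (- ?x)) \<longlonglongrightarrow> 0"
      by (rule LIMSEQ_ignore_initial_segment)
    then have "(\<lambda>m. real (m + N) powr (- ?x) - real (Suc m + N) powr (- ?x)) sums (real (0 + N) powr (- ?x) - 0)"
      by (rule telescope_sums')
    then have 2: "?b sums (C * ((real N powr (- ?x)) / ?x))"
      by (intro sums_mult sums_divide) simp
    have 3: "norm (a (m + N) * npow (Suc (m + N)) (1 + z)) \<le> ?b m" for m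
    proof -
      have "norm (npow (Suc (m + N)) (1 + z)) \<le> (real (m + N) powr (- ?x) - real (Suc (m + N)) powr (- ?x)) / ?x"
        using powr_Suc_bound[of "m + N" ?x] x N by (subst norm_npow) (auto simp: algebra_simps)
      then show ?thesis using bound[of "m + N"] C
        unfolding norm_mult by (intro mult_mono) auto
    qed
    have "norm (\<Sum>m. a (m + N) * npow (Suc (m + N)) (1 + z)) \<le> suminf ?b"
      by (rule norm_suminf_le[OF 3]) (use 2 sums_summable in blast)
    then show ?thesis using 1 2 by (simp add: sums_iff)
  qed
  have head: "norm (S N z) \<le> C * (real N powr y * (1 / real N + 1 / y))"
    if y: "y = - Re z" "y > 0" and N: "N \<ge> 1" for z N y
  proof -
    have "norm (S N z) \<le> (\<Sum>m<N. C * real (Suc m) powr (y - 1))"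
      unfolding S_def
    proof (rule sum_norm_le)
      fix m
      have "norm (npow (Suc m) (1 + z)) = real (Suc m) powr (y - 1)"
        using y by (subst norm_npow) (auto intro!: arg_cong2[where f = "(powr)"])
      then show "norm (a m * npow (Suc m) (1 + z)) \<le> C * real (Suc m) powr (y - 1)"
        using bound[of m] by (simp add: norm_mult mult_right_mono)
    qed
    also have "\<dots> \<le> C * (real N powr y * (1 / real N + 1 / y))"
      unfolding sum_distrib_left [symmetric] by (intro mult_left_mono sum_powr_bound C that)
    finally show ?thesis .
  qed
  have main: "\<exists>K. \<forall>N\<ge>2. norm (S N 0) \<le> 2 * C / R + C / real N + K / ln (real N)" if R: "R > 0" for R
  proof -
    define H1 where "H1 = (\<lambda>z. H z * (1 + z ^ 2 / of_real (R^2)))"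
    have H1an: "H1 analytic_on {z. Re z \<ge> 0}"
      unfolding H1_def using R by (intro analytic_intros Han) auto
    define A where "A = part_circlepath 0 R (-pi/2) (pi/2)"
    define A' where "A' = part_circlepath 0 R (pi/2) (3*pi/2)"
    let ?p = "\<i> * of_real R" and ?q = "- (\<i> * of_real R)"
    have [simp]: "pathstart A = ?q" "pathfinish A = ?p" "valid_path A" "valid_path A'"
      by (simp_all add: A_def A'_def exp_eq_polar cis_conv_exp [symmetric] complex_eq_iff)
    have A_pts: "norm z = R" "Re z \<ge> 0" if "z \<in> path_image A" for z
      using that R pi_gt_zero unfolding A_def
      by (auto simp: path_image_part_circlepath norm_mult cis_conv_exp [symmetric] intro!: mult_nonneg_nonneg cos_ge_zero)
    have A'_pts: "norm z = R" "Re z \<le> 0" if "z \<in> path_image A'" for z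
    proof -
      from that obtain t where t: "z = of_real R * cis t" "pi/2 \<le> t" "t \<le> 3*pi/2"
        using R pi_gt_zero unfolding A'_def
        by (auto simp: path_image_part_circlepath cis_conv_exp [symmetric])
      have "cos (t - pi) \<ge> 0" using t by (intro cos_ge_zero) auto
      then show "norm z = R" "Re z \<le> 0" using t R by (auto simp: norm_mult mult_nonneg_nonpos)
    qed
    define W where "W = (\<lambda>N z. npow N (-z) * (1 / z + z / of_real (R^2)))"
    have W_norm: "norm (W N z) = real N powr (Re z) * (2 * \<bar>Re z\<bar> / R^2)" if "N \<ge> 1" "norm z = R" for N z
      unfolding W_def norm_mult using newman_kernel_norm[OF that(2) R] that by (simp add: norm_npow)
    have W_cont: "continuous_on (sphere 0 R) (W N)" for N
      unfolding W_def npow_def using R by (intro continuous_intros) auto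
    have S_cont: "continuous_on X (S N)" for X N
      using S_hol holomorphic_on_imp_continuous_on by blast
    have imagpt: "z \<in> {?p, ?q}" if "norm z = R" "Re z = 0" for z
      using that R by (auto simp: complex_eq_iff cmod_def)
    have seg: "closed_segment a b \<subseteq> {z. Re z \<ge> 0}" if "a \<in> {?p, ?q}" "b \<in> {?p, ?q}" for a b
      by (rule closed_segment_subset) (use that in \<open>auto intro: convex_halfspace_Re_ge\<close>)
    define I where "I = (\<lambda>N z. H1 z * npow N (-z))"
    have Ian: "I N analytic_on {z. Re z \<ge> 0}" for N
      unfolding I_def npow_def by (intro analytic_intros H1an)
    have Icont: "continuous_on X (I N)" if "X \<subseteq> {z. Re z \<ge> 0}" for X N
      using Ian analytic_imp_holomorphic holomorphic_on_imp_continuous_on continuous_on_subset that by blast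
    have GW: "G z * W N z = I N z" if "z \<in> path_image A" for N z
    proof -
      have "z \<noteq> 0" using A_pts[OF that] R by auto
      then show ?thesis using R by (simp add: W_def I_def H1_def H_def field_simps power2_eq_square)
    qed
    have A_sub: "path_image A \<subseteq> {z. Re z \<ge> 0}" "path_image A \<subseteq> sphere 0 R"
      using A_pts by auto
    have A'_sub: "path_image A' \<subseteq> sphere 0 R"
      using A'_pts by auto
    have J: "contour_integral A (I N) = contour_integral (linepath ?q ?p) (I N)" for N
    proof -
      have iA: "I N contour_integrable_on A"
        unfolding A_def by (rule contour_integrable_continuous_part_circlepath)
          (use A_sub Icont in \<open>auto simp: A_def\<close>)
      have iL: "I N contour_integrable_on linepath ?p ?q"
        by (rule contour_integrable_continuous_linepath) (rule Icont, rule seg, auto)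
      have "(I N has_contour_integral 0) (A +++ linepath ?p ?q)"
      proof (rule Cauchy_theorem_convex_simple)
        show "I N holomorphic_on {z. Re z \<ge> 0}" by (rule analytic_imp_holomorphic[OF Ian])
        show "path_image (A +++ linepath ?p ?q) \<subseteq> {z. Re z \<ge> 0}"
          using A_sub seg[of ?p ?q] by (simp add: path_image_join)
      qed (auto intro: convex_halfspace_Re_ge)
      then have "contour_integral A (I N) + contour_integral (linepath ?p ?q) (I N) = 0"
        using iA iL by (metis contour_integral_join contour_integral_unique valid_path_linepath \<open>valid_path A\<close>)
      moreover have "contour_integral (linepath ?p ?q) (I N) = - contour_integral (linepath ?q ?p) (I N)"
        by (metis contour_integral_reversepath reversepath_linepath valid_path_linepath)
      ultimately show ?thesis by simp
    qed
    have dH1: "(H1 has_field_derivative deriv H1 z) (at z)" if "Re z \<ge> 0" for z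
      using H1an that by (metis analytic_on_imp_differentiable_at field_differentiable_derivI mem_Collect_eq)
    have dH1cont: "continuous_on (closed_segment ?q ?p) (deriv H1)"
      using analytic_deriv[OF H1an] seg[of ?q ?p]
      by (meson analytic_imp_holomorphic continuous_on_subset holomorphic_on_imp_continuous_on insertCI)
    obtain K where K: "\<And>z. z \<in> closed_segment ?q ?p \<Longrightarrow> norm (deriv H1 z) \<le> K" "K \<ge> 0"
    proof -
      have "compact (deriv H1 ` closed_segment ?q ?p)"
        by (intro compact_continuous_image dH1cont) auto
      then obtain K where "\<forall>x\<in>deriv H1 ` closed_segment ?q ?p. norm x \<le> K"
        using compact_imp_bounded bounded_iff by metis
      then show ?thesis using that[of "max K 0"] by (meson image_eqI max.cobounded1 max.cobounded2 order_trans)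
    qed
    define M where "M = norm (H1 ?p) + norm (H1 ?q) + K * (2 * R)"
    have Jbound: "norm (contour_integral (linepath ?q ?p) (I N)) \<le> M / ln (real N)" if N: "N \<ge> 2" for N
    proof -
      let ?L = "of_real (ln (real N)) :: complex"
      have L: "ln (real N) > 0" using N by simp
      define D where "D = (\<lambda>z. deriv H1 z * npow N (-z) / ?L)"
      have nrm1: "norm (npow N (-z)) = 1" if "z \<in> closed_segment ?q ?p" for z
      proof -
        have "z \<in> {z. Re z = 0}"
          using that by (auto simp: closed_segment_def)
        then show ?thesis using N by (simp add: norm_npow)
      qed
      \<comment> \<open>Partial integration: \<open>I + D\<close> is the derivative of \<open>H1 z * N^z / ln N\<close>.\<close>
      have int1: "((\<lambda>z. I N z + D z) has_contour_integral
            (H1 ?p * npow N (- ?p) / ?L - H1 ?q * npow N (- ?q) / ?L)) (linepath ?q ?p)"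
      proof -
        have "((\<lambda>z. I N z + D z) has_contour_integral
            ((\<lambda>z. H1 z * npow N (- z) / ?L) (pathfinish (linepath ?q ?p)) -
             (\<lambda>z. H1 z * npow N (- z) / ?L) (pathstart (linepath ?q ?p)))) (linepath ?q ?p)"
        proof (rule contour_integral_primitive)
          fix z assume "z \<in> closed_segment ?q ?p"
          then have "Re z \<ge> 0" using seg[of ?q ?p] by auto
          have "((\<lambda>z. H1 z * npow N (- z) / ?L) has_field_derivative I N z + D z) (at z)"
          proof -
            have "((\<lambda>z. npow N (-z)) has_field_derivative npow N (-z) * ?L) (at z)"
              unfolding npow_def by (auto intro!: derivative_eq_intros)
            from DERIV_cdivide[OF DERIV_mult[OF dH1[OF \<open>Re z \<ge> 0\<close>] this], of ?L]
            show ?thesis using L by (simp add: I_def D_def field_simps)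
          qed
          then show "((\<lambda>z. H1 z * npow N (- z) / ?L) has_field_derivative I N z + D z) (at z within closed_segment ?q ?p)"
            by (rule has_field_derivative_at_within)
        qed auto
        then show ?thesis by simp
      qed
      have Dint: "D contour_integrable_on linepath ?q ?p"
        unfolding D_def npow_def
        by (intro contour_integrable_continuous_linepath continuous_intros dH1cont) (use L in auto)
      have Dbound: "norm (contour_integral (linepath ?q ?p) D) \<le> K / ln (real N) * norm (?p - ?q)"
      proof (rule contour_integral_bound_linepath[OF Dint])
        fix z assume z: "z \<in> closed_segment ?q ?p"
        show "norm (D z) \<le> K / ln (real N)"
          using K(1)[OF z] nrm1[OF z] L by (simp add: D_def norm_mult norm_divide divide_right_mono)
      qed (use K L in auto)
      have "norm (?p - ?q) = 2 * R"
        using R by (simp add: norm_mult mult_2 [symmetric] del: mult_2)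
      note Dbound = Dbound[unfolded this]
      have "((\<lambda>z. I N z + D z - D z) has_contour_integral
            (H1 ?p * npow N (- ?p) / ?L - H1 ?q * npow N (- ?q) / ?L) - contour_integral (linepath ?q ?p) D) (linepath ?q ?p)"
        by (intro has_contour_integral_diff int1 has_contour_integral_integral Dint)
      then have "contour_integral (linepath ?q ?p) (I N) =
          (H1 ?p * npow N (- ?p) / ?L - H1 ?q * npow N (- ?q) / ?L) - contour_integral (linepath ?q ?p) D"
        by (simp add: contour_integral_unique)
      also have "norm \<dots> \<le> norm (H1 ?p * npow N (- ?p) / ?L) + norm (H1 ?q * npow N (- ?q) / ?L) + K / ln (real N) * (2 * R)"
        by (rule order_trans[OF norm_triangle_ineq4] add_mono norm_triangle_ineq4 Dbound)+
      also have "\<dots> = M / ln (real N)"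
        using nrm1[of ?p] nrm1[of ?q] L
        by (simp add: norm_mult norm_divide M_def add_divide_distrib)
      finally show ?thesis .
    qed
    have est: "norm (2 * of_real pi * \<i> * S N 0) \<le> (2 * C / R^2) * R * pi + (2 * C / (real N * R) + 2 * C / R^2) * R * pi + M / ln (real N)"
      if N: "N \<ge> 2" for N
    proof -
      have SWc: "continuous_on (sphere 0 R) (\<lambda>z. S N z * W N z)"
        by (intro continuous_intros S_cont W_cont)
      have "((\<lambda>z. (S N z * npow N (-z) * (1 + z^2 / of_real (R^2))) / (z - 0)) has_contour_integral
          2 * of_real pi * \<i> * (S N 0 * npow N (-0) * (1 + 0^2 / of_real (R^2)))) (circlepath 0 R)"
        by (rule Cauchy_integral_circlepath_simple) (use R in \<open>auto intro!: holomorphic_intros S_hol\<close>)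
      then have "((\<lambda>z. S N z * W N z) has_contour_integral 2 * of_real pi * \<i> * S N 0) (circlepath 0 R)"
        using R by (rule_tac has_contour_integral_eq[where f = "\<lambda>z. (S N z * npow N (-z) * (1 + z^2 / of_real (R^2))) / (z - 0)"])
          (auto simp: W_def field_simps power2_eq_square)
      then have "2 * of_real pi * \<i> * S N 0 = contour_integral (circlepath 0 R) (\<lambda>z. S N z * W N z)"
        by (simp add: contour_integral_unique)
      also have "\<dots> = contour_integral A (\<lambda>z. S N z * W N z) + contour_integral A' (\<lambda>z. S N z * W N z)"
        unfolding A_def A'_def by (rule contour_integral_circle_halves[OF SWc R])
      finally have eq1: "2 * of_real pi * \<i> * S N 0 = contour_integral A (\<lambda>z. S N z * W N z) + contour_integral A' (\<lambda>z. S N z * W N z)" .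
      have Sint: "(\<lambda>z. S N z * W N z) contour_integrable_on A"
        unfolding A_def by (rule contour_integrable_continuous_part_circlepath)
          (use A_sub SWc continuous_on_subset in \<open>auto simp: A_def\<close>)
      have Iint: "I N contour_integrable_on A"
        unfolding A_def by (rule contour_integrable_continuous_part_circlepath)
          (use A_sub Icont in \<open>auto simp: A_def\<close>)
      have Dint: "(\<lambda>z. I N z - S N z * W N z) contour_integrable_on A"
        by (rule contour_integrable_diff[OF Iint Sint])
      have "contour_integral A (\<lambda>z. S N z * W N z) =
            contour_integral A (I N) - contour_integral A (\<lambda>z. I N z - S N z * W N z)"
        by (subst contour_integral_diff[OF Iint Sint]) simp
      note eq2 = eq1[unfolded this J]
      have b1: "norm (contour_integral A (\<lambda>z. I N z - S N z * W N z)) \<le> (2 * C / R^2) * R * (pi/2 - (-pi/2))"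
        unfolding A_def
      proof (rule contour_integral_bound_part_circlepath_strong[OF Dint[unfolded A_def], where k = "{?p, ?q}"])
        fix z assume "z \<in> path_image (part_circlepath 0 R (- pi / 2) (pi / 2)) - {?p, ?q}"
        then have zA: "z \<in> path_image A" and nz: "z \<notin> {?p, ?q}" by (auto simp: A_def)
        have x: "Re z > 0" using A_pts[OF zA] imagpt[of z] nz by force
        have "norm (I N z - S N z * W N z) = norm (G z - S N z) * norm (W N z)"
          by (simp add: GW[OF zA, symmetric] norm_mult [symmetric] algebra_simps)
        also have "\<dots> \<le> (C * (real N powr (- Re z) / Re z)) * (real N powr (Re z) * (2 * \<bar>Re z\<bar> / R^2))"
          using tail[OF x, of N] W_norm[of N z] A_pts[OF zA] N x C by (intro mult_mono) auto
        also have "\<dots> = 2 * C / R^2"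
          using x N by (simp add: powr_minus field_simps)
        finally show "norm (I N z - S N z * W N z) \<le> 2 * C / R^2" .
      qed (use C R in auto)
      have Sint': "(\<lambda>z. S N z * W N z) contour_integrable_on A'"
        unfolding A'_def by (rule contour_integrable_continuous_part_circlepath)
          (use A'_sub SWc continuous_on_subset in \<open>auto simp: A'_def\<close>)
      have b2: "norm (contour_integral A' (\<lambda>z. S N z * W N z)) \<le> (2 * C / (real N * R) + 2 * C / R^2) * R * (3*pi/2 - pi/2)"
        unfolding A'_def
      proof (rule contour_integral_bound_part_circlepath_strong[OF Sint'[unfolded A'_def], where k = "{?p, ?q}"])
        fix z assume "z \<in> path_image (part_circlepath 0 R (pi / 2) (3 * pi / 2)) - {?p, ?q}"
        then have zA: "z \<in> path_image A'" and nz: "z \<notin> {?p, ?q}" by (auto simp: A'_def)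
        define y where "y = - Re z"
        have y: "y > 0" using A'_pts[OF zA] imagpt[of z] nz unfolding y_def by force
        have yR: "y \<le> R" using A'_pts[OF zA] abs_Re_le_cmod[of z] unfolding y_def by linarith
        have "norm (S N z * W N z) \<le> (C * (real N powr y * (1 / real N + 1 / y))) * (real N powr (Re z) * (2 * \<bar>Re z\<bar> / R^2))"
          unfolding norm_mult using head[OF y_def y, of N] W_norm[of N z] A'_pts[OF zA] N y C by (intro mult_mono) (auto intro!: mult_nonneg_nonneg divide_nonpos_nonneg mult_nonneg_nonpos)
        also have "\<dots> = 2 * C / R^2 * (y / real N + 1)"
          using y N R by (simp add: y_def powr_minus field_simps)
        also have "\<dots> \<le> 2 * C / R^2 * (R / real N + 1)"
          using y yR C R N by (intro mult_left_mono add_right_mono divide_right_mono) auto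
        also have "\<dots> = 2 * C / (real N * R) + 2 * C / R^2"
          using R N by (simp add: field_simps power2_eq_square)
        finally show "norm (S N z * W N z) \<le> 2 * C / (real N * R) + 2 * C / R^2" .
      qed (use C R N in auto)
      have "norm (2 * of_real pi * \<i> * S N 0) \<le>
        norm (contour_integral (linepath ?q ?p) (I N)) + norm (contour_integral A (\<lambda>z. I N z - S N z * W N z))
         + norm (contour_integral A' (\<lambda>z. S N z * W N z))"
        unfolding eq2 by (intro order_trans[OF norm_triangle_ineq] add_right_mono norm_triangle_ineq4)
      then show ?thesis
        using b1 b2 Jbound[OF N] by simp
    qed
    show ?thesis
    proof (intro exI allI impI)
      fix N :: nat assume N: "N \<ge> 2"
      have "norm (2 * of_real pi * \<i> * S N 0) = 2 * pi * norm (S N 0)"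
        using pi_gt_zero by (simp add: norm_mult)
      then have "2 * pi * norm (S N 0) \<le> 2 * pi * (2 * C / R + C / real N + (M / (2 * pi)) / ln (real N))"
      proof -
        have "(2 * C / R^2) * R * pi = 2 * pi * (C / R)"
          "(2 * C / (real N * R) + 2 * C / R^2) * R * pi = 2 * pi * (C / real N + C / R)"
          "M / ln (real N) = 2 * pi * ((M / (2 * pi)) / ln (real N))"
          using R N by (simp_all add: field_simps power2_eq_square)
        then have "norm (2 * of_real pi * \<i> * S N 0) \<le>
           2 * pi * (C / R) + 2 * pi * (C / real N + C / R) + 2 * pi * ((M / (2 * pi)) / ln (real N))"
          using est[OF N] by (simp only:)
        also have "\<dots> = 2 * pi * (2 * C / R + C / real N + (M / (2 * pi)) / ln (real N))"
          by (simp only: distrib_left) simp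
        finally show ?thesis using \<open>norm (2 * of_real pi * \<i> * S N 0) = 2 * pi * norm (S N 0)\<close> by simp
      qed
      then show "norm (S N 0) \<le> 2 * C / R + C / real N + (M / (2 * pi)) / ln (real N)"
        using pi_gt_zero by simp
    qed
  qed
  have "(\<lambda>N. S N 0) \<longlonglongrightarrow> 0"
  proof (rule LIMSEQ_I)
    fix e :: real assume e: "e > 0"
    \<comment> \<open>The bound tends to \<open>2 * C / R\<close> as \<open>N\<close> grows; this \<open>R\<close> makes it smaller than \<open>e\<close>.\<close>
    define R where "R = 4 * C / e + 1"
    have R: "R > 0" using C e by (simp add: R_def add_nonneg_pos)
    have CR: "2 * C / R < e"
    proof -
      have "2 * C < e * R" using e C by (simp add: R_def algebra_simps)
      then show ?thesis using R e by (simp add: field_simps)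
    qed
    obtain K where K: "\<And>N. N \<ge> 2 \<Longrightarrow> norm (S N 0) \<le> 2 * C / R + C / real N + K / ln (real N)"
      using main[OF R] by blast
    have "(\<lambda>N. 2 * C / R + C / real N + K / ln (real N)) \<longlonglongrightarrow> 2 * C / R + 0 + 0"
      by (intro tendsto_add tendsto_const tendsto_divide_0[OF tendsto_const]
           filterlim_at_top_imp_at_infinity[OF filterlim_real_sequentially]
           filterlim_at_top_imp_at_infinity[OF filterlim_compose[OF ln_at_top filterlim_real_sequentially]])
    then have "\<forall>\<^sub>F N in sequentially. 2 * C / R + C / real N + K / ln (real N) < e"
      by (rule order_tendstoD) (use CR in simp)
    then have "\<forall>\<^sub>F N in sequentially. norm (S N 0 - 0) < e"
      using eventually_ge_at_top[of 2]
      by eventually_elim (use K in force)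
    then show "\<exists>no. \<forall>n\<ge>no. norm (S n 0 - 0) < e"
      by (simp add: eventually_sequentially)
  qed
  then show ?thesis by (simp add: sums_def S_def)
qed

text \<open>
  Subtracting the constant \<open>F 1\<close> changes only the coefficient of \<open>1\<close> and reduces the statement to a limit
  function that vanishes at \<open>1\<close>.
\<close>

theorem newman_tauberian:
  fixes a :: "nat \<Rightarrow> complex"
  assumes bound: "\<And>m. norm (a m) \<le> C" and an: "F analytic_on {s. Re s \<ge> 1}"
    and sums: "\<And>s. Re s > 1 \<Longrightarrow> (\<lambda>m. a m * npow (Suc m) s) sums F s"
  shows "(\<lambda>m. a m * npow (Suc m) 1) sums F 1"
proof -
  define b where "b = a(0 := a 0 - F 1)"
  have b: "b m * npow (Suc m) s = a m * npow (Suc m) s - (if m = 0 then F 1 else 0)" for m s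
    by (simp add: b_def algebra_simps)
  have 1: "(\<lambda>m::nat. if m = 0 then F 1 else 0) sums F 1"
    using sums_single[of 0 "\<lambda>_. F 1"] by simp
  have "(\<lambda>m. b m * npow (Suc m) 1) sums 0"
  proof (rule newman_vanishing)
    show "norm (b m) \<le> C + norm (F 1)" for m
      using bound[of m] norm_triangle_ineq4[of "a 0" "F 1"] norm_ge_zero[of "F 1"]
      by (cases "m = 0") (simp_all add: b_def del: norm_ge_zero)
    show "(\<lambda>s. F s - F 1) analytic_on {s. Re s \<ge> 1}"
      by (intro analytic_intros an)
    show "(\<lambda>m. b m * npow (Suc m) s) sums (F s - F 1)" if "Re s > 1" for s
      unfolding b by (intro sums_diff sums 1 that)
  qed simp
  then have "(\<lambda>m. b m * npow (Suc m) 1 + (if m = 0 then F 1 else 0)) sums (0 + F 1)"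
    by (rule sums_add[OF _ 1])
  then show ?thesis unfolding b by simp
qed

section \<open>Dirichlet series with bounded partial sums\<close>

lemma norm_one_minus_exp_le:
  fixes z :: complex
  assumes "Re z \<le> 0"
  shows "norm (1 - exp z) \<le> norm z"
proof -
  have "norm (exp 0 - exp z) \<le> 1 * norm (0 - z)"
  proof (rule field_differentiable_bound[where S = "{z. Re z \<le> 0}" and f' = exp])
    show "(exp has_field_derivative exp z) (at z within {z. Re z \<le> 0})" for z :: complex
      by (rule DERIV_exp[THEN has_field_derivative_at_within])
  qed (use assms convex_halfspace_Re_le[of 0] in auto)
  then show ?thesis by simp
qed

lemma npow_diff_bound:
  assumes m: "m \<ge> 1" and s: "Re s > 0"
  shows "norm (npow m s - npow (Suc m) s) \<le> norm s * real m powr (- Re s - 1)"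
proof -
  let ?d = "ln (real (Suc m)) - ln (real m)"
  have m': "real m > 0" using m by simp
  have d0: "?d \<ge> 0" using m by simp
  have "?d = ln (real (Suc m) / real m)" using m' by (simp add: ln_div)
  also have "\<dots> \<le> real (Suc m) / real m - 1"
    using m' by (intro ln_le_minus_one) auto
  also have "\<dots> = 1 / real m" using m' by (simp add: field_simps)
  finally have d: "?d \<le> 1 / real m" .
  have "npow (Suc m) s = npow m s * exp (- (s * of_real ?d))"
    by (simp add: npow_def exp_add [symmetric] algebra_simps)
  then have "norm (npow m s - npow (Suc m) s) = norm (npow m s) * norm (1 - exp (- (s * of_real ?d)))"
    by (simp add: norm_mult [symmetric] algebra_simps)
  also have "\<dots> \<le> norm (npow m s) * norm (- (s * of_real ?d))"
    using s d0 by (intro mult_left_mono norm_one_minus_exp_le) auto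
  also have "\<dots> \<le> norm (npow m s) * (norm s * (1 / real m))"
  proof (intro mult_left_mono)
    have "norm (- (s * of_real ?d)) = norm s * ?d"
      using d0 by (simp add: norm_mult del: of_real_diff)
    also have "\<dots> \<le> norm s * (1 / real m)" using d by (rule mult_left_mono) simp
    finally show "norm (- (s * of_real ?d)) \<le> norm s * (1 / real m)" .
  qed simp
  also have "\<dots> = norm s * real m powr (- Re s - 1)"
    using m' by (simp add: norm_npow powr_diff)
  finally show ?thesis .
qed

context
  fixes u :: "nat \<Rightarrow> complex" and C :: real
  assumes bounded: "\<And>M. norm (\<Sum>m<M. u m) \<le> C"
begin

text \<open>
  Summation by parts: the differences of \<open>npow\<close> decay one power faster, so the new series converges
  absolutely to the right of \<open>0\<close>.
\<close>

lemma dirichlet_series_abel_sums: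
  assumes s: "Re s > 0"
  shows "summable (\<lambda>m. u m * npow (Suc m) s)"
    and "(\<Sum>m. u m * npow (Suc m) s) =
          (\<Sum>m. (\<Sum>k<Suc m. u k) * (npow (Suc m) s - npow (Suc (Suc m)) s))"
proof -
  let ?U = "\<lambda>M. \<Sum>m<M. u m"
  let ?d = "\<lambda>m. ?U (Suc m) * (npow (Suc m) s - npow (Suc (Suc m)) s)"
  have C: "C \<ge> 0" using bounded[of 0] by simp
  have abel: "(\<Sum>m<M. u m * npow (Suc m) s) = (\<Sum>m<M. ?d m) + ?U M * npow (Suc M) s" for M
    by (induction M) (simp_all add: algebra_simps)
  have "summable (\<lambda>m. real (Suc m) powr (- Re s - 1))"
    using summable_real_powr_iff[of "- Re s - 1"] s by (subst summable_Suc_iff[where f = "\<lambda>m. real m powr (- Re s - 1)"]) auto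
  then have "summable (\<lambda>m. C * (norm s * real (Suc m) powr (- Re s - 1)))"
    by (intro summable_mult)
  then have sm: "summable ?d"
  proof (rule summable_comparison_test[rotated], intro exI allI impI)
    fix m
    show "norm (?d m) \<le> C * (norm s * real (Suc m) powr (- Re s - 1))"
      unfolding norm_mult using npow_diff_bound[of "Suc m" s] s
      by (intro mult_mono bounded C) auto
  qed
  have "(\<lambda>M. ?U M * npow (Suc M) s) \<longlonglongrightarrow> 0"
  proof (rule Lim_null_comparison)
    show "\<forall>\<^sub>F M in sequentially. norm (?U M * npow (Suc M) s) \<le> C * real (Suc M) powr (- Re s)"
      by (intro always_eventually allI) (simp add: norm_mult norm_npow mult_right_mono bounded)
    have "(\<lambda>M. real (Suc M) powr (- Re s)) \<longlonglongrightarrow> 0"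
      using s by (intro tendsto_neg_powr filterlim_compose[OF filterlim_real_sequentially filterlim_Suc]) auto
    then show "(\<lambda>M. C * real (Suc M) powr (- Re s)) \<longlonglongrightarrow> 0"
      by (rule tendsto_mult_right_zero)
  qed
  with sm have "(\<lambda>M. (\<Sum>m<M. ?d m) + ?U M * npow (Suc M) s) \<longlonglongrightarrow> suminf ?d + 0"
    by (intro tendsto_add summable_LIMSEQ)
  then have "(\<lambda>m. u m * npow (Suc m) s) sums suminf ?d"
    by (simp add: sums_def abel)
  then show "summable (\<lambda>m. u m * npow (Suc m) s)" "(\<Sum>m. u m * npow (Suc m) s) = suminf ?d"
    by (simp_all add: sums_iff)
qed

lemma dirichlet_series_holomorphic:
  "(\<lambda>s. \<Sum>m. u m * npow (Suc m) s) holomorphic_on {s. Re s > 0}"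
proof -
  let ?U = "\<lambda>M. \<Sum>m<M. u m"
  let ?d = "\<lambda>m s. ?U (Suc m) * (npow (Suc m) s - npow (Suc (Suc m)) s)"
  have C: "C \<ge> 0" using bounded[of 0] by simp
  have "(\<lambda>s. \<Sum>m. ?d m s) holomorphic_on {s. Re s > 0}"
  proof (rule holomorphic_uniform_sequence)
    show "open {s. Re s > 0}" by (rule open_halfspace_Re_gt)
    show "(\<lambda>s. \<Sum>m<n. ?d m s) holomorphic_on {s. Re s > 0}" for n
      by (intro holomorphic_intros)
    fix s assume "s \<in> {s. Re s > 0}"
    then have s: "Re s > 0" by simp
    define \<delta> where "\<delta> = Re s / 2"
    have \<delta>: "\<delta> > 0" using s by (simp add: \<delta>_def)
    have pts: "Re z \<ge> \<delta>" "norm z \<le> norm s + \<delta>" if "z \<in> cball s \<delta>" for z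
    proof -
      have "norm (s - z) \<le> \<delta>" using that by (simp add: dist_norm)
      moreover have "\<bar>Re (s - z)\<bar> \<le> norm (s - z)" by (rule abs_Re_le_cmod)
      ultimately show "Re z \<ge> \<delta>" by (simp add: \<delta>_def)
      show "norm z \<le> norm s + \<delta>"
        using \<open>norm (s - z) \<le> \<delta>\<close> norm_triangle_ineq2[of z s] by (simp add: norm_minus_commute)
    qed
    have "uniform_limit (cball s \<delta>) (\<lambda>n z. \<Sum>m<n. ?d m z) (\<lambda>z. \<Sum>m. ?d m z) sequentially"
    proof (rule Weierstrass_m_test)
      show "norm (?d m z) \<le> C * ((norm s + \<delta>) * real (Suc m) powr (- \<delta> - 1))" if "z \<in> cball s \<delta>" for m z
      proof -
        have "norm (npow (Suc m) z - npow (Suc (Suc m)) z) \<le> norm z * real (Suc m) powr (- Re z - 1)"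
          using pts[OF that] \<delta> by (intro npow_diff_bound) auto
        also have "\<dots> \<le> (norm s + \<delta>) * real (Suc m) powr (- \<delta> - 1)"
          using pts[OF that] \<delta> by (intro mult_mono powr_mono) auto
        finally show ?thesis unfolding norm_mult by (intro mult_mono bounded C) auto
      qed
      have "summable (\<lambda>m. real (Suc m) powr (- \<delta> - 1))"
        using summable_real_powr_iff[of "- \<delta> - 1"] \<delta> by (subst summable_Suc_iff[where f = "\<lambda>m. real m powr (- \<delta> - 1)"]) auto
      then show "summable (\<lambda>m. C * ((norm s + \<delta>) * real (Suc m) powr (- \<delta> - 1)))"
        by (intro summable_mult)
    qed
    moreover have "cball s \<delta> \<subseteq> {s. Re s > 0}" using pts(1) \<delta> by fastforce
    ultimately show "\<exists>d>0. cball s d \<subseteq> {s. Re s > 0} \<and>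
        uniform_limit (cball s d) (\<lambda>n z. \<Sum>m<n. ?d m z) (\<lambda>z. \<Sum>m. ?d m z) sequentially"
      using \<delta> by blast
  qed
  then show ?thesis
    by (rule holomorphic_transform) (simp add: dirichlet_series_abel_sums(2))
qed

end

text \<open>
  Whole periods contribute nothing, so a partial sum depends on the last incomplete period only.
\<close>

lemma periodic_partial_sums_bounded:
  fixes u :: "nat \<Rightarrow> complex"
  assumes q: "q > 0" and per: "\<And>m. u (m + q) = u m" and zero: "(\<Sum>m<q. u m) = 0"
  shows "norm (\<Sum>m<M. u m) \<le> (\<Sum>m<q. norm (u m))"
proof (induction M rule: less_induct)
  case (less M)
  show ?case
  proof (cases "M \<le> q")
    case True
    then show ?thesis by (intro sum_norm_le[THEN order_trans, OF order_refl] sum_mono2) auto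
  next
    case False
    then obtain k where k: "M = k + q" by (metis le_add_diff_inverse2 nat_le_linear)
    have "(\<Sum>m<M. u m) = (\<Sum>m<q. u m) + (\<Sum>m<k. u (m + q))"
      unfolding k lessThan_atLeast0 by (subst sum.atLeastLessThan_concat[of 0 q "k + q", symmetric])
         (simp_all add: sum.shift_bounds_nat_ivl[of u 0 q k, simplified])
    also have "\<dots> = (\<Sum>m<k. u m)" using zero per by simp
    finally show ?thesis using less.IH[of k] k q by simp
  qed
qed

section \<open>Landau's theorem for non-negative coefficients\<close>

lemma of_real_exp_term:
  "complex_of_real (w * exp (- (x * l))) = of_real w * exp (- (of_real x * of_real l))"
  by (simp only: of_real_mult of_real_minus exp_of_real [symmetric])

text \<open>
  Expand \<open>F\<close> in a power series around \<open>\<sigma>\<close>, in the variable \<open>\<sigma> - s\<close>. Its coefficients are the sums of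
  \<open>w i * exp (- \<sigma> l i) * l i ^ k / k!\<close> over \<open>i\<close>, hence non-negative, and the series converges in the whole disc
  where \<open>F\<close> is holomorphic. At \<open>\<sigma> - h\<close> it is a convergent double series of non-negative terms, which may be summed
  over \<open>k\<close> first.
\<close>

theorem landau_nonneg_convergence:
  fixes w l :: "'i \<Rightarrow> real"
  assumes w: "\<And>i. i \<in> I \<Longrightarrow> w i \<ge> 0" and l: "\<And>i. i \<in> I \<Longrightarrow> l i \<ge> 0"
    and hol: "F holomorphic_on ball (of_real \<sigma>) R" and "\<sigma>0 < \<sigma>"
    and F: "\<And>s. Re s > \<sigma>0 \<Longrightarrow> ((\<lambda>i. of_real (w i) * exp (- (s * of_real (l i)))) has_sum F s) I"
    and h: "0 < h" "h < R"
  shows "(\<lambda>i. w i * exp (- ((\<sigma> - h) * l i))) summable_on I"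
proof -
  define c where "c = (\<lambda>i k. w i * exp (- (\<sigma> * l i)) * l i ^ k / fact k)"
  have c0: "c i k \<ge> 0" if "i \<in> I" for i k using w l that by (simp add: c_def)
  have expo: "((\<lambda>k. of_real (c i k) * z ^ k) has_sum (of_real (w i) * exp (- ((of_real \<sigma> - z) * of_real (l i))))) UNIV"
    for i and z :: complex
  proof -
    have "((\<lambda>k. (of_real (l i) * z) ^ k /\<^sub>R fact k) has_sum exp (of_real (l i) * z)) UNIV"
      by (rule norm_summable_imp_has_sum[OF summable_norm_exp exp_converges])
    then have "((\<lambda>k. (of_real (w i * exp (- (\<sigma> * l i)))) * ((of_real (l i) * z) ^ k /\<^sub>R fact k)) has_sum
       (of_real (w i * exp (- (\<sigma> * l i)))) * exp (of_real (l i) * z)) UNIV"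
      by (rule has_sum_cmult_right)
    also have "(\<lambda>k. (of_real (w i * exp (- (\<sigma> * l i)))) * ((of_real (l i) * z) ^ k /\<^sub>R fact k)) = (\<lambda>k. of_real (c i k) * z ^ k)"
      by (rule ext) (simp only: c_def scaleR_conv_of_real power_mult_distrib divide_inverse of_real_mult
          of_real_inverse of_real_power mult_ac)
    also have "(of_real (w i * exp (- (\<sigma> * l i)))) * exp (of_real (l i) * z) =
               of_real (w i) * exp (- ((of_real \<sigma> - z) * of_real (l i)))"
      using of_real_exp_term[of "w i" \<sigma> "l i"] by (simp only: of_real_exp_term mult.assoc exp_add [symmetric]) (simp add: algebra_simps)
    finally show ?thesis .
  qed
  have expo_real: "((\<lambda>k. c i k * x ^ k) has_sum (w i * exp (- ((\<sigma> - x) * l i)))) UNIV" for i x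
  proof -
    have e: "exp (- ((of_real \<sigma> - of_real x) * of_real (l i))) = complex_of_real (exp (- ((\<sigma> - x) * l i)))"
      using of_real_exp_term[of 1 "\<sigma> - x" "l i"] by (simp only: of_real_1 mult_1_left of_real_diff)
    have "((\<lambda>k. complex_of_real (c i k * x ^ k)) has_sum complex_of_real (w i * exp (- ((\<sigma> - x) * l i)))) UNIV"
      using expo[of i "of_real x"] unfolding e by (simp only: of_real_mult of_real_power)
    then show ?thesis unfolding has_sum_of_real_iff .
  qed
  \<comment> \<open>At \<open>\<sigma> - \<rho>\<close> the double series still converges by assumption, which permits to exchange the sums.\<close>
  define \<rho> where "\<rho> = (\<sigma> - \<sigma>0) / 2"
  have \<rho>: "\<rho> > 0" "\<sigma> - \<rho> > \<sigma>0" using \<open>\<sigma>0 < \<sigma>\<close> by (auto simp: \<rho>_def field_simps)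
  have sumI: "(\<lambda>i. w i * exp (- ((\<sigma> - \<rho>) * l i))) summable_on I"
  proof -
    have "((\<lambda>i. of_real (w i) * exp (- (of_real (\<sigma> - \<rho>) * of_real (l i)))) has_sum F (of_real (\<sigma> - \<rho>))) I"
      using \<rho> by (intro F) simp
    then have "(\<lambda>i. complex_of_real (w i * exp (- ((\<sigma> - \<rho>) * l i)))) summable_on I"
      unfolding summable_on_def of_real_exp_term by blast
    from summable_on_Re[OF this] show ?thesis by simp
  qed
  have dbl: "(\<lambda>(i, k). c i k * \<rho> ^ k) summable_on I \<times> UNIV"
    by (rule summable_on_SigmaI[OF _ sumI]) (use expo_real c0 \<rho> in auto)
  define b where "b = (\<lambda>k. infsum (\<lambda>i. c i k) I)"
  have b_sum: "((\<lambda>i. c i k) has_sum b k) I" for k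
  proof -
    have "(\<lambda>(k, i). c i k * \<rho> ^ k) summable_on UNIV \<times> I"
      using dbl by (subst (asm) summable_on_swap) (simp add: case_prod_unfold)
    then have "(\<lambda>i. c i k * \<rho> ^ k) summable_on I"
      by (rule summable_on_SigmaD1) simp
    then have "(\<lambda>i. c i k * \<rho> ^ k * inverse (\<rho> ^ k)) summable_on I"
      by (rule summable_on_cmult_left)
    then have "(\<lambda>i. c i k) summable_on I" using \<rho> by (simp add: field_simps)
    then show ?thesis by (simp add: b_def)
  qed
  have pow: "(\<lambda>k. of_real (b k) * z ^ k) sums F (of_real \<sigma> - z)" if z: "norm z < \<rho>" for z :: complex
  proof -
    have "(\<lambda>(i, k). of_real (c i k) * z ^ k) summable_on I \<times> UNIV"
    proof (rule abs_summable_summable, rule Infinite_Sum.abs_summable_on_comparison_test'[OF dbl])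
      fix x assume "x \<in> I \<times> (UNIV :: nat set)"
      then show "norm ((\<lambda>(i, k). of_real (c i k) * z ^ k) x) \<le> (\<lambda>(i, k). c i k * \<rho> ^ k) x"
        using z c0 by (auto simp: norm_mult norm_power intro!: mult_left_mono power_mono)
    qed
    then have "((\<lambda>(i, k). of_real (c i k) * z ^ k) has_sum F (of_real \<sigma> - z)) (I \<times> UNIV)"
    proof (rule has_sum_SigmaI[rotated -1])
      show "((\<lambda>i. of_real (w i) * exp (- ((of_real \<sigma> - z) * of_real (l i)))) has_sum F (of_real \<sigma> - z)) I"
        using z \<rho> abs_Re_le_cmod[of z] by (intro F) auto
    qed (use expo in auto)
    then have "((\<lambda>(k, i). of_real (c i k) * z ^ k) has_sum F (of_real \<sigma> - z)) (UNIV \<times> I)"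
      by (subst has_sum_swap) (simp add: case_prod_unfold)
    then have "((\<lambda>k. of_real (b k) * z ^ k) has_sum F (of_real \<sigma> - z)) UNIV"
      by (rule has_sum_SigmaD) (auto intro!: has_sum_cmult_left has_sum_of_real b_sum)
    then show ?thesis by (rule has_sum_imp_sums)
  qed
  define f where "f = (\<lambda>z. F (of_real \<sigma> - z))"
  have "f has_fps_expansion (Abs_fps (\<lambda>k. of_real (b k)))"
  proof (rule has_fps_expansionI)
    have "eventually (\<lambda>z. z \<in> ball 0 \<rho>) (nhds (0::complex))"
      using \<rho> by (intro eventually_nhds_in_open) auto
    then show "\<forall>\<^sub>F u in nhds 0. (\<lambda>n. fps_nth (Abs_fps (\<lambda>k. of_real (b k))) n * u ^ n) sums f u"
      by eventually_elim (auto simp: f_def pow)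
  qed
  then have coeff: "of_real (b k) = (deriv ^^ k) f 0 / fact k" for k
    using fps_nth_fps_expansion[of f "Abs_fps (\<lambda>k. of_real (b k))" k] by simp
  have "f holomorphic_on ball 0 R"
  proof -
    have "(F \<circ> (\<lambda>z. of_real \<sigma> - z)) holomorphic_on ball 0 R"
      by (rule holomorphic_on_compose_gen[OF _ hol]) (auto intro!: holomorphic_intros simp: dist_norm)
    then show ?thesis by (simp add: f_def o_def)
  qed
  then have "(\<lambda>k. (deriv ^^ k) f 0 / fact k * (of_real h - 0) ^ k) sums f (of_real h)"
    using h by (intro holomorphic_power_series) auto
  then have "summable (\<lambda>k. complex_of_real (b k * h ^ k))"
    by (simp add: coeff [symmetric] sums_iff)
  then have "summable (\<lambda>k. b k * h ^ k)"
    by (simp only: summable_complex_of_real)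
  moreover have b0: "b k \<ge> 0" for k
    unfolding b_def using c0 by (intro infsum_nonneg) auto
  ultimately have "(\<lambda>k. b k * h ^ k) summable_on UNIV"
    using h by (intro summable_nonneg_imp_summable_on) auto
  then have "(\<lambda>(k, i). c i k * h ^ k) summable_on UNIV \<times> I"
    by (rule summable_on_SigmaI[rotated]) (use c0 h in \<open>auto intro!: has_sum_cmult_left b_sum\<close>)
  then have "(\<lambda>(i, k). c i k * h ^ k) summable_on I \<times> UNIV"
    by (subst summable_on_swap) (simp add: case_prod_unfold)
  then have "(\<lambda>i. infsum (\<lambda>k. c i k * h ^ k) UNIV) summable_on I"
    by (rule summable_on_Sigma_banach)
  also have "(\<lambda>i. infsum (\<lambda>k. c i k * h ^ k) UNIV) = (\<lambda>i. w i * exp (- ((\<sigma> - h) * l i)))"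
    using infsumI[OF expo_real] by (simp add: fun_eq_iff)
  finally show ?thesis .
qed

section \<open>Moebius sums over divisors\<close>

lemma moebius_prime_mult:
  assumes p: "prime p" and d: "\<not> p dvd d"
  shows "moebius (p * d) = - moebius d"
proof (cases "d = 0")
  case False
  have cop: "coprime p d" using p d by (simp add: prime_imp_coprime)
  have sq: "squarefree (p * d) \<longleftrightarrow> squarefree d"
    using squarefree_mult_coprime[OF cop squarefree_prime[OF p]] squarefree_multD(2)[of p d] by blast
  have "prime_factors (p * d) = insert p (prime_factors d)"
    using p False by (subst prime_factors_product) (auto simp: prime_prime_factors)
  moreover have "p \<notin> prime_factors d" using d by auto
  ultimately show ?thesis by (simp add: moebius_def sq)
qed (use d in auto)

lemma norm_moebius_le: "norm (of_int (moebius m) :: complex) \<le> 1"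
  by (simp add: moebius_def norm_power)

text \<open>
  The squarefree divisors pair off into \<open>d\<close> and \<open>p * d\<close>, on which the Moebius function takes opposite
  values.
\<close>

lemma sum_moebius_mult_eq_0:
  fixes f :: "nat \<Rightarrow> 'a :: comm_ring_1"
  assumes "m > 0" and p: "prime p" "p dvd m"
    and inv: "\<And>d. p * d dvd m \<Longrightarrow> \<not> p dvd d \<Longrightarrow> f (p * d) = f d"
  shows "(\<Sum>d | d dvd m. of_int (moebius d) * f d) = 0"
proof -
  let ?A = "{d. d dvd m \<and> squarefree d \<and> \<not> p dvd d}" and ?B = "{d. d dvd m \<and> squarefree d \<and> p dvd d}"
  have fin: "finite {d. d dvd m}" using \<open>m > 0\<close> by (rule finite_divisors_nat)
  have finA: "finite ?A" and finB: "finite ?B" by (rule finite_subset[OF _ fin], blast)+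
  have p0: "p > 0" "p \<noteq> 1" using p(1) prime_gt_0_nat not_prime_1 by auto
  have "(\<Sum>d | d dvd m. of_int (moebius d) * f d) = (\<Sum>d\<in>?A \<union> ?B. of_int (moebius d) * f d)"
    by (rule sum.mono_neutral_right[OF fin]) (auto simp: moebius_def)
  also have "\<dots> = (\<Sum>d\<in>?A. of_int (moebius d) * f d) + (\<Sum>d\<in>?B. of_int (moebius d) * f d)"
    by (rule sum.union_disjoint[OF finA finB]) auto
  also have "(\<Sum>d\<in>?B. of_int (moebius d) * f d) = (\<Sum>d\<in>?A. - (of_int (moebius d) * f d))"
  proof (rule sum.reindex_bij_witness[where i = "\<lambda>d. p * d" and j = "\<lambda>d. d div p"])
    fix d assume d: "d \<in> ?B"
    then obtain e where e: "d = p * e" by auto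
    have "squarefree (p * e)" using d e by simp
    then have pe: "\<not> p dvd e"
      using p0 squarefreeD[of "p * e" p] by (auto simp: power2_eq_square)
    show "p * (d div p) = d" "d div p \<in> ?A"
      using d e p0 pe dvd_mult_right squarefree_multD(2) by auto
    show "- (of_int (moebius (d div p)) * f (d div p)) = of_int (moebius d) * f d"
      using moebius_prime_mult[OF p(1) pe] inv[of e] d e p0 pe by simp
  next
    fix d assume d: "d \<in> ?A"
    then have cop: "coprime p d" using p by (simp add: prime_imp_coprime)
    show "p * d div p = d" using p0 by simp
    show "p * d \<in> ?B"
      using d cop p by (auto simp: squarefree_mult_coprime squarefree_prime divides_mult)
  qed
  finally show ?thesis by (simp add: sum_negf)
qed

lemma sum_moebius_divisors:
  assumes "m > 0"
  shows "(\<Sum>d | d dvd m. moebius d) = (if m = 1 then 1 else 0)"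
proof (cases "m = 1")
  case True
  then show ?thesis by (simp add: moebius_def)
next
  case False
  then obtain p where p: "prime p" "p dvd m" using prime_factor_nat by blast
  have "(\<Sum>d | d dvd m. of_int (moebius d) * (1::int)) = 0"
    by (rule sum_moebius_mult_eq_0[OF assms p]) simp
  then show ?thesis using False by simp
qed

section \<open>Dirichlet characters and their L-functions\<close>

lemma has_sum_product:
  fixes f :: "'a \<Rightarrow> complex" and g :: "'b \<Rightarrow> complex"
  assumes f: "(f has_sum a) A" and g: "(g has_sum b) B"
  shows "((\<lambda>(x, y). f x * g y) has_sum (a * b)) (A \<times> B)"
proof (rule has_sum_SigmaI)
  show "((\<lambda>y. case (x, y) of (x, y) \<Rightarrow> f x * g y) has_sum f x * b) B" for x
    using has_sum_cmult_right[OF g] by simp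
  show "((\<lambda>x. f x * b) has_sum a * b) A"
    by (rule has_sum_cmult_left[OF f])
  have "(\<lambda>x. norm (f x)) summable_on A" "(\<lambda>x. norm (g x)) summable_on B"
    using has_sum_imp_summable[OF f] has_sum_imp_summable[OF g]
    by (simp_all only: summable_on_iff_abs_summable_on_complex)
  then have "(\<lambda>z. norm (case z of (x, y) \<Rightarrow> f x * g y)) summable_on A \<times> B"
    by (intro summable_on_SigmaI[where g = "\<lambda>x. norm (f x) * infsum (\<lambda>y. norm (g y)) B"])
       (auto simp: norm_mult intro!: has_sum_cmult_right summable_on_cmult_left)
  then show "(\<lambda>(x, y). f x * g y) summable_on A \<times> B"
    by (rule abs_summable_summable)
qed

lemma dirichlet_series_has_sum:
  fixes u :: "nat \<Rightarrow> complex"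
  assumes u: "\<And>m. norm (u m) \<le> C" and s: "Re s > 1"
  shows "((\<lambda>m. u m * npow m s) has_sum (\<Sum>m. u (Suc m) * npow (Suc m) s)) {0<..}"
    and "summable (\<lambda>m. u (Suc m) * npow (Suc m) s)"
proof -
  have C: "C \<ge> 0" using u[of 0] norm_ge_zero order_trans by blast
  have "summable (\<lambda>m. real (Suc m) powr (- Re s))"
    using summable_real_powr_iff[of "- Re s"] s by (subst summable_Suc_iff[where f = "\<lambda>m. real m powr (- Re s)"]) auto
  then have "summable (\<lambda>m. C * real (Suc m) powr (- Re s))" by (rule summable_mult)
  then have sm: "summable (\<lambda>m. norm (u (Suc m) * npow (Suc m) s))"
    by (rule summable_comparison_test'[of _ 0]) (use u in \<open>auto simp: norm_mult norm_npow intro!: mult_right_mono\<close>)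
  then show sm': "summable (\<lambda>m. u (Suc m) * npow (Suc m) s)" by (rule summable_norm_cancel)
  from sm have "((\<lambda>m. u (Suc m) * npow (Suc m) s) has_sum (\<Sum>m. u (Suc m) * npow (Suc m) s)) UNIV"
    by (rule norm_summable_imp_has_sum) (use sm' in \<open>simp add: summable_sums\<close>)
  then show "((\<lambda>m. u m * npow m s) has_sum (\<Sum>m. u (Suc m) * npow (Suc m) s)) {0<..}"
    using has_sum_reindex[of Suc UNIV "\<lambda>m. u m * npow m s"] by (simp add: o_def greaterThan_0)
qed

locale dirichlet_character =
  fixes n :: nat and \<psi> :: "int \<Rightarrow> complex"
  assumes n_pos: "n > 0"
    and mult: "\<psi> (a * b) = \<psi> a * \<psi> b"
    and cong: "[a = b] (mod int n) \<Longrightarrow> \<psi> a = \<psi> b"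
    and eq_0_iff: "\<psi> a = 0 \<longleftrightarrow> \<not> coprime a (int n)"
begin

lemma one [simp]: "\<psi> 1 = 1"
  using mult[of 1 1] eq_0_iff[of 1] by simp

lemma power: "\<psi> (a ^ k) = \<psi> a ^ k"
  by (induction k) (simp_all add: mult)

lemma norm_eq_1:
  assumes "coprime a (int n)"
  shows "norm (\<psi> a) = 1"
proof -
  define b where "b = nat (a mod int n)"
  have b: "int b = a mod int n" using n_pos by (simp add: b_def)
  have "coprime (int b) (int n)" using assms n_pos by (simp add: b)
  then have "coprime b n" by simp
  then have "[b ^ totient n = 1] (mod n)" by (rule euler_theorem)
  then have "[int b ^ totient n = 1] (mod int n)"
    by (metis cong_int_iff of_nat_1 of_nat_power)
  then have "\<psi> (int b) ^ totient n = 1" using cong power by fastforce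
  moreover have "\<psi> (int b) = \<psi> a" unfolding b by (rule cong) simp
  ultimately have "norm (\<psi> a) ^ totient n = 1" by (metis norm_power norm_one)
  then show ?thesis
    using n_pos by (intro power_eq_imp_eq_base[of "norm (\<psi> a)" "totient n" 1]) auto
qed

lemma norm_le_1: "norm (\<psi> a) \<le> 1"
  using norm_eq_1[of a] eq_0_iff[of a] by (cases "coprime a (int n)") auto

definition L :: "complex \<Rightarrow> complex" where
  "L s = (\<Sum>m. \<psi> (int (Suc m)) * npow (Suc m) s)"

lemma L_has_sum: "Re s > 1 \<Longrightarrow> ((\<lambda>m. \<psi> (int m) * npow m s) has_sum L s) {0<..}"
  unfolding L_def using dirichlet_series_has_sum(1)[of "\<lambda>m. \<psi> (int m)" 1 s] norm_le_1 by simp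

text \<open>
  \<open>\<mu>\<close> is the convolution inverse of \<open>1\<close> and \<open>\<psi>\<close> is completely multiplicative; the double series converges
  absolutely and is summed over the pairs \<open>(a * b, b)\<close>.
\<close>

lemma moebius_has_sum:
  assumes s: "Re s > 1"
  defines "M \<equiv> \<Sum>m. of_int (moebius (Suc m)) * \<psi> (int (Suc m)) * npow (Suc m) s"
  shows "((\<lambda>m. of_int (moebius m) * \<psi> (int m) * npow m s) has_sum M) {0<..}"
    and "summable (\<lambda>m. of_int (moebius (Suc m)) * \<psi> (int (Suc m)) * npow (Suc m) s)"
    and "L s * M = 1"
proof -
  have "norm (of_int (moebius m) * \<psi> (int m)) \<le> 1" for m
    using mult_mono[OF norm_moebius_le[of m] norm_le_1[of "int m"]] by (simp add: norm_mult)
  note * = dirichlet_series_has_sum[of "\<lambda>m. of_int (moebius m) * \<psi> (int m)", OF this s]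
  show M: "((\<lambda>m. of_int (moebius m) * \<psi> (int m) * npow m s) has_sum M) {0<..}"
    using *(1) by (simp add: M_def)
  show "summable (\<lambda>m. of_int (moebius (Suc m)) * \<psi> (int (Suc m)) * npow (Suc m) s)"
    using *(2) by simp
  let ?T = "Sigma {0<..} (\<lambda>m::nat. {d. d dvd m})"
  have "((\<lambda>(a, b). (\<psi> (int a) * npow a s) * (of_int (moebius b) * \<psi> (int b) * npow b s)) has_sum (L s * M)) ({0<..} \<times> {0<..})"
    by (rule has_sum_product[OF L_has_sum[OF s] M])
  also have "?this \<longleftrightarrow> ((\<lambda>(m, d). of_int (moebius d) * (\<psi> (int m) * npow m s)) has_sum (L s * M)) ?T"
    by (rule has_sum_reindex_bij_witness[where j = "\<lambda>(a, b). (a * b, b)" and i = "\<lambda>(m, d). (m div d, d)"])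
       (auto simp: mult npow_mult mult_ac div_greater_zero_iff dvd_imp_le intro: dvd_pos_nat)
  finally have "((\<lambda>m. \<Sum>d | d dvd m. of_int (moebius d) * (\<psi> (int m) * npow m s)) has_sum (L s * M)) {0<..}"
    by (rule has_sum_SigmaD) (auto intro!: has_sum_finiteI finite_divisors_nat)
  also have "?this \<longleftrightarrow> ((\<lambda>m::nat. if m = 1 then 1 else 0) has_sum (L s * M)) {0<..}"
  proof (rule has_sum_cong)
    fix m :: nat assume "m \<in> {0<..}"
    then have "(\<Sum>d | d dvd m. of_int (moebius d) :: complex) = of_int (if m = 1 then 1 else 0)"
      by (subst sum_moebius_divisors[symmetric]) auto
    then show "(\<Sum>d | d dvd m. of_int (moebius d) * (\<psi> (int m) * npow m s)) = (if m = 1 then 1 else 0)"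
      by (simp add: sum_distrib_right [symmetric])
  qed
  finally have "((\<lambda>m::nat. if m = 1 then 1 else 0) has_sum (L s * M)) {0<..}" .
  moreover have "((\<lambda>m::nat. if m = 1 then 1 else 0 :: complex) has_sum 1) {0<..}"
    by (rule has_sum_finite_neutralI[where B = "{1}"]) auto
  ultimately show "L s * M = 1" using has_sum_unique by blast
qed

text \<open>
  An odd character sums to zero over a period because \<open>a \<mapsto> - a\<close> permutes the residue classes. Hence its
  L-series converges and is holomorphic to the right of \<open>0\<close>.
\<close>

lemma odd_partial_sums_bounded:
  assumes odd: "\<psi> (-1) = -1"
  shows "norm (\<Sum>m<M. \<psi> (int (Suc m))) \<le> (\<Sum>m<n. norm (\<psi> (int (Suc m))))"
proof (rule periodic_partial_sums_bounded[OF n_pos])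
  show "\<psi> (int (Suc (m + n))) = \<psi> (int (Suc m))" for m
    by (rule cong) (simp add: cong_def flip: add.assoc)
  have neg: "\<psi> (- a) = - \<psi> a" for a using mult[of "-1" a] odd by simp
  have "(\<Sum>m<n. \<psi> (int (Suc m))) = (\<Sum>m<n. \<psi> (int (Suc (n - Suc m))))"
    by (rule sum.nat_diff_reindex[symmetric])
  also have "\<dots> = (\<Sum>m<n. \<psi> (- int m))"
    by (intro sum.cong cong) (auto simp: of_nat_diff cong_def mod_diff_eq)
  also have "\<dots> = - (\<Sum>m<n. \<psi> (int m))" by (simp add: neg sum_negf)
  finally have 1: "(\<Sum>m<n. \<psi> (int (Suc m))) = - (\<Sum>m<n. \<psi> (int m))" .
  have "(\<Sum>m<n. \<psi> (int (Suc m)) - \<psi> (int m)) = \<psi> (int n) - \<psi> (int 0)"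
    by (rule sum_lessThan_telescope)
  also have "\<dots> = 0" using cong[of "int n" 0] by (simp add: cong_def)
  finally show "(\<Sum>m<n. \<psi> (int (Suc m))) = 0" using 1 by (simp add: sum_subtractf)
qed

lemmas L_odd_holomorphic = dirichlet_series_holomorphic[OF odd_partial_sums_bounded, folded L_def]
lemmas L_odd_summable = dirichlet_series_abel_sums(1)[OF odd_partial_sums_bounded]

lemma cnj_character: "dirichlet_character n (\<lambda>a. cnj (\<psi> a))"
  by unfold_locales (use n_pos mult cong eq_0_iff in auto)

end

section \<open>Non-vanishing of L-functions on the line of real part 1\<close>

definition coprimes_to :: "nat \<Rightarrow> nat set" where
  "coprimes_to n = {m. m > 0 \<and> coprime m n}"

lemma coprimes_to_mult_iff: "a * b \<in> coprimes_to n \<longleftrightarrow> a \<in> coprimes_to n \<and> b \<in> coprimes_to n"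
  by (auto simp: coprimes_to_def)

lemma coprimes_to_dvd: "m \<in> coprimes_to n \<Longrightarrow> d dvd m \<Longrightarrow> d \<in> coprimes_to n"
  by (auto simp: coprimes_to_mult_iff elim!: dvdE)

lemma npow_double: "m > 0 \<Longrightarrow> npow m (2 * s) = npow m s * npow m s"
  by (simp only: mult_2 npow_add)

text \<open>
  Ramanujan's evaluation of \<open>\<Sum> |f m|^2 m^-s\<close> for \<open>f = 1 * \<eta>\<close>, in the form without a denominator. Both sides
  are expressed by the sum \<open>K\<close> over coprime pairs \<open>(a, b)\<close>: writing an arbitrary pair as \<open>(g a, g b)\<close> gives
  \<open>L1 * L2 = P2 * K\<close>, and writing \<open>d\<close>, \<open>e\<close> with \<open>d dvd m\<close>, \<open>e dvd m\<close> as \<open>h a\<close>, \<open>h b\<close> with \<open>m = k h a b\<close> gives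
  \<open>P * P * K\<close> for the sum over \<open>m\<close>. What matters later is that the terms on the left are non-negative for
  real \<open>s\<close>.
\<close>

lemma ramanujan_identity:
  fixes \<eta> :: "nat \<Rightarrow> complex" and n :: nat
  defines "C \<equiv> coprimes_to n"
  assumes mult: "\<And>a b. a \<in> C \<Longrightarrow> b \<in> C \<Longrightarrow> \<eta> (a * b) = \<eta> a * \<eta> b"
    and unit: "\<And>a. a \<in> C \<Longrightarrow> norm (\<eta> a) = 1"
    and P: "((\<lambda>m. npow m s) has_sum P) C" and P2: "((\<lambda>m. npow m (2 * s)) has_sum P2) C"
    and L1: "((\<lambda>m. \<eta> m * npow m s) has_sum L1) C"
    and L2: "((\<lambda>m. cnj (\<eta> m) * npow m s) has_sum L2) C"
  shows "((\<lambda>(m, g). of_real (norm (\<Sum>d | d dvd m. \<eta> d) ^ 2) * npow m s * npow g (2 * s)) has_sum (P * P * L1 * L2)) (C \<times> C)"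
proof -
  define E where "E = {(a, b). a \<in> C \<and> b \<in> C \<and> coprime a b}"
  define t where "t = (\<lambda>(a, b). (\<eta> a * npow a s) * (cnj (\<eta> b) * npow b s))"
  have prod: "(t has_sum (L1 * L2)) (C \<times> C)"
    unfolding t_def by (rule has_sum_product[OF L1 L2])
  have "t summable_on E"
    by (rule summable_on_subset_banach[OF has_sum_imp_summable[OF prod]]) (auto simp: E_def)
  then obtain K where K: "(t has_sum K) E" by (auto simp: summable_on_def)
  have pos: "a > 0" if "a \<in> C" for a using that by (simp add: C_def coprimes_to_def)
  have Cm: "a * b \<in> C" if "a \<in> C" "b \<in> C" for a b using that by (simp add: C_def coprimes_to_mult_iff)
  have Cd: "d \<in> C" if "m \<in> C" "d dvd m" for m d using that coprimes_to_dvd by (simp add: C_def)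
  have uu: "\<eta> a * cnj (\<eta> a) = 1" if "a \<in> C" for a
    using unit[OF that] complex_norm_square[of "\<eta> a"] by simp
  have t_scale: "t (g * a, g * b) = npow g (2 * s) * t (a, b)" if "g \<in> C" "a \<in> C" "b \<in> C" for g a b
  proof -
    have "t (g * a, g * b) = (\<eta> g * cnj (\<eta> g)) * (npow g s * npow g s) * t (a, b)"
      using that pos by (simp add: t_def mult npow_mult)
    then show ?thesis using that pos by (simp add: uu npow_double)
  qed
  have "((\<lambda>(g, ab). npow g (2 * s) * t ab) has_sum (P2 * K)) (C \<times> E)"
    by (rule has_sum_product[OF P2 K])
  also have "?this \<longleftrightarrow> (t has_sum (P2 * K)) (C \<times> C)"
  proof (rule has_sum_reindex_bij_witness[where j = "\<lambda>(g, a, b). (g * a, g * b)" and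
          i = "\<lambda>(a, b). (gcd a b, a div gcd a b, b div gcd a b)"])
    fix x assume "x \<in> C \<times> E"
    then obtain g a b where x: "x = (g, a, b)" and gab: "g \<in> C" "a \<in> C" "b \<in> C" "coprime a b"
      by (auto simp: E_def)
    have "gcd (g * a) (g * b) = g" using gab by (simp add: gcd_mult_left)
    then show "(case case x of (g, a, b) \<Rightarrow> (g * a, g * b) of (a, b) \<Rightarrow> (gcd a b, a div gcd a b, b div gcd a b)) = x"
      using pos[OF gab(1)] by (simp add: x)
    show "(case x of (g, a, b) \<Rightarrow> (g * a, g * b)) \<in> C \<times> C" using gab Cm by (simp add: x)
    show "t (case x of (g, a, b) \<Rightarrow> (g * a, g * b)) = (case x of (g, ab) \<Rightarrow> npow g (2 * s) * t ab)"
      using t_scale gab by (simp add: x)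
  next
    fix y assume "y \<in> C \<times> C"
    then obtain a b where y: "y = (a, b)" and ab: "a \<in> C" "b \<in> C" by auto
    have "gcd a b \<in> C" by (rule Cd[OF ab(1)]) simp
    moreover have "a div gcd a b \<in> C" by (rule Cd[OF ab(1)], rule dvdI[of _ _ "gcd a b"]) simp
    moreover have "b div gcd a b \<in> C" by (rule Cd[OF ab(2)], rule dvdI[of _ _ "gcd a b"]) simp
    moreover have "coprime (a div gcd a b) (b div gcd a b)" using pos[OF ab(1)] by (intro div_gcd_coprime) auto
    ultimately show "(case y of (a, b) \<Rightarrow> (gcd a b, a div gcd a b, b div gcd a b)) \<in> C \<times> E"
      by (simp add: y E_def)
    show "(case case y of (a, b) \<Rightarrow> (gcd a b, a div gcd a b, b div gcd a b) of (g, a, b) \<Rightarrow> (g * a, g * b)) = y"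
      by (simp add: y)
  qed simp
  finally have L12: "L1 * L2 = P2 * K" using prod has_sum_unique by blast
  define f where "f = (\<lambda>m. \<Sum>d | d dvd m. \<eta> d)"
  define T where "T = Sigma C (\<lambda>m. {d. d dvd m} \<times> {d. d dvd m})"
  have "((\<lambda>(k, h, ab). npow k s * (case (h, ab) of (h, ab) \<Rightarrow> npow h s * t ab)) has_sum (P * (P * K))) (C \<times> C \<times> E)"
    using has_sum_product[OF P has_sum_product[OF P K]] by (simp add: case_prod_unfold)
  also have "?this \<longleftrightarrow> ((\<lambda>(m, d, e). (\<eta> d * cnj (\<eta> e)) * npow m s) has_sum (P * (P * K))) T"
  proof (rule has_sum_reindex_bij_witness[where j = "\<lambda>(k, h, a, b). (k * h * a * b, h * a, h * b)" and
          i = "\<lambda>(m, d, e). (m div lcm d e, gcd d e, d div gcd d e, e div gcd d e)"])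
    fix x assume "x \<in> C \<times> C \<times> E"
    then obtain k g a b where x: "x = (k, g, a, b)" and kgab: "k \<in> C" "g \<in> C" "a \<in> C" "b \<in> C" "coprime a b"
      by (auto simp: E_def)
    have g: "gcd (g * a) (g * b) = g" using kgab by (simp add: gcd_mult_left)
    have l: "lcm (g * a) (g * b) = g * a * b"
      unfolding lcm_nat_def g using pos[OF kgab(2)] by (simp add: mult.assoc)
    have "k * g * a * b div (g * a * b) = k" "g * a div g = a" "g * b div g = b"
      using pos[OF kgab(1)] pos[OF kgab(2)] pos[OF kgab(3)] pos[OF kgab(4)] by (simp_all add: mult.assoc)
    then show "(case case x of (k, h, a, b) \<Rightarrow> (k * h * a * b, h * a, h * b) of
         (m, d, e) \<Rightarrow> (m div lcm d e, gcd d e, d div gcd d e, e div gcd d e)) = x"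
      unfolding x prod.case g l by (simp only:)
    have "k * g * a * b \<in> C" using kgab Cm by blast
    moreover have "g * a dvd k * g * a * b" by (rule dvdI[of _ _ "k * b"]) (simp add: mult_ac)
    moreover have "g * b dvd k * g * a * b" by (rule dvdI[of _ _ "k * a"]) (simp add: mult_ac)
    ultimately show "(case x of (k, h, a, b) \<Rightarrow> (k * h * a * b, h * a, h * b)) \<in> T"
      by (simp add: x T_def)
    have "npow (k * g * a * b) s = npow k s * npow g s * npow a s * npow b s"
      using kgab pos by (simp add: npow_mult)
    then have "\<eta> (g * a) * cnj (\<eta> (g * b)) * npow (k * g * a * b) s =
         (\<eta> g * cnj (\<eta> g)) * (npow k s * (npow g s * t (a, b)))"
      using kgab by (simp add: t_def mult)
    then have "\<eta> (g * a) * cnj (\<eta> (g * b)) * npow (k * g * a * b) s = npow k s * (npow g s * t (a, b))"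
      using uu[OF kgab(2)] by simp
    then show "(case case x of (k, h, a, b) \<Rightarrow> (k * h * a * b, h * a, h * b) of
         (m, d, e) \<Rightarrow> \<eta> d * cnj (\<eta> e) * npow m s) =
        (case x of (k, h, ab) \<Rightarrow> npow k s * (case (h, ab) of (h, ab) \<Rightarrow> npow h s * t ab))"
      unfolding x prod.case .
  next
    fix y assume "y \<in> T"
    then obtain m d e where y: "y = (m, d, e)" and mde: "m \<in> C" "d dvd m" "e dvd m"
      by (auto simp: T_def)
    have m: "m > 0" using pos mde by simp
    have d: "d > 0" "e > 0" using m mde dvd_pos_nat by auto
    let ?g = "gcd d e"
    have da: "?g * (d div ?g) = d" "?g * (e div ?g) = e" by simp_all
    have l: "lcm d e = ?g * (d div ?g) * (e div ?g)"
      by (simp add: lcm_nat_def div_mult_swap)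
    have lm: "lcm d e dvd m" using mde by simp
    have "m div lcm d e * ?g * (d div ?g) * (e div ?g) = (m div lcm d e) * lcm d e"
      unfolding l by (simp only: mult.assoc)
    also have "\<dots> = m" using lm by (rule dvd_div_mult_self)
    finally show "(case case y of (m, d, e) \<Rightarrow> (m div lcm d e, gcd d e, d div gcd d e, e div gcd d e) of
        (k, h, a, b) \<Rightarrow> (k * h * a * b, h * a, h * b)) = y"
      unfolding y prod.case da by (simp only:)
    have "m div lcm d e dvd m" by (rule dvdI[of _ _ "lcm d e"]) (use lm in simp)
    moreover have "?g dvd m" by (rule dvd_trans[OF _ mde(2)]) simp
    moreover have "d div ?g dvd m" by (rule dvd_trans[OF _ mde(2)], rule dvdI[of _ _ ?g]) simp
    moreover have "e div ?g dvd m" by (rule dvd_trans[OF _ mde(3)], rule dvdI[of _ _ ?g]) simp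
    moreover have "coprime (d div ?g) (e div ?g)" using d by (intro div_gcd_coprime) auto
    ultimately show "(case y of (m, d, e) \<Rightarrow> (m div lcm d e, gcd d e, d div gcd d e, e div gcd d e)) \<in> C \<times> C \<times> E"
      using Cd[OF mde(1)] by (simp add: y E_def)
  qed simp
  finally have "((\<lambda>m. \<Sum>(d,e)\<in>{d. d dvd m} \<times> {d. d dvd m}. (\<eta> d * cnj (\<eta> e)) * npow m s) has_sum (P * (P * K))) C"
    unfolding T_def
    by (rule has_sum_SigmaD) (auto intro!: has_sum_finiteI finite_divisors_nat pos simp: case_prod_unfold)
  also have "?this \<longleftrightarrow> ((\<lambda>m. of_real (norm (f m) ^ 2) * npow m s) has_sum (P * (P * K))) C"
  proof (rule has_sum_cong)
    fix m assume "m \<in> C"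
    have "complex_of_real (norm (f m) ^ 2) = f m * cnj (f m)"
      using complex_norm_square[of "f m"] by simp
    also have "\<dots> = (\<Sum>(d,e)\<in>{d. d dvd m} \<times> {d. d dvd m}. \<eta> d * cnj (\<eta> e))"
      by (simp add: f_def sum_product sum.cartesian_product)
    finally show "(\<Sum>(d,e)\<in>{d. d dvd m} \<times> {d. d dvd m}. (\<eta> d * cnj (\<eta> e)) * npow m s) = of_real (norm (f m) ^ 2) * npow m s"
      by (simp add: sum_distrib_right case_prod_unfold)
  qed
  finally have "((\<lambda>m. of_real (norm (f m) ^ 2) * npow m s) has_sum (P * (P * K))) C" .
  from has_sum_product[OF this P2]
  have "((\<lambda>(m, g). of_real (norm (f m) ^ 2) * npow m s * npow g (2 * s)) has_sum (P * (P * K) * P2)) (C \<times> C)" .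
  moreover have "P * (P * K) * P2 = P * P * L1 * L2"
    unfolding mult.assoc L12 by (simp only: mult_ac)
  ultimately show ?thesis
    by (simp only: f_def)
qed

context dirichlet_character
begin

lemma coprime_series_has_sum:
  assumes s: "Re s > 1" and v: "\<And>m. norm (v m) \<le> 1" and z: "\<And>m. \<not> coprime m n \<Longrightarrow> v m = 0"
  shows "((\<lambda>m. v m * npow m s) has_sum (\<Sum>m. v (Suc m) * npow (Suc m) s)) (coprimes_to n)"
proof -
  have "((\<lambda>m. v m * npow m s) has_sum (\<Sum>m. v (Suc m) * npow (Suc m) s)) {0<..}"
    by (rule dirichlet_series_has_sum(1)[OF v s])
  then show ?thesis
    by (rule has_sum_cong_neutral[THEN iffD1, rotated -1]) (auto simp: coprimes_to_def z)
qed

text \<open>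
  The coefficients of \<open>(1 - 2^(1-s)) * \<Sum> m^-s\<close>, the sum ranging over the \<open>m\<close> coprime to \<open>n\<close>. They have
  period \<open>2 n\<close> and mean zero, so the product extends holomorphically to the right of \<open>0\<close>; this is the
  continuation of the principal L-function that is used below.
\<close>

definition mean_zero_coeff :: "nat \<Rightarrow> complex" where
  "mean_zero_coeff m = (if coprime m n then 1 else 0) - (if even m \<and> coprime (m div 2) n then 2 else 0)"

lemma mean_zero_coeff_bounded:
  "norm (\<Sum>m<M. mean_zero_coeff (Suc m)) \<le> (\<Sum>m<2*n. norm (mean_zero_coeff (Suc m)))"
proof (rule periodic_partial_sums_bounded)
  show "2 * n > 0" using n_pos by simp
  show "mean_zero_coeff (Suc (m + 2 * n)) = mean_zero_coeff (Suc m)" for m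
  proof -
    have nz: "n \<noteq> 0" using n_pos by simp
    have cop: "coprime (a + k * n) n \<longleftrightarrow> coprime a n" for a k
      using coprime_mod_left_iff[OF nz, of "a + k * n"] coprime_mod_left_iff[OF nz, of a]
      unfolding mod_mult_self1 by blast
    have "coprime (Suc (m + 2 * n)) n = coprime (Suc m) n" using cop[of "Suc m" 2] by simp
    moreover have "even (Suc (m + 2 * n)) = even (Suc m)" by simp
    moreover have "coprime (Suc (m + 2 * n) div 2) n = coprime (Suc m div 2) n"
    proof -
      have "Suc (m + 2 * n) div 2 = Suc m div 2 + 1 * n" by simp
      then show ?thesis using cop[of "Suc m div 2" 1] by simp
    qed
    ultimately show ?thesis unfolding mean_zero_coeff_def by (simp only:)
  qed
  define c :: "nat \<Rightarrow> complex" where "c = (\<lambda>m. if coprime m n then 1 else 0)"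
  have per: "c (m + n) = c m" for m
    using coprime_mod_left_iff[of n "m + n"] coprime_mod_left_iff[of n m] n_pos by (simp add: c_def)
  have 1: "(\<Sum>m<2*n. c (Suc m)) = 2 * (\<Sum>m<n. c (Suc m))"
  proof -
    have "(\<Sum>m<n + N. c (Suc m)) = (\<Sum>m<n. c (Suc m)) + (\<Sum>m<N. c (Suc m))" for N
    proof (induction N)
      case (Suc N)
      have "c (Suc (n + N)) = c (Suc N)" using per[of "Suc N"] by (simp add: add.commute)
      with Suc show ?case by simp
    qed simp
    from this[of n] show ?thesis by (simp only: mult_2)
  qed
  have 2: "(\<Sum>m<2*N. if even (Suc m) \<and> coprime (Suc m div 2) n then 2 else 0) = 2 * (\<Sum>m<N. c (Suc m))" for N
    by (induction N) (auto simp: c_def)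
  show "(\<Sum>m<2*n. mean_zero_coeff (Suc m)) = 0"
    unfolding mean_zero_coeff_def sum_subtractf using 1 2[of n] by (simp add: c_def)
qed

definition mean_zero_series :: "complex \<Rightarrow> complex" where
  "mean_zero_series s = (\<Sum>m. mean_zero_coeff (Suc m) * npow (Suc m) s)"

lemma mean_zero_series_holomorphic: "mean_zero_series holomorphic_on {s. Re s > 0}"
  using dirichlet_series_holomorphic[OF mean_zero_coeff_bounded] by (simp add: mean_zero_series_def [abs_def])

lemma mean_zero_series_eq:
  assumes s: "Re s > 1" and P: "((\<lambda>m. npow m s) has_sum P) (coprimes_to n)"
  shows "mean_zero_series s = (1 - 2 * npow 2 s) * P"
proof -
  have "norm (mean_zero_coeff m) \<le> 3" for m
    unfolding mean_zero_coeff_def by (rule order_trans[OF norm_triangle_ineq4]) auto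
  then have mean_zero_series: "((\<lambda>m. mean_zero_coeff m * npow m s) has_sum mean_zero_series s) {0<..}"
    unfolding mean_zero_series_def by (rule dirichlet_series_has_sum(1)[OF _ s])
  have 1: "((\<lambda>m. (if coprime m n then 1 else 0) * npow m s) has_sum P) {0<..}"
    by (rule has_sum_cong_neutral[THEN iffD1, OF _ _ _ P]) (auto simp: coprimes_to_def)
  have "((\<lambda>m. 2 * npow 2 s * npow m s) has_sum (2 * npow 2 s * P)) (coprimes_to n)"
    by (rule has_sum_cmult_right[OF P])
  also have "?this \<longleftrightarrow> ((\<lambda>m. 2 * npow m s) has_sum (2 * npow 2 s * P)) ((\<lambda>m. 2 * m) ` coprimes_to n)"
    by (subst has_sum_reindex) (auto intro!: has_sum_cong simp: npow_mult coprimes_to_def inj_on_def)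
  also have "\<dots> \<longleftrightarrow> ((\<lambda>m. (if even m \<and> coprime (m div 2) n then 2 else 0) * npow m s) has_sum (2 * npow 2 s * P)) {0<..}"
    by (rule has_sum_cong_neutral) (auto simp: coprimes_to_def elim!: evenE)
  finally have 2: "((\<lambda>m. (if even m \<and> coprime (m div 2) n then 2 else 0) * npow m s) has_sum (2 * npow 2 s * P)) {0<..}" .
  have "((\<lambda>m. mean_zero_coeff m * npow m s) has_sum (P - 2 * npow 2 s * P)) {0<..}"
    using has_sum_add[OF 1 has_sum_uminusI[OF 2]] by (simp add: mean_zero_coeff_def algebra_simps)
  from has_sum_unique[OF mean_zero_series this] show ?thesis by (simp add: algebra_simps)
qed

lemma not_summable_inverse_coprimes: "\<not> (\<lambda>g. 1 / real g) summable_on coprimes_to n"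
proof
  assume *: "(\<lambda>g. 1 / real g) summable_on coprimes_to n"
  have "(\<lambda>k. Suc (k * n)) ` UNIV \<subseteq> coprimes_to n"
  proof safe
    fix k
    have nz: "n \<noteq> 0" using n_pos by simp
    have "coprime (1 + k * n) n"
      using coprime_mod_left_iff[OF nz, of "1 + k * n"] coprime_mod_left_iff[OF nz, of 1]
      unfolding mod_mult_self1 by simp
    then show "Suc (k * n) \<in> coprimes_to n" by (simp add: coprimes_to_def)
  qed
  from summable_on_subset_banach[OF * this]
  have "(\<lambda>k. 1 / real (Suc (k * n))) summable_on UNIV"
    using n_pos by (subst (asm) summable_on_reindex) (auto simp: inj_on_def o_def)
  then have "summable (\<lambda>k. 1 / real (Suc (k * n)))" by (rule summable_on_imp_summable)
  then have "summable (\<lambda>k. real n * (1 / real (Suc (k * n))))" by (rule summable_mult)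
  then have "summable (\<lambda>k. 1 / real (Suc k))"
  proof (rule summable_comparison_test'[where N = 0])
    fix k :: nat
    have "real (Suc (k * n)) \<le> real n * real (Suc k)"
      using n_pos by (simp add: algebra_simps)
    then have "1 / real (Suc k) \<le> real n / real (Suc (k * n))"
      by (subst frac_le_eq) (auto simp del: of_nat_Suc intro!: divide_nonpos_pos)
    then show "norm (1 / real (Suc k)) \<le> real n * (1 / real (Suc (k * n)))" by simp
  qed
  then have "summable (\<lambda>k. 1 / real k)"
    by (subst (asm) summable_Suc_iff[where f = "\<lambda>k. 1 / real k"])
  then show False using not_summable_harmonic[where 'a = real] by (simp add: divide_inverse)
qed

text \<open>
  Let \<open>\<eta> m = \<psi> m * m^(-i\<tau>)\<close>. The identity of Ramanujan type shows that \<open>F = P(s)^2 L(s, \<eta>) L(s, cnj \<eta>)\<close> is a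
  Dirichlet series with non-negative coefficients, \<open>P\<close> being the principal L-function. If \<open>L(s, \<psi>)\<close> vanishes at
  \<open>1 + i \<tau>\<close>, then both L-functions vanish at \<open>1\<close> and cancel the double pole of \<open>P^2\<close>, so \<open>F\<close> is holomorphic in the
  disc of radius \<open>2\<close> around \<open>2\<close>. By Landau's theorem its series converges at \<open>1/2\<close>. But the terms with \<open>m = 1\<close>
  alone give the harmonic series over the integers coprime to \<open>n\<close>.
\<close>

theorem L_nonzero:
  assumes odd: "\<psi> (-1) = -1"
  shows "L (1 + \<i> * of_real \<tau>) \<noteq> 0"
proof
  assume zero: "L (1 + \<i> * of_real \<tau>) = 0"
  interpret conj: dirichlet_character n "\<lambda>a. cnj (\<psi> a)" by (rule cnj_character)
  define it where "it = \<i> * complex_of_real \<tau>"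
  define \<eta> where "\<eta> = (\<lambda>m. \<psi> (int m) * npow m it)"
  define L1 where "L1 = (\<lambda>s. L (s + it))"
  define L2 where "L2 = (\<lambda>s. conj.L (s - it))"
  let ?H = "{s. Re s > 0}" and ?B = "ball (2::complex) 2"
  have BH: "?B \<subseteq> ?H"
  proof
    fix s :: complex assume "s \<in> ?B"
    then have "norm (2 - s) < 2" by (simp add: dist_norm)
    then show "s \<in> ?H" using abs_Re_le_cmod[of "2 - s"] by simp
  qed
  have openH: "open ?H" by (rule open_halfspace_Re_gt)
  have Re_it: "Re it = 0" by (simp add: it_def)
  have hol1: "L1 holomorphic_on ?H"
  proof -
    have "(L \<circ> (\<lambda>s. s + it)) holomorphic_on ?H"
      by (rule holomorphic_on_compose_gen[OF _ L_odd_holomorphic[OF odd]]) (auto intro!: holomorphic_intros simp: Re_it)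
    then show ?thesis by (simp add: L1_def o_def)
  qed
  have hol2: "L2 holomorphic_on ?H"
  proof -
    have "(conj.L \<circ> (\<lambda>s. s - it)) holomorphic_on ?H"
      by (rule holomorphic_on_compose_gen[OF _ conj.L_odd_holomorphic])
         (use odd in \<open>auto intro!: holomorphic_intros simp: Re_it\<close>)
    then show ?thesis by (simp add: L2_def o_def)
  qed
  have npow_cnj: "cnj (npow m s) = npow m (cnj s)" for m s by (simp add: npow_def exp_cnj)
  have z1: "L1 1 = 0" using zero by (simp add: L1_def it_def)
  have z2: "L2 1 = 0"
  proof -
    have "summable (\<lambda>m. \<psi> (int (Suc m)) * npow (Suc m) (1 + it))"
      by (rule L_odd_summable[OF odd]) (simp add: Re_it)
    then have "(\<lambda>m. \<psi> (int (Suc m)) * npow (Suc m) (1 + it)) sums L (1 + it)"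
      unfolding L_def by (rule summable_sums)
    then have "(\<lambda>m. cnj (\<psi> (int (Suc m)) * npow (Suc m) (1 + it))) sums cnj (L (1 + it))"
      by (subst sums_cnj)
    moreover have "cnj (1 + it) = 1 - it" by (simp add: it_def)
    ultimately have "conj.L (1 - it) = cnj (L (1 + it))"
      unfolding conj.L_def by (simp add: npow_cnj sums_iff)
    then show ?thesis using zero by (simp add: L2_def it_def)
  qed
  define g where "g = (\<lambda>s. 1 - 2 * npow 2 s)"
  have g1: "g 1 = 0" by (simp add: g_def npow_one_right)
  have g_hol: "g holomorphic_on ?H" unfolding g_def by (intro holomorphic_intros)
  \<comment> \<open>The zero at \<open>1\<close> is divided out of numerators and denominator alike.\<close>
  define quot where "quot = (\<lambda>f s. if s = 1 then deriv f 1 else f s / (s - 1 :: complex))"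
  have quot_hol: "quot f holomorphic_on ?H" if "f holomorphic_on ?H" "f 1 = 0" for f
    by (rule pole_theorem_open_0[OF that(1) openH, of 1]) (auto simp: quot_def that(2))
  have g_nz: "quot g s \<noteq> 0" if s: "s \<in> ?B" for s
  proof (cases "s = 1")
    case True
    have "(g has_field_derivative (of_real (ln 2) * (2 * npow 2 1))) (at 1)"
      unfolding g_def npow_def by (auto intro!: derivative_eq_intros)
    then have "deriv g 1 = of_real (ln 2) * (2 * npow 2 1)" by (rule DERIV_imp_deriv)
    then show ?thesis using True by (simp add: quot_def)
  next
    case False
    have "g s \<noteq> 0"
    proof
      assume "g s = 0"
      then have "2 * npow 2 s = 1" by (simp add: g_def)
      moreover have "2 = exp (complex_of_real (ln 2))"
        by (simp add: exp_of_real)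
      moreover have "exp ((1 - s) * of_real (ln 2)) = exp (complex_of_real (ln 2)) * npow 2 s"
        unfolding npow_def exp_add [symmetric] by (simp add: algebra_simps)
      ultimately have "exp ((1 - s) * of_real (ln 2)) = 1"
        by (simp only:)
      \<comment> \<open>The zeros of \<open>1 - 2^(1-s)\<close> are \<open>1 + 2 \<pi> i k / ln 2\<close>; only \<open>k = 0\<close> gives one in the disc.\<close>
      then obtain k :: int where k: "Re ((1 - s) * of_real (ln 2)) = 0" "Im ((1 - s) * of_real (ln 2)) = of_int (2 * k) * pi"
        by (auto simp: exp_eq_1)
      have "\<bar>Im s\<bar> < 2"
        using s abs_Im_le_cmod[of "2 - s"] by (simp add: dist_norm)
      have ln2: "0 < ln (2::real)" "ln (2::real) < 1" using ln_2_less_1 by auto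
      have "\<bar>Im s\<bar> * ln 2 < 2 * 1"
        using \<open>\<bar>Im s\<bar> < 2\<close> ln2 by (intro mult_strict_mono') auto
      moreover have "\<bar>Im s\<bar> * ln 2 = \<bar>of_int (2 * k) * pi\<bar>"
      proof -
        have "of_int (2 * k) * pi = - (Im s * ln 2)" using k(2) by simp
        then show ?thesis using ln2 by (simp only: abs_minus abs_mult)
      qed
      ultimately have "\<bar>of_int (2 * k)\<bar> * pi < 2" by (simp add: abs_mult)
      moreover have "2 * 3 < \<bar>of_int (2 * k)\<bar> * pi" if "k \<noteq> 0"
        using that pi_gt3 by (intro mult_le_less_imp_less) auto
      ultimately have "k = 0" by fastforce
      then have "s = 1" using k ln2 by (auto simp: complex_eq_iff)
      with False show False by contradiction
    qed
    then show ?thesis using False by (simp add: quot_def)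
  qed
  define F where "F = (\<lambda>s. mean_zero_series s * mean_zero_series s * quot L1 s * quot L2 s / (quot g s * quot g s))"
  have F_hol: "F holomorphic_on ball (of_real 2) 2"
    unfolding F_def of_real_numeral
    by (intro holomorphic_intros holomorphic_on_subset[OF mean_zero_series_holomorphic BH]
          holomorphic_on_subset[OF quot_hol BH] hol1 hol2 g_hol z1 z2 g1) (use g_nz in auto)
  define C where "C = coprimes_to n"
  have Cc: "coprime (int m) (int n)" "m > 0" if "m \<in> C" for m using that by (auto simp: C_def coprimes_to_def)
  define f where "f = (\<lambda>m. \<Sum>d | d dvd m. \<eta> d)"
  define w where "w = (\<lambda>(m :: nat, g :: nat). norm (f m) ^ 2)"
  define l where "l = (\<lambda>(m, g). ln (real m) + 2 * ln (real g))"
  have npow_it: "norm (npow m it) = 1" "npow m (s + it) = npow m s * npow m it"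
     "npow m (s - it) = npow m s * cnj (npow m it)" if "m > 0" for m s
    using that by (simp_all add: norm_npow Re_it npow_add npow_cnj diff_conv_add_uminus[of s] it_def del: add_uminus_conv_diff)
  have F_sum: "((\<lambda>i. of_real (w i) * exp (- (s * of_real (l i)))) has_sum F s) (C \<times> C)" if s: "Re s > 1" for s
  proof -
    have summ: "(\<lambda>m. npow m s) summable_on C" if "Re s > 1" for s
    proof -
      have "((\<lambda>m. (if coprime m n then 1 else 0) * npow m s) has_sum (\<Sum>m. (if coprime (Suc m) n then 1 else 0) * npow (Suc m) s)) C"
        unfolding C_def by (rule coprime_series_has_sum[OF that]) auto
      then have "(\<lambda>m. (if coprime m n then 1 else 0) * npow m s) summable_on C" by (rule has_sum_imp_summable)
      also have "?this \<longleftrightarrow> ?thesis" by (rule summable_on_cong) (simp add: C_def coprimes_to_def)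
      finally show ?thesis .
    qed
    obtain P where P: "((\<lambda>m. npow m s) has_sum P) C" using summ[OF s] by (auto simp: summable_on_def)
    obtain P2 where P2: "((\<lambda>m. npow m (2 * s)) has_sum P2) C" using summ[of "2 * s"] s by (auto simp: summable_on_def)
    have sit: "Re (s + it) > 1" "Re (s - it) > 1" using s by (simp_all add: Re_it)
    have 1: "((\<lambda>m. \<eta> m * npow m s) has_sum L1 s) C"
    proof -
      have "((\<lambda>m. \<psi> (int m) * npow m (s + it)) has_sum L1 s) C"
        unfolding C_def L1_def L_def by (rule coprime_series_has_sum[OF sit(1)]) (auto simp: norm_le_1 eq_0_iff)
      also have "?this \<longleftrightarrow> ?thesis" by (rule has_sum_cong) (simp add: \<eta>_def npow_it(2,3) Cc)
      finally show ?thesis .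
    qed
    have 2: "((\<lambda>m. cnj (\<eta> m) * npow m s) has_sum L2 s) C"
    proof -
      have "((\<lambda>m. cnj (\<psi> (int m)) * npow m (s - it)) has_sum L2 s) C"
        unfolding C_def L2_def conj.L_def by (rule coprime_series_has_sum[OF sit(2)]) (auto simp: norm_le_1 eq_0_iff)
      also have "?this \<longleftrightarrow> ?thesis" by (rule has_sum_cong) (simp add: \<eta>_def npow_it(2,3) Cc)
      finally show ?thesis .
    qed
    have "((\<lambda>(m, g). of_real (norm (\<Sum>d | d dvd m. \<eta> d) ^ 2) * npow m s * npow g (2 * s)) has_sum (P * P * L1 s * L2 s)) (C \<times> C)"
      unfolding C_def
    proof (rule ramanujan_identity)
      fix a b assume "a \<in> coprimes_to n" "b \<in> coprimes_to n"
      then have "a > 0" "b > 0" by (auto simp: coprimes_to_def)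
      then show "\<eta> (a * b) = \<eta> a * \<eta> b" by (simp add: \<eta>_def mult npow_mult)
    next
      fix a assume "a \<in> coprimes_to n"
      then show "norm (\<eta> a) = 1" using Cc[of a] npow_it by (simp add: C_def \<eta>_def norm_mult norm_eq_1)
    qed (use P P2 1 2 in \<open>simp_all add: C_def\<close>)
    also have "P * P * L1 s * L2 s = F s"
    proof -
      have s1: "s \<noteq> 1" using s by auto
      have "g s \<noteq> 0"
      proof -
        have "norm (2 * npow 2 s) = 2 powr (1 - Re s)"
          by (simp add: norm_mult norm_npow powr_diff powr_minus_divide)
        also have "\<dots> < 2 powr 0" using s by (intro powr_less_mono) auto
        finally have less: "norm (2 * npow 2 s) < 1" by simp
        show ?thesis
        proof
          assume "g s = 0"
          then have "2 * npow 2 s = 1" by (simp add: g_def)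
          then show False using less by simp
        qed
      qed
      moreover have "mean_zero_series s = g s * P" using mean_zero_series_eq[OF s] P by (simp add: C_def g_def)
      moreover have cancel: "P * P * a * b = (c * P) * (c * P) * (a / u) * (b / u) / ((c / u) * (c / u))"
        if "c \<noteq> 0" "u \<noteq> 0" for a b c u :: complex
        using that by (simp add: field_simps)
      moreover have "F s = (g s * P) * (g s * P) * (L1 s / (s - 1)) * (L2 s / (s - 1)) / ((g s / (s - 1)) * (g s / (s - 1)))"
        unfolding F_def quot_def \<open>mean_zero_series s = g s * P\<close> using s1 by (simp only: if_False)
      ultimately show ?thesis using s1 by (simp only: cancel[of "g s" "s - 1"] right_minus_eq not_False_eq_True)
    qed
    finally have sum_F: "((\<lambda>(m, g). of_real (norm (\<Sum>d | d dvd m. \<eta> d) ^ 2) * npow m s * npow g (2 * s)) has_sum F s) (C \<times> C)" .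
    show ?thesis
    proof (rule has_sum_cong[THEN iffD1, OF _ sum_F])
      fix i assume "i \<in> C \<times> C"
      then obtain m g where i: "i = (m, g)" by auto
      show "(case i of (m, g) \<Rightarrow> of_real (norm (\<Sum>d | d dvd m. \<eta> d) ^ 2) * npow m s * npow g (2 * s)) = of_real (w i) * exp (- (s * of_real (l i)))"
        by (simp add: i w_def l_def f_def npow_def exp_add [symmetric] algebra_simps)
    qed
  qed
  have "(\<lambda>i. w i * exp (- ((2 - 3/2) * l i))) summable_on (C \<times> C)"
    by (rule landau_nonneg_convergence[OF _ _ F_hol _ F_sum]) (auto simp: w_def l_def dest!: Cc(2))
  moreover have "(\<lambda>g. (1, g)) ` C \<subseteq> C \<times> C" by (auto simp: C_def coprimes_to_def)
  ultimately have "(\<lambda>i. w i * exp (- ((2 - 3/2) * l i))) summable_on ((\<lambda>g. (1, g)) ` C)"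
    by (rule summable_on_subset_banach)
  then have "(\<lambda>g. w (1, g) * exp (- ((2 - 3/2) * l (1, g)))) summable_on C"
    by (subst (asm) summable_on_reindex) (auto simp: inj_on_def o_def)
  also have "?this \<longleftrightarrow> (\<lambda>g. 1 / real g) summable_on C"
  proof (rule summable_on_cong)
    fix g assume "g \<in> C"
    then have "g > 0" using Cc by simp
    then show "w (1, g) * exp (- ((2 - 3/2) * l (1, g))) = 1 / real g"
      by (simp add: w_def l_def f_def \<eta>_def exp_minus inverse_eq_divide)
  qed
  finally show False using not_summable_inverse_coprimes by (simp add: C_def)
qed

end

context dirichlet_character
begin

lemma moebius_sums_at_1:
  assumes odd: "\<psi> (-1) = -1"
  shows "(\<lambda>m. of_int (moebius (Suc m)) * \<psi> (int (Suc m)) * npow (Suc m) 1) sums (1 / L 1)" and "L 1 \<noteq> 0"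
proof -
  have nz: "L z \<noteq> 0" if "Re z \<ge> 1" for z
  proof (cases "Re z = 1")
    case True
    then have "z = 1 + \<i> * of_real (Im z)" by (simp add: complex_eq_iff)
    then show ?thesis using L_nonzero[OF odd, of "Im z"] by simp
  next
    case False
    then have "Re z > 1" using that by simp
    from moebius_has_sum(3)[OF this] show ?thesis by (metis mult_zero_left zero_neq_one)
  qed
  show "(\<lambda>m. of_int (moebius (Suc m)) * \<psi> (int (Suc m)) * npow (Suc m) 1) sums (1 / L 1)"
  proof (rule newman_tauberian[where C = 1 and F = "\<lambda>s. 1 / L s"])
    show "norm (of_int (moebius (Suc m)) * \<psi> (int (Suc m))) \<le> 1" for m
      using mult_mono[OF norm_moebius_le[of "Suc m"] norm_le_1[of "int (Suc m)"]] by (simp add: norm_mult)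
    have "L analytic_on {s. Re s \<ge> 1}"
      using L_odd_holomorphic[OF odd] open_halfspace_Re_gt[of 0]
      unfolding analytic_on_holomorphic by (intro exI[of _ "{s. Re s > 0}"] conjI) auto
    then show "(\<lambda>s. 1 / L s) analytic_on {s. Re s \<ge> 1}"
      by (intro analytic_on_divide analytic_on_const) (simp_all add: nz)
    fix s :: complex assume s: "Re s > 1"
    have "(\<lambda>m. of_int (moebius (Suc m)) * \<psi> (int (Suc m)) * npow (Suc m) s) sums
      (\<Sum>m. of_int (moebius (Suc m)) * \<psi> (int (Suc m)) * npow (Suc m) s)"
      by (rule summable_sums[OF moebius_has_sum(2)[OF s]])
    moreover have "(\<Sum>m. of_int (moebius (Suc m)) * \<psi> (int (Suc m)) * npow (Suc m) s) = 1 / L s"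
      using moebius_has_sum(3)[OF s] nz[of s] s by (subst eq_divide_eq) (simp add: mult.commute)
    ultimately show "(\<lambda>m. of_int (moebius (Suc m)) * \<psi> (int (Suc m)) * npow (Suc m) s) sums (1 / L s)" by simp
  qed
  show "L 1 \<noteq> 0" by (rule nz) simp
qed

end

section \<open>Decomposition of functions on residue classes into characters\<close>

lemma sum_roots_of_unity_eq_0:
  fixes N j :: nat
  assumes "0 < j" "j < N"
  shows "(\<Sum>k<N. cis (- (2 * pi * real j * real k / real N))) = 0"
proof -
  define z where "z = cis (- (2 * pi * real j / real N))"
  have pow: "z ^ k = cis (- (2 * pi * real j * real k / real N))" for k
    unfolding z_def Complex.DeMoivre by (rule arg_cong[of _ _ cis]) simp
  have "z ^ N = cis (- (2 * pi * real j))" unfolding pow using assms by simp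
  also have "\<dots> = 1" using cis_multiple_2pi[of "- real j"] by simp
  finally have zN: "z ^ N = 1" .
  have "z \<noteq> 1"
  proof
    assume "z = 1"
    then have "cos (2 * pi * real j / real N) = 1" by (simp add: z_def complex_eq_iff)
    then obtain k :: int where "2 * pi * real j / real N = of_int k * 2 * pi" by (auto simp: cos_one_2pi_int)
    then have "real j = of_int k * real N" using assms by (simp add: field_simps)
    then have "int j = k * int N" by (metis of_int_eq_iff of_int_mult of_int_of_nat_eq)
    then have "int N dvd int j" by simp
    then show False using assms by (auto dest: zdvd_imp_le)
  qed
  then have "(\<Sum>k<N. z ^ k) = 0" by (simp add: sum_gp_strict zN)
  then show ?thesis by (simp only: pow)
qed

text \<open>
  Functions on the units modulo \<open>n\<close>, as functions on the integers extended by zero.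
\<close>

definition residue_functions :: "nat \<Rightarrow> (int \<Rightarrow> complex) set" where
  "residue_functions n = {f. (\<forall>x y. [x = y] (mod int n) \<longrightarrow> f x = f y) \<and> (\<forall>x. \<not> coprime x (int n) \<longrightarrow> f x = 0)}"

lemma residue_functionsD:
  "f \<in> residue_functions n \<Longrightarrow> [x = y] (mod int n) \<Longrightarrow> f x = f y"
  "f \<in> residue_functions n \<Longrightarrow> \<not> coprime x (int n) \<Longrightarrow> f x = 0"
  by (auto simp: residue_functions_def)

text \<open>
  The projections onto the eigenspaces of the operator \<open>h \<mapsto> h (u * _)\<close>, whose \<open>totient n\<close>-th power is the
  identity by Euler's theorem.
\<close>

lemma eigen_projection:
  fixes u :: int and n :: nat
  assumes n: "n > 0" and u: "coprime u (int n)" and h: "h \<in> residue_functions n"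
  defines "N \<equiv> totient n"
  defines "p \<equiv> (\<lambda>k x. (\<Sum>j<N. cis (- (2 * pi * real j * real k / real N)) * h (u ^ j * x)) / of_nat N)"
  shows "p k \<in> residue_functions n"
    and "p k (u * x) = cis (2 * pi * real k / real N) * p k x"
    and "h x = (\<Sum>k<N. p k x)"
proof -
  have N: "N > 0" using n by (simp add: N_def)
  have cop: "coprime (u ^ j * x) (int n) \<longleftrightarrow> coprime x (int n)" for j x
    using u by simp
  show "p k \<in> residue_functions n"
    unfolding residue_functions_def
  proof (intro CollectI conjI allI impI)
    fix x y assume "[x = y] (mod int n)"
    then have "h (u ^ j * x) = h (u ^ j * y)" for j
      by (intro residue_functionsD(1)[OF h] cong_mult cong_refl)
    then show "p k x = p k y" by (simp only: p_def)
  next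
    fix x assume "\<not> coprime x (int n)"
    then have "h (u ^ j * x) = 0" for j
      by (intro residue_functionsD(2)[OF h]) (simp add: cop)
    then show "p k x = 0" by (simp add: p_def)
  qed
  have "[u ^ N = 1] (mod int n)"
  proof -
    define b where "b = nat (u mod int n)"
    have b: "int b = u mod int n" using n by (simp add: b_def)
    have "coprime (int b) (int n)" using u n by (simp add: b)
    then have "coprime b n" by simp
    then have "[b ^ totient n = 1] (mod n)" by (rule euler_theorem)
    then have "[int b ^ totient n = 1] (mod int n)"
      by (metis cong_int_iff of_nat_1 of_nat_power)
    moreover have "[u ^ N = int b ^ totient n] (mod int n)"
      unfolding N_def by (rule cong_pow) (simp add: b cong_def)
    ultimately show ?thesis using cong_trans by blast
  qed
  then have uN: "h (u ^ N * x) = h x" for x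
    using residue_functionsD(1)[OF h] cong_mult[of "u ^ N" 1 "int n" x x] by fastforce
  define g where "g = (\<lambda>j. cis (- (2 * pi * real j * real k / real N)) * h (u ^ j * x))"
  have "g N = cis (- (2 * pi * real k)) * h x" using N by (simp add: g_def uN mult.assoc)
  moreover have "cis (- (2 * pi * real k)) = 1"
    using cis_multiple_2pi[of "- real k"] by simp
  ultimately have gN: "g N = g 0" by (simp add: g_def)
  have "(\<Sum>j<N. g (Suc j) - g j) = 0" using gN by (simp add: sum_lessThan_telescope)
  then have shift: "(\<Sum>j<N. g (Suc j)) = (\<Sum>j<N. g j)" by (simp add: sum_subtractf)
  have "cis (- (2 * pi * real j * real k / real N)) * h (u ^ j * (u * x)) = cis (2 * pi * real k / real N) * g (Suc j)" for j
  proof -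
    have "cis (2 * pi * real k / real N) * cis (- (2 * pi * real (Suc j) * real k / real N)) = cis (- (2 * pi * real j * real k / real N))"
      unfolding cis_mult by (rule arg_cong[of _ _ cis]) (use N in \<open>simp add: field_simps\<close>)
    moreover have "u ^ j * (u * x) = u ^ Suc j * x" by (simp add: mult_ac)
    ultimately show ?thesis by (simp only: g_def mult.assoc [symmetric])
  qed
  then have "p k (u * x) = (\<Sum>j<N. cis (2 * pi * real k / real N) * g (Suc j)) / of_nat N"
    by (simp only: p_def)
  also have "\<dots> = cis (2 * pi * real k / real N) * ((\<Sum>j<N. g j) / of_nat N)"
    by (simp add: sum_distrib_left [symmetric] shift)
  finally show "p k (u * x) = cis (2 * pi * real k / real N) * p k x"
    by (simp only: p_def g_def)
  have "(\<Sum>k<N. p k x) = (\<Sum>j<N. (\<Sum>k<N. cis (- (2 * pi * real j * real k / real N))) * h (u ^ j * x)) / of_nat N"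
    unfolding p_def sum_divide_distrib [symmetric] sum_distrib_right by (subst sum.swap) (rule refl)
  also have "(\<Sum>j<N. (\<Sum>k<N. cis (- (2 * pi * real j * real k / real N))) * h (u ^ j * x)) = (\<Sum>j<N. if j = 0 then of_nat N * h x else 0)"
    by (rule sum.cong) (use sum_roots_of_unity_eq_0 in auto)
  also have "\<dots> = of_nat N * h x" using N by simp
  finally show "h x = (\<Sum>k<N. p k x)" using N by simp
qed

text \<open>
  Every function on the units is a sum of multiples of characters. Splitting a function by the eigenspaces
  of one unit after the other preserves the eigenvectors found so far; a joint eigenvector \<open>h\<close> of all units
  satisfies \<open>h (a * x) * h 1 = h a * h x\<close> and is thus a multiple of a character. In the form of an induction rule,
  a property closed under sums has to be checked on multiples of characters only.
\<close>

theorem residue_functions_character_induct [consumes 2, case_names zero add character]: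
  fixes P :: "(int \<Rightarrow> complex) \<Rightarrow> bool"
  assumes n: "n > 0" and f: "f \<in> residue_functions n"
    and zero: "P (\<lambda>_. 0)" and add: "\<And>f g. f \<in> residue_functions n \<Longrightarrow> g \<in> residue_functions n \<Longrightarrow> P f \<Longrightarrow> P g \<Longrightarrow> P (\<lambda>x. f x + g x)"
    and char: "\<And>c \<psi>. dirichlet_character n \<psi> \<Longrightarrow> P (\<lambda>x. c * \<psi> x)"
  shows "P f"
proof -
  define Q where "Q = (\<lambda>U. \<forall>h\<in>residue_functions n. (\<forall>u\<in>U. \<exists>c. \<forall>x. h (u * x) = c * h x) \<longrightarrow> P h)"
  have sum: "P (\<lambda>x. \<Sum>k\<in>K. p k x) \<and> (\<lambda>x. \<Sum>k\<in>K. p k x) \<in> residue_functions n"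
    if "finite K" "\<And>k. p k \<in> residue_functions n" "\<And>k. P (p k)" for K :: "nat set" and p
    using that(1)
  proof induction
    case empty
    show ?case using zero by (simp add: residue_functions_def)
  next
    case (insert k K)
    have IH: "P (\<lambda>x. \<Sum>k\<in>K. p k x)" "(\<lambda>x. \<Sum>k\<in>K. p k x) \<in> residue_functions n"
      using insert.IH by simp_all
    have "(\<lambda>x. p k x + (\<Sum>k\<in>K. p k x)) \<in> residue_functions n"
      unfolding residue_functions_def
    proof (intro CollectI conjI allI impI)
      fix x y assume xy: "[x = y] (mod int n)"
      show "p k x + (\<Sum>k\<in>K. p k x) = p k y + (\<Sum>k\<in>K. p k y)"
        by (simp only: residue_functionsD(1)[OF that(2) xy])
    next
      fix x assume x: "\<not> coprime x (int n)"
      show "p k x + (\<Sum>k\<in>K. p k x) = 0"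
        by (simp add: residue_functionsD(2)[OF that(2) x])
    qed
    moreover have "P (\<lambda>x. p k x + (\<Sum>k\<in>K. p k x))"
      by (rule add[OF that(2) IH(2) that(3) IH(1)])
    ultimately show ?case using insert.hyps by simp
  qed
  have step: "Q U" if QU: "Q (insert u U)" and u: "coprime u (int n)" for u U
    unfolding Q_def
  proof (intro ballI impI)
    fix h assume h: "h \<in> residue_functions n" and eig: "\<forall>u\<in>U. \<exists>c. \<forall>x. h (u * x) = c * h x"
    define N where "N = totient n"
    define p where "p = (\<lambda>k x. (\<Sum>j<N. cis (- (2 * pi * real j * real k / real N)) * h (u ^ j * x)) / of_nat N)"
    have pr: "p k \<in> residue_functions n" "p k (u * x) = cis (2 * pi * real k / real N) * p k x"
        "h x = (\<Sum>k<N. p k x)" for k x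
      unfolding p_def N_def
      by (fact eigen_projection(1)[OF n u h], fact eigen_projection(2)[OF n u h], fact eigen_projection(3)[OF n u h])
    have "P (p k)" for k
    proof -
      have "\<exists>c. \<forall>x. p k (v * x) = c * p k x" if v: "v \<in> U" for v
      proof -
        from eig v obtain c where c: "\<And>x. h (v * x) = c * h x" by blast
        have "h (u ^ j * (v * x)) = c * h (u ^ j * x)" for j x
          using c[of "u ^ j * x"] by (simp add: mult.left_commute)
        then have "p k (v * x) = c * p k x" for x
          by (simp add: p_def sum_distrib_left mult.left_commute)
        then show ?thesis by blast
      qed
      moreover have "\<exists>c. \<forall>x. p k (u * x) = c * p k x" by (intro exI allI) (rule pr(2))
      ultimately have "\<forall>v\<in>insert u U. \<exists>c. \<forall>x. p k (v * x) = c * p k x" by simp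
      then show ?thesis by (rule QU[unfolded Q_def, THEN bspec, OF pr(1), THEN mp])
    qed
    then have "P (\<lambda>x. \<Sum>k<N. p k x)" using sum[of "{..<N}" p, OF finite_lessThan pr(1)] by simp
    moreover have "h = (\<lambda>x. \<Sum>k<N. p k x)" by (rule ext) (rule pr(3))
    ultimately show "P h" by simp
  qed
  have down: "Q {}" if "finite U" "Q U" "\<forall>u\<in>U. coprime u (int n)" for U
    using that
  proof (induction U rule: finite_induct)
    case (insert u U)
    have "Q U" by (rule step[OF insert.prems(1)]) (use insert.prems in simp)
    then show ?case using insert.IH insert.prems by simp
  qed simp
  define G where "G = {u. 0 \<le> u \<and> u < int n \<and> coprime u (int n)}"
  have finG: "finite G" by (rule finite_subset[of _ "{0..<int n}"]) (auto simp: G_def)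
  have "Q G"
    unfolding Q_def
  proof (intro ballI impI)
    fix h assume h: "h \<in> residue_functions n" and eig: "\<forall>u\<in>G. \<exists>c. \<forall>x. h (u * x) = c * h x"
    have eig': "h (a * x) * h 1 = h a * h x" for a x
    proof (cases "coprime a (int n)")
      case False
      then have "\<not> coprime (a * x) (int n)" by simp
      then show ?thesis using False residue_functionsD(2)[OF h] by simp
    next
      case True
      define u where "u = a mod int n"
      have ua: "[u = a] (mod int n)" by (simp add: u_def cong_def)
      have "u \<in> G" using n True by (simp add: G_def u_def)
      then obtain c where c: "\<And>x. h (u * x) = c * h x" using eig by blast
      have "h (u * x) = h (a * x)" by (rule residue_functionsD(1)[OF h]) (rule cong_mult[OF ua cong_refl])
      moreover have "h u = h a" by (rule residue_functionsD(1)[OF h ua])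
      ultimately show ?thesis using c[of x] c[of 1] by simp
    qed
    show "P h"
    proof (cases "h 1 = 0")
      case True
      have "h x = 0" for x
        using eig'[of x x] True by simp
      then have "h = (\<lambda>_. 0)" by blast
      then show ?thesis using zero by simp
    next
      case False
      define \<psi> where "\<psi> = (\<lambda>x. h x / h 1)"
      have m: "\<psi> (a * b) = \<psi> a * \<psi> b" for a b
        using eig'[of a b] False by (simp add: \<psi>_def field_simps)
      have c: "\<psi> a = \<psi> b" if "[a = b] (mod int n)" for a b
        using residue_functionsD(1)[OF h that] by (simp add: \<psi>_def)
      have "dirichlet_character n \<psi>"
      proof
        show "n > 0" by (rule n)
        show "\<psi> a = 0 \<longleftrightarrow> \<not> coprime a (int n)" for a
        proof
          assume "\<not> coprime a (int n)"
          then show "\<psi> a = 0" using residue_functionsD(2)[OF h] by (simp add: \<psi>_def)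
        next
          assume z: "\<psi> a = 0"
          show "\<not> coprime a (int n)"
          proof
            assume "coprime a (int n)"
            then obtain b where "[a * b = 1] (mod int n)" using cong_solve_coprime_int by blast
            then have "\<psi> (a * b) = \<psi> 1" by (rule c)
            then have "\<psi> a * \<psi> b = \<psi> 1" by (simp only: m)
            then show False using z False by (simp add: \<psi>_def)
          qed
        qed
      qed (fact m c)+
      then have "P (\<lambda>x. h 1 * \<psi> x)" by (rule char)
      then show ?thesis using False by (simp add: \<psi>_def)
    qed
  qed
  then have "Q {}" by (rule down[OF finG]) (simp add: G_def)
  then show ?thesis using f by (simp add: Q_def)
qed

section \<open>The convolution identity for sums over residue classes\<close>

text \<open>
  The sum of \<open>f m / m^r\<close> over the non-zero integers \<open>m\<close> is the sum of \<open>parity_part r f m / m^r\<close> over the positive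
  ones; for \<open>r = 1\<close> this is the symmetric summation.
\<close>

definition parity_part :: "nat \<Rightarrow> (int \<Rightarrow> complex) \<Rightarrow> int \<Rightarrow> complex" where
  "parity_part r f x = f x + (- 1) ^ r * f (- x)"

definition Lterm :: "nat \<Rightarrow> (int \<Rightarrow> complex) \<Rightarrow> nat \<Rightarrow> complex" where
  "Lterm r f m = parity_part r f (int (Suc m)) * npow (Suc m) (of_nat r)"

definition Mterm :: "nat \<Rightarrow> (int \<Rightarrow> complex) \<Rightarrow> nat \<Rightarrow> complex" where
  "Mterm r f m = of_int (moebius (Suc m)) * parity_part r f (int (Suc m)) * npow (Suc m) (of_nat r)"

definition Lsum :: "nat \<Rightarrow> (int \<Rightarrow> complex) \<Rightarrow> complex" where
  "Lsum r f = (\<Sum>m. Lterm r f m)"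

definition Msum :: "nat \<Rightarrow> (int \<Rightarrow> complex) \<Rightarrow> complex" where
  "Msum r f = (\<Sum>m. Mterm r f m)"

definition residue_indicator :: "nat \<Rightarrow> int \<Rightarrow> int \<Rightarrow> complex" where
  "residue_indicator n a x = (if [x = a] (mod int n) then 1 else 0)"

definition unit_residues :: "nat \<Rightarrow> int set" where
  "unit_residues n = {a. 0 \<le> a \<and> a < int n \<and> coprime a (int n)}"

lemma finite_unit_residues [simp]: "finite (unit_residues n)"
  by (rule finite_subset[of _ "{0..<int n}"]) (auto simp: unit_residues_def)

lemma unit_residues_coprime: "a \<in> unit_residues n \<Longrightarrow> coprime a (int n)"
  by (simp add: unit_residues_def)

lemma residue_indicator_in_residue_functions:
  assumes "coprime a (int n)"
  shows "residue_indicator n a \<in> residue_functions n"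
  unfolding residue_functions_def
proof (intro CollectI conjI allI impI)
  fix x y assume "[x = y] (mod int n)"
  then show "residue_indicator n a x = residue_indicator n a y"
    using cong_trans[of x y "int n" a] cong_trans[of y x "int n" a] cong_sym by (auto simp: residue_indicator_def)
next
  fix x assume "\<not> coprime x (int n)"
  then have "\<not> [x = a] (mod int n)" using assms cong_imp_coprime cong_sym by blast
  then show "residue_indicator n a x = 0" by (simp add: residue_indicator_def)
qed

lemma residue_functions_bounded:
  assumes n: "n > 0" and f: "f \<in> residue_functions n"
  shows "norm (f x) \<le> (\<Sum>m<n. norm (f (int m)))"
proof -
  define m where "m = nat (x mod int n)"
  have m: "int m = x mod int n" using n by (simp add: m_def)
  have "m < n" using n by (simp add: m_def nat_less_iff)
  have "f x = f (int m)" by (rule residue_functionsD(1)[OF f]) (simp add: m cong_def)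
  then show ?thesis using \<open>m < n\<close> member_le_sum[of m "{..<n}" "\<lambda>m. norm (f (int m))"] by simp
qed

lemma parity_part_bounded:
  assumes n: "n > 0" and f: "f \<in> residue_functions n"
  shows "norm (parity_part r f x) \<le> 2 * (\<Sum>m<n. norm (f (int m)))"
proof -
  have "norm (parity_part r f x) \<le> norm (f x) + norm ((- 1) ^ r * f (- x))"
    unfolding parity_part_def by (rule norm_triangle_ineq)
  also have "norm ((- 1) ^ r * f (- x)) = norm (f (- x))" by (simp add: norm_mult norm_power)
  finally show ?thesis
    using residue_functions_bounded[OF n f, of x] residue_functions_bounded[OF n f, of "- x"] by simp
qed

text \<open>
  For \<open>r = 1\<close> the function \<open>m \<mapsto> f m - f (- m)\<close> has mean zero over a period, which gives conditional
  convergence.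
\<close>

lemma Lterm_summable:
  assumes n: "n > 0" and f: "f \<in> residue_functions n" and r: "r \<ge> 1"
  shows "summable (Lterm r f)"
proof (cases "r = 1")
  case False
  then have "Re (of_nat r) > 1" using r by simp
  from dirichlet_series_has_sum(2)[where u = "\<lambda>m. parity_part r f (int m)", OF parity_part_bounded[OF n f] this]
  show ?thesis unfolding Lterm_def [abs_def] .
next
  case True
  define u where "u = (\<lambda>m. parity_part 1 f (int (Suc m)))"
  have "norm (\<Sum>m<M. u m) \<le> (\<Sum>m<n. norm (u m))" for M
  proof (rule periodic_partial_sums_bounded[OF n])
    show "u (m + n) = u m" for m
    proof -
      have "f (int (Suc (m + n))) = f (int (Suc m))" "f (- int (Suc (m + n))) = f (- int (Suc m))"
        by (rule residue_functionsD(1)[OF f], simp add: cong_iff_dvd_diff)+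
      then show ?thesis by (simp only: u_def parity_part_def)
    qed
    have "(\<Sum>m<n. f (- int (Suc m))) = (\<Sum>m<n. f (- int (Suc (n - Suc m))))"
      by (rule sum.nat_diff_reindex[symmetric])
    also have "\<dots> = (\<Sum>m<n. f (int m))"
      by (intro sum.cong refl residue_functionsD(1)[OF f]) (auto simp: of_nat_diff cong_iff_dvd_diff)
    finally have 1: "(\<Sum>m<n. f (- int (Suc m))) = (\<Sum>m<n. f (int m))" .
    have "(\<Sum>m<n. f (int (Suc m)) - f (int m)) = f (int n) - f (int 0)"
      by (rule sum_lessThan_telescope)
    also have "f (int n) = f (int 0)"
      by (rule residue_functionsD(1)[OF f]) (simp add: cong_def)
    finally have "(\<Sum>m<n. f (int (Suc m))) = (\<Sum>m<n. f (int m))"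
      by (simp only: sum_subtractf) simp
    then show "(\<Sum>m<n. u m) = 0"
      unfolding u_def parity_part_def sum.distrib sum_distrib_left [symmetric] 1 by simp
  qed
  from dirichlet_series_abel_sums(1)[OF this, of 1] show ?thesis
    unfolding True Lterm_def [abs_def] u_def by simp
qed

context dirichlet_character
begin

lemma in_residue_functions: "\<psi> \<in> residue_functions n"
  using cong eq_0_iff by (auto simp: residue_functions_def)

lemma minus_one: "\<psi> (-1) = 1 \<or> \<psi> (-1) = -1"
proof -
  have "\<psi> (-1) * \<psi> (-1) = 1" using mult[of "-1" "-1"] by simp
  then show ?thesis by (simp add: square_eq_1_iff)
qed

lemma parity_part_eq: "parity_part r \<psi> x = (if \<psi> (-1) = (-1) ^ r then 2 else 0) * \<psi> x"
proof -
  have "\<psi> (- x) = \<psi> (-1) * \<psi> x" using mult[of "-1" x] by simp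
  then show ?thesis using minus_one by (cases "even r") (auto simp: parity_part_def)
qed

text \<open>
  If the parity of \<open>\<psi>\<close> agrees with that of \<open>r\<close>, both sums are twice the series over the positive integers, and
  these are inverse to each other; otherwise everything vanishes. Only for \<open>r = 1\<close> is there no absolute
  convergence; then \<open>\<psi>\<close> is odd.
\<close>

lemma Lsum_Msum:
  assumes r: "r \<ge> 1"
  shows "summable (Mterm r \<psi>)"
    and "Lsum r \<psi> * Msum r \<psi> = (if \<psi> (-1) = (-1) ^ r then 4 else 0)"
proof -
  have "summable (Mterm r \<psi>) \<and> Lsum r \<psi> * Msum r \<psi> = (if \<psi> (-1) = (-1) ^ r then 4 else 0)"
  proof (cases "\<psi> (-1) = (-1) ^ r")
    case False
    then have "Mterm r \<psi> m = 0" for m by (simp add: Mterm_def parity_part_eq)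
    then have "Mterm r \<psi> = (\<lambda>_. 0)" by blast
    then show ?thesis using False by (simp add: Msum_def)
  next
    case True
    define m where "m = (\<lambda>k. of_int (moebius (Suc k)) * \<psi> (int (Suc k)) * npow (Suc k) (of_nat r))"
    have L: "Lsum r \<psi> = 2 * L (of_nat r)" if "summable (\<lambda>m. \<psi> (int (Suc m)) * npow (Suc m) (of_nat r))"
      unfolding Lsum_def Lterm_def L_def parity_part_eq using True by (subst suminf_mult[OF that, symmetric]) (simp add: mult.assoc)
    have M: "Mterm r \<psi> = (\<lambda>k. 2 * m k)"
      using True by (simp add: fun_eq_iff Mterm_def m_def parity_part_eq)
    have "summable m \<and> summable (\<lambda>m. \<psi> (int (Suc m)) * npow (Suc m) (of_nat r)) \<and> L (of_nat r) * suminf m = 1"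
    proof (cases "r = 1")
      case r1: True
      then have odd: "\<psi> (-1) = -1" using True by simp
      have 1: "m sums (1 / L 1)" using moebius_sums_at_1(1)[OF odd] by (simp add: m_def r1)
      moreover have "summable (\<lambda>m. \<psi> (int (Suc m)) * npow (Suc m) (of_nat r))"
        by (rule L_odd_summable[OF odd]) (simp add: r1)
      ultimately show ?thesis using moebius_sums_at_1(2)[OF odd] r1 by (auto simp: sums_iff)
    next
      case False
      then have r2: "Re (of_nat r) > 1" using r by simp
      show ?thesis
        unfolding m_def using moebius_has_sum(2,3)[OF r2]
          dirichlet_series_has_sum(2)[of "\<lambda>m. \<psi> (int m)" 1, OF norm_le_1 r2] by blast
    qed
    then show ?thesis using True L by (simp add: M Msum_def suminf_mult summable_mult)
  qed
  then show "summable (Mterm r \<psi>)" "Lsum r \<psi> * Msum r \<psi> = (if \<psi> (-1) = (-1) ^ r then 4 else 0)" by auto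
qed

end

lemma Lsum_sum:
  assumes n: "n > 0" and r: "r \<ge> 1" and f: "\<And>a. a \<in> A \<Longrightarrow> f a \<in> residue_functions n" and "finite A"
  shows "Lsum r (\<lambda>x. \<Sum>a\<in>A. c a * f a x) = (\<Sum>a\<in>A. c a * Lsum r (f a))"
proof -
  have "Lterm r (\<lambda>x. \<Sum>a\<in>A. c a * f a x) m = (\<Sum>a\<in>A. c a * Lterm r (f a) m)" for m
    by (simp add: Lterm_def parity_part_def sum_distrib_left sum_distrib_right sum.distrib [symmetric] algebra_simps)
  then have "Lsum r (\<lambda>x. \<Sum>a\<in>A. c a * f a x) = (\<Sum>m. \<Sum>a\<in>A. c a * Lterm r (f a) m)"
    by (simp only: Lsum_def)
  also have "\<dots> = (\<Sum>a\<in>A. \<Sum>m. c a * Lterm r (f a) m)"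
    by (rule suminf_sum) (intro summable_mult Lterm_summable[OF n f r])
  also have "\<dots> = (\<Sum>a\<in>A. c a * Lsum r (f a))"
    unfolding Lsum_def by (intro sum.cong refl suminf_mult Lterm_summable[OF n f r])
  finally show ?thesis .
qed

lemma residue_functions_expand:
  assumes n: "n > 0" and f: "f \<in> residue_functions n"
  shows "f = (\<lambda>x. \<Sum>a\<in>unit_residues n. f a * residue_indicator n a x)"
proof
  fix x
  let ?u = "x mod int n"
  have u: "[x = ?u] (mod int n)" by (simp add: cong_def)
  have ind: "residue_indicator n a x = (if a = ?u then 1 else 0)" if "a \<in> unit_residues n" for a
    using that n by (auto simp: residue_indicator_def cong_def unit_residues_def)
  have "(\<Sum>a\<in>unit_residues n. f a * residue_indicator n a x) = (\<Sum>a\<in>unit_residues n. if a = ?u then f a else 0)"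
    by (intro sum.cong refl) (simp add: ind)
  also have "\<dots> = (if ?u \<in> unit_residues n then f ?u else 0)" by simp
  also have "\<dots> = f x"
  proof (cases "coprime x (int n)")
    case True
    then have "?u \<in> unit_residues n" using n by (simp add: unit_residues_def)
    then show ?thesis using residue_functionsD(1)[OF f u] by simp
  next
    case False
    then have "?u \<notin> unit_residues n" using n by (simp add: unit_residues_def)
    then show ?thesis using residue_functionsD(2)[OF f False] by simp
  qed
  finally show "f x = (\<Sum>a\<in>unit_residues n. f a * residue_indicator n a x)" by simp
qed

text \<open>
  \<open>L\<close> and \<open>M\<close> are convolution inverses up to parity, in a form linear in a test function \<open>f\<close>. Linearity
  permits to take \<open>f\<close> to be a character, where the sum over \<open>a\<close> factors into \<open>Lsum r \<psi> * Msum r \<psi>\<close>.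
\<close>

theorem moebius_convolution:
  assumes n: "n > 0" and r: "r \<ge> 1" and f: "f \<in> residue_functions n"
  shows "(\<forall>a. summable (Mterm r (\<lambda>x. f (a * x)))) \<and>
    (\<Sum>a\<in>unit_residues n. Lsum r (residue_indicator n a) * Msum r (\<lambda>x. f (a * x))) = 2 * (f 1 + (- 1) ^ r * f (- 1))"
  using n f
proof (induction rule: residue_functions_character_induct)
  case zero
  then show ?case by (simp add: Msum_def Mterm_def [abs_def] parity_part_def)
next
  case (add f g)
  have M: "Mterm r (\<lambda>x. f (a * x) + g (a * x)) = (\<lambda>m. Mterm r (\<lambda>x. f (a * x)) m + Mterm r (\<lambda>x. g (a * x)) m)" for a
    by (simp add: fun_eq_iff Mterm_def parity_part_def algebra_simps)
  have "Msum r (\<lambda>x. f (a * x) + g (a * x)) = Msum r (\<lambda>x. f (a * x)) + Msum r (\<lambda>x. g (a * x))" for a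
    unfolding Msum_def M using add.IH by (intro suminf_add [symmetric]) auto
  then show ?case using add.IH by (simp add: M summable_add distrib_left sum.distrib)
next
  case (character c \<psi>)
  interpret dirichlet_character n \<psi> by fact
  have M: "Mterm r (\<lambda>x. c * \<psi> (a * x)) = (\<lambda>m. (c * \<psi> a) * Mterm r \<psi> m)" for a
    by (simp add: fun_eq_iff Mterm_def parity_part_def mult algebra_simps)
  have s: "summable (Mterm r (\<lambda>x. c * \<psi> (a * x)))" for a
    unfolding M by (intro summable_mult Lsum_Msum(1)[OF r])
  have "Msum r (\<lambda>x. c * \<psi> (a * x)) = (c * \<psi> a) * Msum r \<psi>" for a
    unfolding Msum_def M by (rule suminf_mult[OF Lsum_Msum(1)[OF r]])
  then have "(\<Sum>a\<in>unit_residues n. Lsum r (residue_indicator n a) * Msum r (\<lambda>x. c * \<psi> (a * x))) =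
     c * Msum r \<psi> * (\<Sum>a\<in>unit_residues n. \<psi> a * Lsum r (residue_indicator n a))"
    by (simp add: sum_distrib_left mult_ac)
  also have "(\<Sum>a\<in>unit_residues n. \<psi> a * Lsum r (residue_indicator n a)) = Lsum r (\<lambda>x. \<Sum>a\<in>unit_residues n. \<psi> a * residue_indicator n a x)"
    by (rule Lsum_sum[OF n_pos r, symmetric]) (simp_all add: residue_indicator_in_residue_functions unit_residues_coprime)
  also have "(\<lambda>x. \<Sum>a\<in>unit_residues n. \<psi> a * residue_indicator n a x) = \<psi>"
    by (rule residue_functions_expand[OF n_pos in_residue_functions, symmetric])
  also have "c * Msum r \<psi> * Lsum r \<psi> = c * (Lsum r \<psi> * Msum r \<psi>)" by simp
  also have "\<dots> = 2 * (c * \<psi> 1 + (- 1) ^ r * (c * \<psi> (- 1)))"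
    using minus_one unfolding Lsum_Msum(2)[OF r] by (cases "even r") auto
  finally show ?case using s by simp
qed

corollary moebius_convolution_indicator:
  assumes n: "n > 0" and r: "r \<ge> 1" and c: "coprime c (int n)"
  shows "summable (Mterm r (residue_indicator n c))"
    and "(\<Sum>a\<in>unit_residues n. Lsum r (residue_indicator n a) * Msum r (\<lambda>x. residue_indicator n c (a * x))) =
     2 * (residue_indicator n c 1 + (- 1) ^ r * residue_indicator n c (- 1))"
  using moebius_convolution[OF n r residue_indicator_in_residue_functions[OF c]]
  by (auto dest: spec[of _ 1])

text \<open>
  The partial sums over \<open>|m| \<le> K\<close> are those of \<open>Mterm\<close>; for \<open>r \<ge> 2\<close> absolute summability over the integers
  makes them converge to the unordered sum.
\<close>

lemma d_num_eq_Msum: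
  assumes n: "n > 0" and r: "r \<ge> 1" and j: "coprime j (int n)"
  shows "of_real (d_num n r j) = Msum r (residue_indicator n j)"
proof -
  define f where "f = residue_indicator n j"
  have sm: "Mterm r f sums Msum r f"
    unfolding f_def Msum_def by (rule summable_sums[OF moebius_convolution_indicator(1)[OF n r j]])
  define t :: "int \<Rightarrow> real" where "t = (\<lambda>m. real_of_int (moebius (nat \<bar>m\<bar>)) / real_of_int m ^ r)"
  let ?S = "\<lambda>K::nat. {m. \<bar>m\<bar> \<le> int K \<and> [m = j] (mod int n)}"
  have part: "of_real (sum t (?S K)) = (\<Sum>m<K. Mterm r f m)" for K
  proof (induction K)
    case 0
    have "?S 0 \<subseteq> {0}" by auto
    moreover have "t 0 = 0" using r by (simp add: t_def moebius_def)
    ultimately have "sum t (?S 0) = 0" by (intro sum.neutral) auto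
    then show ?case by simp
  next
    case (Suc K)
    let ?D = "{m. m \<in> {int (Suc K), - int (Suc K)} \<and> [m = j] (mod int n)}"
    have "?S (Suc K) = ?S K \<union> ?D" by auto
    moreover have "finite (?S K)" by (rule finite_subset[of _ "{- int K..int K}"]) auto
    moreover have "?S K \<inter> ?D = {}" by auto
    moreover have "finite ?D" by (rule finite_subset[of _ "{int (Suc K), - int (Suc K)}"]) auto
    ultimately have "sum t (?S (Suc K)) = sum t (?S K) + sum t ?D"
      by (simp only: sum.union_disjoint)
    also have "sum t ?D = (\<Sum>m\<in>{int (Suc K), - int (Suc K)}. if [m = j] (mod int n) then t m else 0)"
      by (subst sum.inter_filter [symmetric]) (auto)
    also have "\<dots> = (if [int (Suc K) = j] (mod int n) then t (int (Suc K)) else 0) +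
         (if [- int (Suc K) = j] (mod int n) then t (- int (Suc K)) else 0)"
      by (subst sum.insert) auto
    finally have "of_real (sum t (?S (Suc K))) = of_real (sum t (?S K)) +
       (if [int (Suc K) = j] (mod int n) then complex_of_real (t (int (Suc K))) else 0) +
         (if [- int (Suc K) = j] (mod int n) then complex_of_real (t (- int (Suc K))) else 0)"
      by simp
    moreover have "complex_of_real (t (int (Suc K))) = of_int (moebius (Suc K)) * npow (Suc K) (of_nat r)"
      by (simp add: t_def npow_of_nat del: of_nat_Suc)
    moreover have "complex_of_real (t (- int (Suc K))) = (- 1) ^ r * (of_int (moebius (Suc K)) * npow (Suc K) (of_nat r))"
      by (cases "even r") (simp_all add: t_def npow_of_nat del: of_nat_Suc)
    ultimately show ?case
      using Suc.IH by (simp add: Mterm_def parity_part_def f_def residue_indicator_def distrib_left distrib_right)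
  qed
  show ?thesis
  proof (cases "r = 1")
    case True
    have lim: "(\<lambda>K. complex_of_real (sum t (?S K))) \<longlonglongrightarrow> Msum r f"
      unfolding part using sm by (simp add: sums_def)
    have re: "(\<lambda>K. sum t (?S K)) \<longlonglongrightarrow> Re (Msum r f)"
      using tendsto_Re[OF lim] by (simp only: Re_complex_of_real)
    have im: "Im (Msum r f) = 0"
      using tendsto_Im[OF lim] by (simp only: Im_complex_of_real LIMSEQ_const_iff)
    from re have "d_num n r j = Re (Msum r f)"
      using True by (simp add: d_num_def t_def limI)
    then show ?thesis using im by (simp add: f_def complex_eq_iff)
  next
    case False
    then have r2: "r \<ge> 2" using r by simp
    have nat: "(\<lambda>k. 1 / real k ^ r) summable_on UNIV"
      using inverse_power_summable[OF r2, where 'a = real]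
      by (intro summable_nonneg_imp_summable_on) (simp_all add: inverse_eq_divide)
    have "(\<lambda>m. 1 / \<bar>real_of_int m\<bar> ^ r) summable_on range int"
      using nat by (subst summable_on_reindex) (simp_all add: o_def)
    moreover have "(\<lambda>m. 1 / \<bar>real_of_int m\<bar> ^ r) summable_on range (\<lambda>k. - int k)"
      using nat by (subst summable_on_reindex) (simp_all add: o_def inj_on_def)
    ultimately have "(\<lambda>m. 1 / \<bar>real_of_int m\<bar> ^ r) summable_on (range int \<union> range (\<lambda>k. - int k))"
      by (rule summable_on_union)
    also have "range int \<union> range (\<lambda>k. - int k) = UNIV"
    proof safe
      fix x :: int assume "x \<notin> range (\<lambda>k. - int k)"
      then have "x \<ge> 0" by (metis int_cases2 rangeI zero_le_imp_eq_int of_nat_0_le_iff)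
      then show "x \<in> range int" by (metis rangeI zero_le_imp_eq_int)
    qed auto
    finally have bnd: "(\<lambda>m. 1 / \<bar>real_of_int m\<bar> ^ r) summable_on UNIV" .
    let ?A = "{m. [m = j] (mod int n)}"
    have "t summable_on UNIV"
    proof (rule abs_summable_summable, rule Infinite_Sum.abs_summable_on_comparison_test'[OF bnd])
      fix x :: int
      have "\<bar>real_of_int (moebius (nat \<bar>x\<bar>))\<bar> \<le> 1" by (simp add: moebius_def power_abs)
      then show "norm (t x) \<le> 1 / \<bar>real_of_int x\<bar> ^ r"
        by (simp add: t_def power_abs divide_right_mono)
    qed
    then have "t summable_on ?A" by (rule summable_on_subset_banach) simp
    then have "(t has_sum infsum t ?A) ?A" by simp
    then have lim: "(sum t \<longlongrightarrow> infsum t ?A) (finite_subsets_at_top ?A)" by (simp only: has_sum_def)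
    have "filterlim ?S (finite_subsets_at_top ?A) sequentially"
      unfolding filterlim_finite_subsets_at_top
    proof (intro allI impI)
      fix X :: "int set" assume X: "finite X \<and> X \<subseteq> ?A"
      show "\<forall>\<^sub>F K in sequentially. finite (?S K) \<and> X \<subseteq> ?S K \<and> ?S K \<subseteq> ?A"
        using eventually_ge_at_top[of "\<Sum>x\<in>X. nat \<bar>x\<bar>"]
      proof eventually_elim
        case (elim K)
        have "finite (?S K)" by (rule finite_subset[of _ "{- int K..int K}"]) auto
        moreover have "\<bar>x\<bar> \<le> int K" if "x \<in> X" for x
          using member_le_sum[of x X "\<lambda>x. nat \<bar>x\<bar>"] that X elim by simp
        ultimately show ?case using X by auto
      qed
    qed
    from filterlim_compose[OF lim this] have "(\<lambda>K. sum t (?S K)) \<longlonglongrightarrow> infsum t ?A" .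
    then have "(\<lambda>K. complex_of_real (sum t (?S K))) \<longlonglongrightarrow> of_real (infsum t ?A)"
      by (rule tendsto_of_real)
    moreover have "(\<lambda>K. complex_of_real (sum t (?S K))) \<longlonglongrightarrow> Msum r f"
      unfolding part using sm by (simp add: sums_def)
    ultimately have "of_real (infsum t ?A) = Msum r f" by (rule LIMSEQ_unique)
    then show ?thesis using False by (simp add: d_num_def t_def f_def)
  qed
qed

section \<open>Generating functions of Bernoulli values\<close>

definition bernoulli_egf :: "real \<Rightarrow> real fps" where
  "bernoulli_egf x = fps_X * fps_exp x / (fps_exp 1 - 1)"

definition bernoulli_egf_complex :: "real \<Rightarrow> complex fps" where
  "bernoulli_egf_complex x = Abs_fps (\<lambda>k. of_real (fps_nth (bernoulli_egf x) k))"

lemma bernoulli_poly_eq_coeff: "bernoulli_poly r x = fact r * fps_nth (bernoulli_egf x) r"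
  by (simp only: bernoulli_poly_def bernoulli_egf_def)

lemma fps_exp_minus_1_nonzero: "fps_exp (1 :: 'a :: field_char_0) - 1 \<noteq> 0"
proof
  assume "fps_exp (1 :: 'a) - 1 = 0"
  then have "fps_nth (fps_exp (1 :: 'a) - 1) 1 = 0" by simp
  then show False by simp
qed

lemma bernoulli_egf_mult: "bernoulli_egf x * (fps_exp 1 - 1) = fps_X * fps_exp x"
proof -
  have "subdegree (fps_exp (1::real) - 1) = 1"
    by (rule subdegreeI) auto
  moreover have "subdegree (fps_X * fps_exp x) = 1"
    by (rule subdegreeI) auto
  moreover have "fps_X * fps_exp x \<noteq> 0" by (metis fps_X_neq_zero fps_exp_neq_0 mult_eq_0_iff)
  ultimately have "fps_exp 1 - 1 dvd fps_X * fps_exp x"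
    using fps_exp_minus_1_nonzero by (subst fps_dvd_iff) auto
  then show ?thesis unfolding bernoulli_egf_def by (rule dvd_div_mult_self)
qed

lemma bernoulli_egf_complex_mult:
  "bernoulli_egf_complex x * (fps_exp 1 - 1) = fps_X * fps_exp (of_real x)"
proof (rule fps_ext)
  fix k
  have "fps_nth (bernoulli_egf_complex x * (fps_exp 1 - 1)) k = of_real (fps_nth (bernoulli_egf x * (fps_exp 1 - 1)) k)"
    by (auto simp: fps_mult_nth bernoulli_egf_complex_def intro!: sum.cong)
  also have "\<dots> = fps_nth (fps_X * fps_exp (of_real x)) k"
    unfolding bernoulli_egf_mult by (cases k) simp_all
  finally show "fps_nth (bernoulli_egf_complex x * (fps_exp 1 - 1)) k = fps_nth (fps_X * fps_exp (of_real x)) k" .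
qed

lemma bernoulli_poly_eq_complex_coeff:
  "complex_of_real (bernoulli_poly r x) = fact r * fps_nth (bernoulli_egf_complex x) r"
  by (simp add: bernoulli_poly_eq_coeff bernoulli_egf_complex_def)

lemma bernoulli_poly_1: "bernoulli_poly r 1 = bernoulli_poly r 0 + (if r = 1 then 1 else 0)"
proof -
  have "(bernoulli_egf 1 - bernoulli_egf 0) * (fps_exp 1 - 1) = fps_X * (fps_exp 1 - 1)"
    using bernoulli_egf_mult[of 1] bernoulli_egf_mult[of 0] by (simp add: algebra_simps)
  then have "bernoulli_egf 1 - bernoulli_egf 0 = fps_X"
    by (rule mult_right_cancel[OF fps_exp_minus_1_nonzero, THEN iffD1])
  then have "fps_nth (bernoulli_egf 1 - bernoulli_egf 0) r = fps_nth fps_X r" by (simp only:)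
  then have "fps_nth (bernoulli_egf 1) r - fps_nth (bernoulli_egf 0) r = (if r = 1 then 1 else 0)"
    by (simp only: fps_sub_nth fps_X_nth)
  then have "fps_nth (bernoulli_egf 1) r = fps_nth (bernoulli_egf 0) r + (if r = 1 then 1 else 0)"
    by linarith
  then show ?thesis by (simp add: bernoulli_poly_eq_coeff)
qed

text \<open>
  Replacing \<open>X\<close> by \<open>-X\<close> in \<open>X / (exp X - 1)\<close> gives \<open>X exp X / (exp X - 1)\<close>.
\<close>

lemma bernoulli_poly_reflect: "bernoulli_poly r 1 = (- 1) ^ r * bernoulli_poly r 0"
proof -
  let ?c = "\<lambda>f :: real fps. fps_compose f (- fps_X)"
  have "?c (bernoulli_egf 0) * ?c (fps_exp 1 - 1) = ?c (fps_X * fps_exp 0)"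
    unfolding bernoulli_egf_mult [symmetric] by (rule fps_compose_mult_distrib [symmetric]) simp
  also have "?c (fps_exp 1 - 1) = fps_exp (-1) - 1"
    by (simp add: fps_compose_sub_distrib)
  finally have "?c (bernoulli_egf 0) * (fps_exp (-1) - 1) = - fps_X" by simp
  then have "?c (bernoulli_egf 0) * ((fps_exp (-1) - 1) * fps_exp 1) = - fps_X * fps_exp 1"
    by (simp only: mult.assoc [symmetric])
  moreover have "(fps_exp (-1) - 1) * fps_exp (1::real) = - (fps_exp 1 - 1)"
    using fps_exp_add_mult[of "-1" "1::real"] by (simp only: left_diff_distrib) simp
  ultimately have "?c (bernoulli_egf 0) * (fps_exp 1 - 1) = fps_X * fps_exp 1"
    by (simp only: mult_minus_right mult_minus_left neg_equal_iff_equal)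
  then have "?c (bernoulli_egf 0) * (fps_exp 1 - 1) = bernoulli_egf 1 * (fps_exp 1 - 1)"
    by (simp only: bernoulli_egf_mult of_real_1)
  then have "?c (bernoulli_egf 0) = bernoulli_egf 1"
    by (rule mult_right_cancel[OF fps_exp_minus_1_nonzero, THEN iffD1])
  moreover have "fps_nth (?c (bernoulli_egf 0)) r = (- 1) ^ r * fps_nth (bernoulli_egf 0) r"
  proof -
    have "fps_const (- 1) * fps_X = (- fps_X :: real fps)" by (simp add: fps_eq_iff)
    then have "?c (bernoulli_egf 0) = Abs_fps (\<lambda>k. (- 1) ^ k * fps_nth (bernoulli_egf 0) k)"
      using fps_compose_linear[of "bernoulli_egf 0" "-1"] by (simp only:)
    then show ?thesis by (simp only: fps_nth_Abs_fps)
  qed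
  ultimately show ?thesis by (simp add: bernoulli_poly_eq_coeff)
qed

text \<open>
  With \<open>y = w * exp (X / n)\<close> one has \<open>y^n = exp X\<close>, so the sum over \<open>k\<close> is \<open>X\<close> times a geometric sum divided by
  \<open>y^n - 1\<close>.
\<close>

lemma bernoulli_egf_dft:
  fixes w :: complex and n :: nat
  assumes n: "n > 0" and w: "w ^ n = 1" "w \<noteq> 1"
  shows "(\<Sum>k<n. fps_const (w ^ k) * bernoulli_egf_complex (real k / real n)) =
    fps_X * inverse (fps_const w * fps_exp (1 / of_nat n) - 1)"
proof -
  define y where "y = fps_const w * fps_exp (1 / of_nat n)"
  define S where "S = (\<Sum>k<n. fps_const (w ^ k) * bernoulli_egf_complex (real k / real n))"
  have ypow: "y ^ k = fps_const (w ^ k) * fps_exp (of_real (real k / real n))" for k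
    unfolding y_def power_mult_distrib by (simp add: fps_exp_power_mult fps_const_power)
  have yn: "y ^ n = fps_exp 1" using n w by (simp add: ypow)
  have y0: "fps_nth (y - 1) 0 \<noteq> 0" using w by (simp add: y_def)
  have "S * (fps_exp 1 - 1) = (\<Sum>k<n. fps_X * y ^ k)"
    unfolding S_def sum_distrib_right
    by (intro sum.cong refl) (simp add: ypow mult.assoc bernoulli_egf_complex_mult mult.left_commute)
  then have "S * (fps_exp 1 - 1) * (y - 1) = fps_X * ((\<Sum>k<n. y ^ k) * (y - 1))"
    by (simp add: sum_distrib_left [symmetric] mult.assoc)
  also have "(\<Sum>k<n. y ^ k) * (y - 1) = fps_exp 1 - 1"
    using power_diff_1_eq[of y n] yn by (simp add: mult.commute)
  finally have "(S * (y - 1)) * (fps_exp 1 - 1) = fps_X * (fps_exp 1 - 1)"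
    by (simp only: mult_ac)
  then have "S * (y - 1) = fps_X" by (rule mult_right_cancel[OF fps_exp_minus_1_nonzero, THEN iffD1])
  then have "S * ((y - 1) * inverse (y - 1)) = fps_X * inverse (y - 1)"
    by (simp only: mult.assoc [symmetric])
  moreover have "(y - 1) * inverse (y - 1) = 1"
    using inverse_mult_eq_1'[OF y0] by simp
  ultimately have "S = fps_X * inverse (y - 1)" by (simp only: mult_1_right)
  then show ?thesis by (simp only: S_def y_def)
qed

section \<open>Partial fractions of the cotangent\<close>

text \<open>
  This is \<open>- \<pi> cot (\<pi> y)\<close>. The Digamma function supplies both the partial fractions and the higher
  derivatives of the cotangent.
\<close>

definition digamma_odd :: "complex \<Rightarrow> complex" where
  "digamma_odd y = Digamma y - Digamma (1 - y)"

lemma not_Ints_one_minus: "1 - y \<in> \<int> \<longleftrightarrow> (y :: complex) \<in> \<int>"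
  using Ints_diff[of 1 "1 - y"] Ints_diff[of 1 y] by auto

lemma nonpos_Ints_subset: "(y :: complex) \<notin> \<int> \<Longrightarrow> y \<notin> \<int>\<^sub>\<le>\<^sub>0"
  using nonpos_Ints_subset_Ints by blast

text \<open>
  Logarithmic derivative of the reflection formula of the Gamma function.
\<close>

lemma digamma_odd_eq_cot:
  assumes y: "y \<notin> \<int>"
  shows "digamma_odd y = - of_real pi * (cos (of_real pi * y) / sin (of_real pi * y))"
proof -
  have y1: "1 - y \<notin> \<int>" using y not_Ints_one_minus by simp
  have np: "y \<notin> \<int>\<^sub>\<le>\<^sub>0" "1 - y \<notin> \<int>\<^sub>\<le>\<^sub>0" using y y1 nonpos_Ints_subset by auto
  have sin_nz: "sin (of_real pi * y) \<noteq> 0"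
  proof
    assume "sin (of_real pi * y) = 0"
    then obtain k :: int where "of_real pi * y = of_real (of_int k * pi)" by (auto simp: Complex_Transcendental.sin_eq_0)
    then have "y = of_int k" by simp
    then show False using y by simp
  qed
  have refl: "Gamma u * Gamma (1 - u) = of_real pi / sin (of_real pi * u)" for u :: complex
    by (rule Gamma_reflection_complex)
  have "((\<lambda>u. Gamma u * Gamma (1 - u)) has_field_derivative
      (Gamma y * Digamma y * Gamma (1 - y) + Gamma y * (Gamma (1 - y) * Digamma (1 - y) * (- 1)))) (at y)"
    using np by (auto intro!: derivative_eq_intros simp: algebra_simps)
  then have "((\<lambda>u. of_real pi / sin (of_real pi * u)) has_field_derivative
      (Gamma y * Digamma y * Gamma (1 - y) + Gamma y * (Gamma (1 - y) * Digamma (1 - y) * (- 1)))) (at y)"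
    by (simp only: refl)
  moreover have "((\<lambda>u. of_real pi / sin (of_real pi * u)) has_field_derivative
      (- (of_real pi * (cos (of_real pi * y) * of_real pi)) / (sin (of_real pi * y) * sin (of_real pi * y)))) (at y)"
    using sin_nz by (auto intro!: derivative_eq_intros)
  ultimately have "Gamma y * Digamma y * Gamma (1 - y) + Gamma y * (Gamma (1 - y) * Digamma (1 - y) * (- 1)) =
     - (of_real pi * (cos (of_real pi * y) * of_real pi)) / (sin (of_real pi * y) * sin (of_real pi * y))"
    by (rule DERIV_unique)
  then have "(Gamma y * Gamma (1 - y)) * digamma_odd y = (of_real pi / sin (of_real pi * y)) * (- of_real pi * (cos (of_real pi * y) / sin (of_real pi * y)))"
    by (simp add: digamma_odd_def algebra_simps)
  moreover have "Gamma y * Gamma (1 - y) \<noteq> 0" unfolding refl using sin_nz by simp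
  ultimately show ?thesis unfolding refl by (metis mult_left_cancel)
qed

lemma open_not_Ints: "open {y :: complex. y \<notin> \<int>}"
  using closed_Ints[where 'a = complex] by (simp add: open_closed Compl_eq)

lemma digamma_odd_holomorphic: "digamma_odd holomorphic_on {y. y \<notin> \<int>}"
proof -
  have "(\<lambda>y. Digamma y - (Digamma \<circ> (\<lambda>y. 1 - y)) y) holomorphic_on {y. y \<notin> \<int>}"
    by (intro holomorphic_on_diff holomorphic_on_compose_gen[where t = "{y. y \<notin> \<int>}"] holomorphic_on_Polygamma holomorphic_intros)
       (auto simp: not_Ints_one_minus dest: nonpos_Ints_subset)
  then show ?thesis by (simp add: digamma_odd_def [abs_def] o_def)
qed

lemma higher_deriv_digamma_odd:
  assumes y: "y \<notin> \<int>"
  shows "(deriv ^^ k) digamma_odd y = Polygamma k y - (- 1) ^ k * Polygamma k (1 - y)"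
proof -
  let ?U = "{y :: complex. y \<notin> \<int>}"
  have hol: "Digamma holomorphic_on ?U"
    by (rule holomorphic_on_Polygamma) (auto dest: nonpos_Ints_subset)
  have hol': "(\<lambda>y. Digamma (-1 * y + 1)) holomorphic_on ?U"
  proof -
    have "(Digamma \<circ> (\<lambda>y. -1 * y + 1)) holomorphic_on ?U"
      by (rule holomorphic_on_compose_gen[OF _ hol]) (auto intro!: holomorphic_intros simp: not_Ints_one_minus)
    then show ?thesis by (simp add: o_def)
  qed
  have "(deriv ^^ k) (\<lambda>y. Digamma y - Digamma (-1 * y + 1)) y = (deriv ^^ k) Digamma y - (deriv ^^ k) (\<lambda>y. Digamma (-1 * y + 1)) y"
    by (rule higher_deriv_diff[OF hol hol' open_not_Ints]) (use y in simp)
  also have "(deriv ^^ k) (\<lambda>y. Digamma (-1 * y + 1)) y = (-1) ^ k * (deriv ^^ k) Digamma (-1 * y + 1)"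
    by (rule higher_deriv_compose_linear'[OF hol open_not_Ints open_not_Ints]) (use y not_Ints_one_minus in auto)
  also have "(deriv ^^ k) Digamma y = Polygamma k y"
    using higher_deriv_Polygamma[of y k 0] y nonpos_Ints_subset by simp
  also have "(deriv ^^ k) Digamma (-1 * y + 1) = Polygamma k (1 - y)"
    using higher_deriv_Polygamma[of "1 - y" k 0] y nonpos_Ints_subset not_Ints_one_minus[of y] by simp
  finally show ?thesis by (simp add: digamma_odd_def [abs_def])
qed

text \<open>
  The \<open>(r - 1)\<close>-st derivative of the partial fraction expansion of the cotangent, read off from the series
  of the Polygamma functions.
\<close>

lemma cot_partial_fractions:
  assumes y: "y \<notin> \<int>" and r: "r \<ge> 1"
  shows "(\<lambda>k. inverse ((y + of_nat k) ^ r) + (- 1) ^ r * inverse ((1 - y + of_nat k) ^ r)) sums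
    ((- 1) ^ r / fact (r - 1) * (deriv ^^ (r - 1)) digamma_odd y)"
proof (cases "r = 1")
  case True
  have nz: "y \<noteq> 0" "1 - y \<noteq> 0" using y by auto
  have "(\<lambda>k. inverse (of_nat (Suc k)) - inverse (u + of_nat k)) sums (Digamma u + euler_mascheroni)" if "u \<noteq> 0" for u :: complex
    using summable_sums[OF summable_Digamma[OF that]] by (simp add: Digamma_def)
  from sums_diff[OF this[OF nz(2)] this[OF nz(1)]] show ?thesis
    by (simp add: True digamma_odd_def)
next
  case False
  then have r2: "r \<ge> 2" using r by simp
  have nz: "y \<noteq> 0" "1 - y \<noteq> 0" using y by auto
  have P: "(\<lambda>k. inverse ((u + of_nat k) ^ r)) sums ((- 1) ^ r / fact (r - 1) * Polygamma (r - 1) u)" if "u \<noteq> 0" for u :: complex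
  proof -
    have "((- 1) ^ r / fact (r - 1) * Polygamma (r - 1) u) = (\<Sum>k. inverse ((u + of_nat k) ^ r))"
      using r2 by (simp add: Polygamma_def Suc_diff_Suc numeral_2_eq_2 flip: power_add)
    then show ?thesis using summable_sums[OF Polygamma_converges'[OF that r2]] by simp
  qed
  have "(- 1) ^ (r - 1) = (- ((- 1) ^ r) :: complex)" using r by (cases r) auto
  then show ?thesis
    using sums_add[OF P[OF nz(1)] sums_mult[OF P[OF nz(2)], of "(-1)^r"]]
    by (simp add: higher_deriv_digamma_odd[OF y] algebra_simps)
qed

text \<open>
  In each block of \<open>n\<close> consecutive integers only the two congruent to \<open>a\<close> and \<open>-a\<close> contribute; after division by
  \<open>n\<close> they are the terms of the partial fractions at \<open>a / n\<close>.
\<close>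

lemma Lsum_eq_digamma_odd:
  assumes a: "0 < a" "a < n" "coprime a n" and r: "r \<ge> 1"
  shows "Lsum r (residue_indicator n (int a)) =
    (- 1) ^ r / (fact (r - 1) * of_nat n ^ r) * (deriv ^^ (r - 1)) digamma_odd (of_nat a / of_nat n)"
proof -
  let ?f = "residue_indicator n (int a)"
  have n: "n > 0" using a by simp
  have cop: "coprime (int a) (int n)" using a by simp
  have "Lterm r ?f sums Lsum r ?f"
    unfolding Lsum_def by (rule summable_sums[OF Lterm_summable[OF n residue_indicator_in_residue_functions[OF cop] r]])
  from sums_group[OF this n]
  have "(\<lambda>k. \<Sum>m = k * n..<k * n + n. Lterm r ?f m) sums Lsum r ?f" .
  moreover define y where "y = complex_of_nat a / of_nat n"
  have "(\<Sum>m = k * n..<k * n + n. Lterm r ?f m) =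
      (inverse ((y + of_nat k) ^ r) + (- 1) ^ r * inverse ((1 - y + of_nat k) ^ r)) / of_nat n ^ r" for k
  proof -
    have "(\<Sum>m = k * n..<k * n + n. Lterm r ?f m) = (\<Sum>i<n. Lterm r ?f (i + k * n))"
      using sum.shift_bounds_nat_ivl[of "Lterm r ?f" 0 "k * n" n] by (simp add: lessThan_atLeast0 add.commute)
    also have "\<dots> = (\<Sum>i<n. (if i = a - 1 then inverse ((y + of_nat k) ^ r) / of_nat n ^ r else 0) +
         (if i = n - a - 1 then (- 1) ^ r * inverse ((1 - y + of_nat k) ^ r) / of_nat n ^ r else 0))"
    proof (rule sum.cong[OF refl])
      fix i assume "i \<in> {..<n}"
      then have i: "i < n" by simp
      let ?m = "i + k * n"
      have m1: "[int (Suc ?m) = int a] (mod int n) \<longleftrightarrow> i = a - 1"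
      proof -
        have "[int (Suc ?m) = int a] (mod int n) \<longleftrightarrow> [int (Suc i) = int a] (mod int n)"
          by (simp add: cong_def flip: add.assoc)
        also have "\<dots> \<longleftrightarrow> [Suc i = a] (mod n)" by (simp only: cong_int_iff)
        also have "\<dots> \<longleftrightarrow> i = a - 1"
          using i a by (cases "Suc i = n") (auto simp: cong_def)
        finally show ?thesis .
      qed
      have m2: "[- int (Suc ?m) = int a] (mod int n) \<longleftrightarrow> i = n - a - 1"
      proof -
        have "[- int (Suc ?m) = int a] (mod int n) \<longleftrightarrow> int n dvd int (Suc i + a) + int k * int n"
          unfolding cong_iff_dvd_diff by (subst dvd_minus_iff[symmetric]) (simp add: algebra_simps)
        also have "\<dots> \<longleftrightarrow> int n dvd int (Suc i + a)" by (simp only: dvd_add_times_triv_right_iff)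
        also have "\<dots> \<longleftrightarrow> n dvd Suc i + a" by (simp only: int_dvd_int_iff)
        also have "\<dots> \<longleftrightarrow> Suc i + a = n"
        proof
          assume "n dvd Suc i + a"
          then obtain q where q: "Suc i + a = n * q" by (auto elim: dvdE)
          then have "n * q < n * 2" "0 < n * q" using i a by linarith+
          then have "q < 2" "0 < q" by simp_all
          then have "q = 1" by simp
          with q show "Suc i + a = n" by simp
        qed simp
        also have "\<dots> \<longleftrightarrow> i = n - a - 1" using a i by auto
        finally show ?thesis .
      qed
      have Suc_m: "npow (Suc ?m) (of_nat r) = 1 / of_nat (Suc ?m) ^ r" by (rule npow_of_nat) simp
      have v1: "1 / of_nat (Suc ?m) ^ r = inverse ((y + of_nat k) ^ r) / of_nat n ^ r" if "i = a - 1"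
      proof -
        have e: "complex_of_nat (Suc ?m) = (y + of_nat k) * of_nat n"
          using that a by (simp add: y_def field_simps of_nat_diff)
        show ?thesis unfolding e power_mult_distrib by (simp add: divide_inverse)
      qed
      have v2: "1 / of_nat (Suc ?m) ^ r = inverse ((1 - y + of_nat k) ^ r) / of_nat n ^ r" if "i = n - a - 1"
      proof -
        have e: "complex_of_nat (Suc ?m) = (1 - y + of_nat k) * of_nat n"
          using that a by (simp add: y_def field_simps of_nat_diff)
        show ?thesis unfolding e power_mult_distrib by (simp add: divide_inverse)
      qed
      show "Lterm r ?f ?m = (if i = a - 1 then inverse ((y + of_nat k) ^ r) / of_nat n ^ r else 0) +
         (if i = n - a - 1 then (- 1) ^ r * inverse ((1 - y + of_nat k) ^ r) / of_nat n ^ r else 0)"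
      proof -
        have "(if i = a - 1 then 1 else 0) * (1 / of_nat (Suc ?m) ^ r) = (if i = a - 1 then inverse ((y + of_nat k) ^ r) / of_nat n ^ r else 0)"
          using v1 by (cases "i = a - 1") (simp_all only: simp_thms if_True if_False mult_1_left mult_zero_left)
        moreover have "(if i = n - a - 1 then 1 else 0) * (1 / of_nat (Suc ?m) ^ r) = (if i = n - a - 1 then inverse ((1 - y + of_nat k) ^ r) / of_nat n ^ r else 0)"
          using v2 by (cases "i = n - a - 1") (simp_all only: simp_thms if_True if_False mult_1_left mult_zero_left)
        moreover have "Lterm r ?f ?m = (if i = a - 1 then 1 else 0) * (1 / of_nat (Suc ?m) ^ r) +
           (- 1) ^ r * ((if i = n - a - 1 then 1 else 0) * (1 / of_nat (Suc ?m) ^ r))"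
          unfolding Lterm_def parity_part_def residue_indicator_def m1 m2 Suc_m
          by (simp only: distrib_right mult.assoc)
        ultimately have "Lterm r ?f ?m = (if i = a - 1 then inverse ((y + of_nat k) ^ r) / of_nat n ^ r else 0) +
           (- 1) ^ r * (if i = n - a - 1 then inverse ((1 - y + of_nat k) ^ r) / of_nat n ^ r else 0)"
          by (simp only:)
        also have "(- 1) ^ r * (if i = n - a - 1 then inverse ((1 - y + of_nat k) ^ r) / of_nat n ^ r else 0) =
           (if i = n - a - 1 then (- 1) ^ r * inverse ((1 - y + of_nat k) ^ r) / of_nat n ^ r else 0)"
          by simp
        finally show ?thesis .
      qed
    qed
    also have "\<dots> = (inverse ((y + of_nat k) ^ r) + (- 1) ^ r * inverse ((1 - y + of_nat k) ^ r)) / of_nat n ^ r"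
      unfolding sum.distrib using a by (simp add: add_divide_distrib)
    finally show ?thesis .
  qed
  ultimately have 1: "(\<lambda>k. (inverse ((y + of_nat k) ^ r) + (- 1) ^ r * inverse ((1 - y + of_nat k) ^ r)) / of_nat n ^ r) sums Lsum r ?f"
    by simp
  have "y \<notin> \<int>"
  proof
    assume "y \<in> \<int>"
    then obtain q where "y = of_int q" by (auto elim: Ints_cases)
    then have "complex_of_int (int a) = of_int (q * int n)" using n by (simp add: y_def field_simps)
    then have "int a = q * int n" by (simp only: of_int_eq_iff)
    then have "int n dvd int a" by simp
    then have "n dvd a" by simp
    then show False using a by (auto dest: dvd_imp_le)
  qed
  from sums_unique2[OF 1 sums_divide[OF cot_partial_fractions[OF this r]]]
  show ?thesis by (simp add: y_def)
qed

text \<open>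
  The generating function of the left-hand side is \<open>t / (w exp (t/n) - 1)\<close> with \<open>w = exp (-2 \<pi> i a / n)\<close>, and
  \<open>1 / (w exp (t/n) - 1)\<close> is \<open>-1/2\<close> plus a multiple of the cotangent at \<open>a/n - t / (2 \<pi> i n)\<close>. Comparing Taylor
  coefficients at \<open>t = 0\<close> gives the sums \<open>Lsum\<close>; the constant \<open>-1/2\<close> shows for \<open>r = 1\<close> only.
\<close>

theorem bernoulli_dft:
  fixes a n r :: nat
  assumes a: "0 < a" "a < n" "coprime a n" and r: "r \<ge> 1"
  shows "(\<Sum>k<n. cis (- (2 * pi * real a * real k / real n)) * of_real (bernoulli_poly r (real k / real n))) =
    fact r * (- (if r = 1 then 1 / 2 else 0) - of_nat n / (2 * of_real pi * \<i>) ^ r * Lsum r (residue_indicator n (int a)))"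
proof -
  define w where "w = cis (- (2 * pi * real a / real n))"
  define y where "y = complex_of_nat a / of_nat n"
  have n: "n > 0" using a by simp
  have wpow: "w ^ k = cis (- (2 * pi * real a * real k / real n))" for k
    unfolding w_def Complex.DeMoivre by (rule arg_cong[of _ _ cis]) simp
  have yI: "y + of_nat 0 \<notin> \<int>"
  proof
    assume "y + of_nat 0 \<in> \<int>"
    then obtain q where "y = of_int q" by (auto elim: Ints_cases)
    then have "complex_of_int (int a) = of_int (q * int n)" using n by (simp add: y_def field_simps)
    then have "int a = q * int n" by (simp only: of_int_eq_iff)
    then have "int n dvd int a" by simp
    then have "n dvd a" by simp
    then show False using a by (auto dest: dvd_imp_le)
  qed
  have wexp: "w = exp (- (2 * of_real pi * \<i> * y))"
    by (simp add: w_def cis_conv_exp y_def mult_ac)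
  have exp_1: "u \<in> \<int>" if e1: "exp (2 * of_real pi * \<i> * u) = 1" for u
  proof -
    obtain k :: int where "Re (2 * of_real pi * \<i> * u) = 0" "Im (2 * of_real pi * \<i> * u) = of_int (2 * k) * pi"
      using e1 unfolding exp_eq_1 by blast
    then have "u = of_int k" by (simp add: complex_eq_iff)
    then show ?thesis by simp
  qed
  have w1: "w \<noteq> 1"
  proof
    assume "w = 1"
    then have "exp (2 * of_real pi * \<i> * y) = 1" unfolding wexp exp_minus by (metis inverse_1 inverse_inverse_eq)
    then show False using exp_1 yI by simp
  qed
  have wn: "w ^ n = 1"
    unfolding wpow using n cis_multiple_2pi[of "- real a"] by simp
  define f where "f = (\<lambda>t. inverse (w * exp (1 / of_nat n * t) - 1))"
  have fexp: "f has_fps_expansion inverse (fps_const w * fps_exp (1 / of_nat n) - 1)"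
    unfolding f_def using w1
    by (intro has_fps_expansion_inverse has_fps_expansion_diff has_fps_expansion_mult has_fps_expansion_const
         has_fps_expansion_exp has_fps_expansion_1) auto
  \<comment> \<open>Chosen such that \<open>exp (- 2 \<pi> i (u t + y)) = w exp (t / n)\<close>.\<close>
  define u where "u = - 1 / (2 * of_real pi * \<i> * of_nat n)"
  define S where "S = {t. u * t + y \<notin> \<int>}"
  have openS: "open S"
  proof -
    have "open ((\<lambda>t. u * t + y) -` {y. y \<notin> \<int>})"
      by (intro open_vimage open_not_Ints continuous_intros)
    then show ?thesis by (simp add: S_def vimage_def)
  qed
  have S0: "0 \<in> S" using yI by (simp add: S_def)
  have comp_hol: "(\<lambda>t. digamma_odd (u * t + y)) holomorphic_on S"
  proof -
    have "(digamma_odd \<circ> (\<lambda>t. u * t + y)) holomorphic_on S"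
      by (rule holomorphic_on_compose_gen[OF _ digamma_odd_holomorphic]) (auto intro!: holomorphic_intros simp: S_def)
    then show ?thesis by (simp add: o_def)
  qed
  have fS: "f t = - 1 / 2 + 1 / (2 * of_real pi * \<i>) * digamma_odd (u * t + y)" if t: "t \<in> S" for t
  proof -
    define v where "v = u * t + y"
    have v: "v \<notin> \<int>" using t by (simp add: S_def v_def)
    define X where "X = w * exp (1 / of_nat n * t)"
    have X: "X = exp (- (2 * of_real pi * \<i> * v))"
      unfolding X_def wexp exp_add [symmetric] v_def u_def using n
      by (intro arg_cong[of _ _ exp]) (simp add: field_simps)
    have Xinv: "inverse X = exp (2 * of_real pi * \<i> * v)" unfolding X by (simp add: exp_minus)
    have X1: "X \<noteq> 1" using exp_1[of v] v Xinv by auto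
    have X0: "X \<noteq> 0" by (simp add: X)
    \<comment> \<open>Sine and cosine of \<open>\<pi> v\<close> in terms of \<open>exp (i \<pi> v)\<close>, whose square is \<open>1 / X\<close>.\<close>
    define q where "q = exp (\<i> * (of_real pi * v))"
    have q0: "q \<noteq> 0" by (simp add: q_def)
    have qq: "q * q = inverse X" unfolding Xinv q_def exp_add [symmetric] by (simp add: mult_ac)
    have cs: "cos (of_real pi * v) = (q + inverse q) / 2" "sin (of_real pi * v) = (q - inverse q) / (2 * \<i>)"
      by (simp_all add: cos_exp_eq sin_exp_eq q_def exp_minus)
    have "cos (of_real pi * v) / sin (of_real pi * v) = \<i> * ((q * q + 1) / (q * q - 1))"
      unfolding cs using q0 by (simp add: divide_simps)
    also have "(q * q + 1) / (q * q - 1) = (1 + X) / (1 - X)"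
      unfolding qq using X0 X1 by (simp add: divide_simps)
    finally have "digamma_odd v = - of_real pi * (\<i> * ((1 + X) / (1 - X)))"
      using digamma_odd_eq_cot[OF v] by simp
    then have "1 / (2 * of_real pi * \<i>) * digamma_odd v = - ((1 + X) / (1 - X)) / 2"
      by (simp add: add.commute mult.commute)
    also have "\<dots> = inverse (X - 1) + 1 / 2" using X1 by (simp add: divide_simps) (simp add: algebra_simps)
    finally have "1 / (2 * of_real pi * \<i>) * digamma_odd v = f t + 1 / 2" by (simp add: f_def X_def)
    then show ?thesis unfolding v_def [symmetric] by simp
  qed
  have f_hol: "f holomorphic_on S"
    by (rule holomorphic_transform[OF _ fS [symmetric]]) (intro holomorphic_intros comp_hol)
  have deriv_f: "(deriv ^^ k) f 0 = (if k = 0 then - 1 / 2 else 0) + 1 / (2 * of_real pi * \<i>) * (u ^ k * (deriv ^^ k) digamma_odd y)" for k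
  proof -
    have "(deriv ^^ k) f 0 = (deriv ^^ k) (\<lambda>t. - 1 / 2 + 1 / (2 * of_real pi * \<i>) * digamma_odd (u * t + y)) 0"
      by (rule higher_deriv_transform_within_open[OF f_hol _ openS S0 fS]) (intro holomorphic_intros comp_hol)
    also have "\<dots> = (deriv ^^ k) (\<lambda>t. - 1 / 2) 0 + (deriv ^^ k) (\<lambda>t. 1 / (2 * of_real pi * \<i>) * digamma_odd (u * t + y)) 0"
      by (rule higher_deriv_add[OF _ _ openS S0]) (intro holomorphic_intros comp_hol)+
    also have "(deriv ^^ k) (\<lambda>t. 1 / (2 * of_real pi * \<i>) * digamma_odd (u * t + y)) 0 =
       1 / (2 * of_real pi * \<i>) * (deriv ^^ k) (\<lambda>t. digamma_odd (u * t + y)) 0"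
      by (rule higher_deriv_cmult[OF comp_hol S0 openS])
    also have "(deriv ^^ k) (\<lambda>t. digamma_odd (u * t + y)) 0 = u ^ k * (deriv ^^ k) digamma_odd (u * 0 + y)"
      by (rule higher_deriv_compose_linear'[OF digamma_odd_holomorphic openS open_not_Ints S0]) (simp add: S_def)
    finally show ?thesis by simp
  qed
  have "(\<Sum>k<n. w ^ k * fps_nth (bernoulli_egf_complex (real k / real n)) r) =
     fps_nth (\<Sum>k<n. fps_const (w ^ k) * bernoulli_egf_complex (real k / real n)) r"
    by (simp add: fps_sum_nth)
  also have "\<dots> = fps_nth (fps_X * inverse (fps_const w * fps_exp (1 / of_nat n) - 1)) r"
    by (simp only: bernoulli_egf_dft[OF n wn w1])
  also have "\<dots> = fps_nth (inverse (fps_const w * fps_exp (1 / of_nat n) - 1)) (r - 1)"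
    using r by (cases r) simp_all
  also have "\<dots> = (deriv ^^ (r - 1)) f 0 / fact (r - 1)"
    by (rule fps_nth_fps_expansion[OF fexp])
  finally have coeff: "(\<Sum>k<n. w ^ k * fps_nth (bernoulli_egf_complex (real k / real n)) r) = (deriv ^^ (r - 1)) f 0 / fact (r - 1)" .
  have "(deriv ^^ (r - 1)) f 0 / fact (r - 1) = - (if r = 1 then 1 / 2 else 0) - of_nat n / (2 * of_real pi * \<i>) ^ r * Lsum r (residue_indicator n (int a))"
  proof -
    obtain k where k: "r = Suc k" using r by (cases r) auto
    have "u ^ k * (2 * of_real pi * \<i>) ^ k * of_nat n ^ k = (-1) ^ k"
      unfolding power_mult_distrib [symmetric] using n by (simp add: u_def)
    then have uk: "u ^ k = (-1) ^ k / ((2 * of_real pi * \<i>) ^ k * of_nat n ^ k)"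
      using n by (simp add: field_simps)
    have cancel: "1 / P * ((-1) ^ k / (P ^ k * N ^ k) * D) / F = - (N / P ^ Suc k * ((-1) ^ Suc k / (F * N ^ Suc k) * D))"
      if "P \<noteq> 0" "N \<noteq> 0" "F \<noteq> 0" for P N D F :: complex
      using that by (simp add: field_simps)
    have half: "(if k = 0 then - 1 / 2 else 0) / fact k = (- (if r = 1 then 1 / 2 else 0) :: complex)"
      by (cases "k = 0") (simp_all add: k)
    have "(deriv ^^ (r - 1)) f 0 / fact (r - 1) = (if k = 0 then - 1 / 2 else 0) / fact k +
        1 / (2 * of_real pi * \<i>) * ((-1) ^ k / ((2 * of_real pi * \<i>) ^ k * of_nat n ^ k) * (deriv ^^ k) digamma_odd y) / fact k"
      unfolding deriv_f k diff_Suc_1 uk add_divide_distrib ..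
    also have "\<dots> = - (if r = 1 then 1 / 2 else 0) - of_nat n / (2 * of_real pi * \<i>) ^ Suc k *
        ((-1) ^ Suc k / (fact k * of_nat n ^ Suc k) * (deriv ^^ k) digamma_odd y)"
      unfolding half by (subst cancel) (use n in simp_all)
    finally show ?thesis
      using Lsum_eq_digamma_odd[OF a r] by (simp only: y_def k diff_Suc_1)
  qed
  moreover have "(\<Sum>k<n. cis (- (2 * pi * real a * real k / real n)) * of_real (bernoulli_poly r (real k / real n))) =
     fact r * (\<Sum>k<n. w ^ k * fps_nth (bernoulli_egf_complex (real k / real n)) r)"
    by (simp add: wpow bernoulli_poly_eq_complex_coeff sum_distrib_left mult_ac)
  ultimately show ?thesis using coeff by simp
qed

section \<open>Exponential sums over divisors\<close>

definition unit_exp :: "nat \<Rightarrow> int \<Rightarrow> complex" where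
  "unit_exp n x = cis (2 * pi * real_of_int x / real n)"

lemma unit_exp_0 [simp]: "unit_exp n 0 = 1"
  by (simp add: unit_exp_def)

lemma unit_exp_add: "unit_exp n (x + y) = unit_exp n x * unit_exp n y"
  unfolding unit_exp_def cis_mult by (rule arg_cong[of _ _ cis]) (simp add: add_divide_distrib distrib_left)

lemma unit_exp_eq_1_iff:
  assumes n: "n > 0"
  shows "unit_exp n x = 1 \<longleftrightarrow> int n dvd x"
proof
  assume "int n dvd x"
  then obtain q where x: "x = int n * q" by (auto elim: dvdE)
  have "2 * pi * real_of_int x / real n = 2 * pi * real_of_int q" using n by (simp add: x)
  then show "unit_exp n x = 1" unfolding unit_exp_def by (simp add: cis_multiple_2pi)
next
  assume "unit_exp n x = 1"
  then have "cos (2 * pi * real_of_int x / real n) = 1" by (simp add: unit_exp_def complex_eq_iff)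
  then obtain k :: int where "2 * pi * real_of_int x / real n = of_int k * 2 * pi" by (auto simp: cos_one_2pi_int)
  then have "real_of_int x = of_int k * real n" using n by (simp add: field_simps)
  then have "real_of_int x = real_of_int (k * int n)" by simp
  then have "x = k * int n" by (simp only: of_int_eq_iff)
  then show "int n dvd x" by simp
qed

lemma unit_exp_cong:
  assumes n: "n > 0" and xy: "[x = y] (mod int n)"
  shows "unit_exp n x = unit_exp n y"
proof -
  have "unit_exp n (x - y) = 1" using xy unit_exp_eq_1_iff[OF n] by (simp add: cong_iff_dvd_diff)
  then show ?thesis using unit_exp_add[of n "x - y" y] by simp
qed

lemma sum_residues_shift:
  fixes f :: "int \<Rightarrow> 'a :: comm_monoid_add"
  assumes n: "n > 0" and f: "\<And>x y. [x = y] (mod int n) \<Longrightarrow> f x = f y"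
  shows "(\<Sum>x\<in>{0..<int n}. f (x + c)) = (\<Sum>x\<in>{0..<int n}. f x)"
proof (rule sum.reindex_bij_witness[where i = "\<lambda>x. (x - c) mod int n" and j = "\<lambda>x. (x + c) mod int n"])
  fix x assume "x \<in> {0..<int n}"
  then have x: "0 \<le> x" "x < int n" by auto
  show "((x + c) mod int n - c) mod int n = x" using x by (simp add: mod_diff_left_eq)
  show "((x - c) mod int n + c) mod int n = x" using x by (simp add: mod_add_left_eq)
  show "(x + c) mod int n \<in> {0..<int n}" "(x - c) mod int n \<in> {0..<int n}" using n by simp_all
  show "f ((x + c) mod int n) = f (x + c)" by (rule f) (simp add: cong_def)
qed

lemma sum_unit_exp:
  assumes n: "n > 0"
  shows "(\<Sum>x\<in>{0..<int n}. unit_exp n (x * c)) = (if int n dvd c then of_nat n else 0)"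
proof (cases "int n dvd c")
  case True
  then have "unit_exp n (x * c) = 1" for x using unit_exp_eq_1_iff[OF n] by simp
  then show ?thesis using True by simp
next
  case False
  let ?S = "\<Sum>x\<in>{0..<int n}. unit_exp n (x * c)"
  have "(\<Sum>x\<in>{0..<int n}. unit_exp n ((x + 1) * c)) = ?S"
    by (rule sum_residues_shift[where f = "\<lambda>x. unit_exp n (x * c)", OF n])
       (rule unit_exp_cong[OF n], rule cong_mult, assumption, rule cong_refl)
  moreover have "unit_exp n ((x + 1) * c) = unit_exp n c * unit_exp n (x * c)" for x
    by (simp add: distrib_right unit_exp_add)
  ultimately have "unit_exp n c * ?S = ?S"
    by (simp only: sum_distrib_left)
  moreover have "unit_exp n c \<noteq> 1" using False unit_exp_eq_1_iff[OF n] by simp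
  ultimately show ?thesis using False by simp
qed

text \<open>
  The idempotent modulo \<open>n\<close> that belongs to the factorisation \<open>n = d * (n / d)\<close>, for squarefree \<open>n\<close>.
\<close>

definition crt_unit :: "nat \<Rightarrow> nat \<Rightarrow> int" where
  "crt_unit n d = (SOME k. [k = 0] (mod int d) \<and> [k = 1] (mod int (n div d)))"

text \<open>
  For squarefree \<open>n\<close> this is a product over the primes \<open>p\<close> dividing \<open>n\<close> of factors \<open>\<zeta>_p^x - 1\<close>, with \<open>\<zeta>_p\<close>
  a primitive \<open>p\<close>-th root of unity; the sum is that product expanded.
\<close>

definition moebius_exp :: "nat \<Rightarrow> int \<Rightarrow> complex" where
  "moebius_exp n x = (\<Sum>d | d dvd n. of_int (moebius d) * unit_exp n (x * crt_unit n d))"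

lemma coprime_iff_gcd_nat: "coprime x (int n) \<longleftrightarrow> gcd (nat \<bar>x\<bar>) n = 1"
  by (simp only: coprime_iff_gcd_eq_1 gcd_int_def abs_of_nat nat_int of_nat_eq_1_iff)

context
  fixes n :: nat
  assumes sf: "squarefree n"
begin

lemma squarefree_pos: "n > 0"
  using sf by (cases n) auto

lemma coprime_cofactor:
  assumes "d dvd n"
  shows "coprime d (n div d)"
proof (rule coprimeI)
  fix c assume "c dvd d" "c dvd n div d"
  then have "c * c dvd d * (n div d)" by (rule mult_dvd_mono)
  then have "c\<^sup>2 dvd n" using assms by (simp add: power2_eq_square)
  then show "is_unit c" using squarefreeD[OF sf] by blast
qed

lemma crt_unit:
  assumes "d dvd n"
  shows "[crt_unit n d = 0] (mod int d)" "[crt_unit n d = 1] (mod int (n div d))"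
proof -
  have "coprime (int d) (int (n div d))" using coprime_cofactor[OF assms] by simp
  from binary_chinese_remainder_int[OF this, of 0 1]
  have "\<exists>k. [k = 0] (mod int d) \<and> [k = 1] (mod int (n div d))" by blast
  from someI_ex[OF this] show "[crt_unit n d = 0] (mod int d)" "[crt_unit n d = 1] (mod int (n div d))"
    by (simp_all only: crt_unit_def)
qed

lemma crt_unit_unique:
  assumes d: "d dvd n" and k: "[k = 0] (mod int d)" "[k = y] (mod int (n div d))"
  shows "[k = y * crt_unit n d] (mod int n)"
proof -
  have c: "coprime (int d) (int (n div d))" using coprime_cofactor[OF d] by simp
  have "[y * crt_unit n d = y * 0] (mod int d)" by (intro cong_mult cong_refl crt_unit[OF d])
  then have "[k = y * crt_unit n d] (mod int d)" using k by (metis cong_sym cong_trans mult_zero_right)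
  moreover have "[y * crt_unit n d = y * 1] (mod int (n div d))" by (intro cong_mult cong_refl crt_unit[OF d])
  then have "[k = y * crt_unit n d] (mod int (n div d))" using k by (metis cong_sym cong_trans mult_1_right)
  ultimately have "[k = y * crt_unit n d] (mod (int d * int (n div d)))"
    by (rule coprime_cong_mult[OF _ _ c])
  moreover have "int d * int (n div d) = int n" using d by (metis dvd_mult_div_cancel of_nat_mult)
  ultimately show ?thesis by simp
qed

lemma moebius_exp_cong: "[x = y] (mod int n) \<Longrightarrow> moebius_exp n x = moebius_exp n y"
  unfolding moebius_exp_def
  by (intro sum.cong refl arg_cong2[where f = "(*)"] unit_exp_cong[OF squarefree_pos] cong_mult) auto

text \<open>
  If a prime \<open>p\<close> divides \<open>x\<close> and \<open>n\<close>, the exponents for \<open>d\<close> and \<open>p * d\<close> agree modulo \<open>n\<close>, and their terms have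
  opposite signs.
\<close>

lemma moebius_exp_eq_0:
  assumes x: "\<not> coprime x (int n)"
  shows "moebius_exp n x = 0"
proof -
  have "gcd (nat \<bar>x\<bar>) n \<noteq> 1"
    using x by (simp only: coprime_iff_gcd_nat not_False_eq_True)
  then obtain p where p: "prime p" "p dvd gcd (nat \<bar>x\<bar>) n" using prime_factor_nat by blast
  have pn: "p dvd n" by (rule dvd_trans[OF p(2) gcd_dvd2])
  have "p dvd nat \<bar>x\<bar>" by (rule dvd_trans[OF p(2) gcd_dvd1])
  then have "int p dvd int (nat \<bar>x\<bar>)" by (simp only: int_dvd_int_iff)
  then have px: "int p dvd x" by simp
  show ?thesis
    unfolding moebius_exp_def
  proof (rule sum_moebius_mult_eq_0[OF squarefree_pos p(1) pn])
    fix d assume pd: "p * d dvd n" "\<not> p dvd d"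
    then obtain m where m: "n = p * d * m" by (auto elim: dvdE)
    have nz: "p > 0" "d > 0" "m > 0" using squarefree_pos m by auto
    have dn: "d dvd n" using m by simp
    have "n div d = p * m" using nz by (simp add: m)
    moreover have "n div (p * d) = m" using nz by (simp add: m)
    ultimately have "[crt_unit n d = 1] (mod (int p * int m))" "[crt_unit n (p * d) = 1] (mod int m)"
      "[crt_unit n d = 0] (mod int d)" "[crt_unit n (p * d) = 0] (mod (int p * int d))"
      using crt_unit[OF dn] crt_unit[OF pd(1)] by simp_all
    then have "int m dvd crt_unit n d - 1" "int m dvd crt_unit n (p * d) - 1" "int d dvd crt_unit n d" "int d dvd crt_unit n (p * d)"
      by (auto simp: cong_iff_dvd_diff intro: dvd_mult_right)
    then have "int m dvd (crt_unit n (p * d) - 1) - (crt_unit n d - 1)" "int d dvd crt_unit n (p * d) - crt_unit n d"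
      by (blast intro: dvd_diff)+
    moreover have "coprime (int d) (int m)"
    proof -
      have "coprime d (p * m)" using coprime_cofactor[OF dn] \<open>n div d = p * m\<close> by simp
      then show ?thesis by simp
    qed
    ultimately have "int d * int m dvd crt_unit n (p * d) - crt_unit n d"
      by (intro divides_mult) simp_all
    then have "int p * (int d * int m) dvd x * (crt_unit n (p * d) - crt_unit n d)"
      using px by (rule mult_dvd_mono[rotated])
    then have "int n dvd x * crt_unit n (p * d) - x * crt_unit n d"
      by (simp add: m mult.assoc right_diff_distrib)
    then show "unit_exp n (x * crt_unit n (p * d)) = unit_exp n (x * crt_unit n d)"
      by (intro unit_exp_cong[OF squarefree_pos]) (simp add: cong_iff_dvd_diff)
  qed
qed

lemma sum_unit_residues:
  assumes "\<And>x. \<not> coprime x (int n) \<Longrightarrow> f x = 0"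
  shows "(\<Sum>x\<in>{0..<int n}. f x) = (\<Sum>x\<in>unit_residues n. f x)"
  by (rule sum.mono_neutral_right) (auto simp: unit_residues_def assms)

text \<open>
  A multiple of the idempotent for \<open>d\<close> is divisible by \<open>d\<close> modulo \<open>n\<close>, hence a unit only for \<open>d = 1\<close>.
\<close>

lemma not_dvd_crt_unit:
  assumes "d dvd n" and z: "coprime z (int n)" and k: "[y * crt_unit n d = z] (mod int n)"
  shows "d = 1"
proof (rule ccontr)
  assume "d \<noteq> 1"
  have dn: "int d dvd int n" using assms(1) by simp
  have "int d dvd crt_unit n d" using crt_unit(1)[OF assms(1)] by (simp add: cong_0_iff)
  then have "int d dvd y * crt_unit n d" by simp
  moreover have "int d dvd y * crt_unit n d - z" using k dn by (meson cong_iff_dvd_diff dvd_trans)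
  ultimately have "int d dvd z" by (metis dvd_diff_commute dvd_diff_right_iff)
  then have "is_unit (int d)" using z dn coprime_common_divisor by blast
  then show False using \<open>d \<noteq> 1\<close> by simp
qed

text \<open>
  As \<open>moebius_exp n (x * y)\<close> vanishes off the units, \<open>x\<close> may run over all residues. Orthogonality then leaves
  the divisors \<open>d\<close> with \<open>y * crt_unit n d \<equiv> z\<close>, and the unit \<open>z\<close> forces \<open>d = 1\<close>.
\<close>

theorem moebius_exp_inversion:
  assumes z: "coprime z (int n)"
  shows "(\<Sum>x\<in>unit_residues n. moebius_exp n (x * y) * unit_exp n (- (x * z))) = (if [y = z] (mod int n) then of_nat n else 0)"
proof -
  have n: "n > 0" by (rule squarefree_pos)
  have one: "[crt_unit n 1 = 1] (mod int n)" using crt_unit(2)[of 1] by simp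
  have "(\<Sum>x\<in>unit_residues n. moebius_exp n (x * y) * unit_exp n (- (x * z))) =
        (\<Sum>x\<in>{0..<int n}. moebius_exp n (x * y) * unit_exp n (- (x * z)))"
    by (rule sum_unit_residues[symmetric]) (simp add: moebius_exp_eq_0)
  also have "\<dots> = (\<Sum>x\<in>{0..<int n}. \<Sum>d | d dvd n. of_int (moebius d) * unit_exp n (x * (y * crt_unit n d - z)))"
    unfolding moebius_exp_def sum_distrib_right
    by (intro sum.cong refl) (simp add: mult.assoc right_diff_distrib flip: unit_exp_add)
  also have "\<dots> = (\<Sum>d | d dvd n. of_int (moebius d) * (\<Sum>x\<in>{0..<int n}. unit_exp n (x * (y * crt_unit n d - z))))"
    by (subst sum.swap) (simp add: sum_distrib_left)
  also have "\<dots> = (\<Sum>d | d dvd n. if d = 1 then (if [y = z] (mod int n) then of_nat n else 0) else 0)"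
  proof (rule sum.cong[OF refl])
    fix d assume "d \<in> {d. d dvd n}"
    then have d: "d dvd n" by simp
    show "of_int (moebius d) * (\<Sum>x\<in>{0..<int n}. unit_exp n (x * (y * crt_unit n d - z))) =
       (if d = 1 then (if [y = z] (mod int n) then of_nat n else 0) else 0)"
    proof (cases "d = 1")
      case True
      have "[y * crt_unit n 1 = y * 1] (mod int n)" by (intro cong_mult cong_refl one)
      then have "int n dvd y * crt_unit n 1 - z \<longleftrightarrow> [y = z] (mod int n)"
        unfolding cong_iff_dvd_diff[symmetric] by (metis cong_sym cong_trans mult_1_right)
      then show ?thesis by (simp add: sum_unit_exp[OF n] True moebius_def)
    next
      case False
      then have "\<not> int n dvd y * crt_unit n d - z"
        using not_dvd_crt_unit[OF d z] by (auto simp: cong_iff_dvd_diff)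
      then show ?thesis using False by (simp add: sum_unit_exp[OF n])
    qed
  qed
  also have "\<dots> = (if [y = z] (mod int n) then of_nat n else 0)"
    using n by simp
  finally show ?thesis .
qed

text \<open>
  Detect coprimality to \<open>n\<close> by a Moebius sum over \<open>e\<close>. The multiples of \<open>e\<close> in the class of \<open>y\<close> modulo \<open>q\<close> form
  the empty set if \<open>e\<close> and \<open>q\<close> have a common factor, and otherwise a class modulo \<open>q * e\<close>, over which the exponential
  sums to zero unless \<open>q * e = n\<close>.
\<close>

lemma sum_unit_exp_in_class:
  assumes y: "coprime y (int n)" and q: "q dvd n"
  shows "(\<Sum>x | x \<in> unit_residues n \<and> [x = y] (mod int q). unit_exp n x) =
    of_int (moebius (n div q)) * unit_exp n (y * crt_unit n (n div q))"
proof -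
  have n: "n > 0" by (rule squarefree_pos)
  \<comment> \<open>The multiples of \<open>e\<close> among the residues congruent to \<open>y\<close> modulo \<open>q\<close>.\<close>
  define X where "X = (\<lambda>e :: nat. {x. x \<in> {0..<int n} \<and> [x = y] (mod int q) \<and> int e dvd x})"
  have finX: "finite (X e)" for e by (rule finite_subset[of _ "{0..<int n}"]) (auto simp: X_def)
  have W: "(\<Sum>x\<in>X e. unit_exp n x) = (if e = n div q then unit_exp n (y * crt_unit n (n div q)) else 0)"
    if e: "e dvd n" for e
  proof (cases "e = n div q")
    case True
    have q': "n div e = q" using q n by (simp add: True div_div_eq_right)
    define k where "k = (y * crt_unit n e) mod int n"
    have kc: "[k = y * crt_unit n e] (mod int n)" by (simp add: k_def cong_def)
    have "X e = {k}"
    proof (intro equalityI subsetI)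
      fix x assume "x \<in> X e"
      then have x: "0 \<le> x" "x < int n" "[x = y] (mod int q)" "[x = 0] (mod int e)"
        by (auto simp: X_def cong_0_iff)
      have "[x = y * crt_unit n e] (mod int n)"
        by (rule crt_unit_unique[OF e x(4)]) (use x q' in simp)
      then have "x mod int n = k" by (simp add: k_def cong_def)
      then show "x \<in> {k}" using x by simp
    next
      fix x assume "x \<in> {k}"
      then have "x = k" by simp
      have "[k = y * crt_unit n e] (mod int q)" "[k = y * crt_unit n e] (mod int e)"
        using cong_dvd_modulus[OF kc] q e by simp_all
      moreover have "[y * crt_unit n e = y * 1] (mod int q)"
        by (rule cong_mult[OF cong_refl crt_unit(2)[OF e, unfolded q']])
      moreover have "[y * crt_unit n e = y * 0] (mod int e)"
        by (rule cong_mult[OF cong_refl crt_unit(1)[OF e]])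
      ultimately have "[k = y * 1] (mod int q)" "[k = y * 0] (mod int e)"
        by (blast intro: cong_trans)+
      then have "[k = y] (mod int q)" "[k = 0] (mod int e)" by simp_all
      then show "x \<in> X e" using n by (simp add: \<open>x = k\<close> X_def k_def cong_0_iff)
    qed
    then show ?thesis using unit_exp_cong[OF n kc] True by simp
  next
    case False
    show ?thesis
    proof (cases "coprime e q")
      case True
      have qe: "q * e dvd n" using True q e by (simp add: divides_mult coprime_commute)
      have nd: "\<not> int n dvd int (q * e)"
      proof
        assume "int n dvd int (q * e)"
        then have "n dvd q * e" by (simp only: int_dvd_int_iff)
        then have "n = q * e" using qe by (simp add: dvd_antisym)
        then show False using False n by simp
      qed
      let ?c = "int (q * e)"
      have sh: "(x + t * ?c) mod int n \<in> X e" if "x \<in> X e" for x t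
      proof -
        have "int q dvd int n" "int e dvd int n" using q e by simp_all
        have a: "[(x + t * ?c) mod int n = x + t * ?c] (mod int n)" by (simp add: cong_def)
        have "[(x + t * ?c) mod int n = x + t * ?c] (mod int q)" "[(x + t * ?c) mod int n = x + t * ?c] (mod int e)"
          using cong_dvd_modulus[OF a] q e by simp_all
        moreover have "[x + t * ?c = x] (mod int q)" "[x + t * ?c = x] (mod int e)"
          by (simp_all add: cong_iff_dvd_diff)
        ultimately have "[(x + t * ?c) mod int n = x] (mod int q)" "[(x + t * ?c) mod int n = x] (mod int e)"
          using cong_trans by blast+
        moreover have "[x = y] (mod int q)" "[x = 0] (mod int e)" using that by (auto simp: X_def cong_0_iff)
        ultimately have "[(x + t * ?c) mod int n = y] (mod int q)" "[(x + t * ?c) mod int n = 0] (mod int e)"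
          using cong_trans by blast+
        then show ?thesis using n by (simp add: X_def cong_0_iff)
      qed
      have "(\<Sum>x\<in>X e. unit_exp n (x + ?c)) = (\<Sum>x\<in>X e. unit_exp n x)"
      proof (rule sum.reindex_bij_witness[where i = "\<lambda>x. (x - ?c) mod int n" and j = "\<lambda>x. (x + ?c) mod int n"])
        fix x assume x: "x \<in> X e"
        then have x': "0 \<le> x" "x < int n" by (auto simp: X_def)
        show "((x + ?c) mod int n - ?c) mod int n = x" using x' by (simp add: mod_diff_left_eq del: of_nat_mult)
        show "((x - ?c) mod int n + ?c) mod int n = x" using x' by (simp add: mod_add_left_eq del: of_nat_mult)
        show "(x + ?c) mod int n \<in> X e" using sh[OF x, of 1] by simp
        show "(x - ?c) mod int n \<in> X e" using sh[OF x, of "-1"] by simp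
        show "unit_exp n ((x + ?c) mod int n) = unit_exp n (x + ?c)"
          by (rule unit_exp_cong[OF n]) (simp add: cong_def)
      qed
      then have "(\<Sum>x\<in>X e. unit_exp n x) * unit_exp n ?c = (\<Sum>x\<in>X e. unit_exp n x)"
        by (simp only: unit_exp_add sum_distrib_right)
      moreover have "unit_exp n ?c \<noteq> 1" using nd unit_exp_eq_1_iff[OF n] by simp
      ultimately show ?thesis using False by simp
    next
      case nc: False
      have "X e = {}"
      proof (rule ccontr)
        assume "X e \<noteq> {}"
        then obtain x where x: "[x = y] (mod int q)" "int e dvd x" by (auto simp: X_def)
        let ?g = "int (gcd e q)"
        have g: "?g dvd int e" "?g dvd int q" by simp_all
        have "?g dvd x" using g x by (meson dvd_trans)
        moreover have "?g dvd x - y" using g x by (meson cong_iff_dvd_diff dvd_trans)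
        ultimately have "?g dvd y" by (metis dvd_diff_commute dvd_diff_right_iff)
        moreover have "?g dvd int n" using g q by (meson dvd_trans int_dvd_int_iff)
        ultimately have "is_unit ?g" using y coprime_common_divisor by blast
        then have "int (gcd e q) dvd int 1" by (simp only: of_nat_1)
        then have "gcd e q = 1" by (simp only: int_dvd_int_iff nat_dvd_1_iff_1)
        then show False using nc by (simp only: coprime_iff_gcd_eq_1 not_True_eq_False)
      qed
      then show ?thesis using False by simp
    qed
  qed
  have "(\<Sum>x | x \<in> unit_residues n \<and> [x = y] (mod int q). unit_exp n x) =
     (\<Sum>x\<in>X 1. (if coprime x (int n) then 1 else 0) * unit_exp n x)"
    by (rule sum.mono_neutral_cong_left[OF finX]) (auto simp: X_def unit_residues_def)
  also have "\<dots> = (\<Sum>x\<in>X 1. \<Sum>e | e dvd n. (if int e dvd x then of_int (moebius e) * unit_exp n x else 0))"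
  proof (rule sum.cong[OF refl])
    fix x assume "x \<in> X 1"
    let ?g = "gcd (nat \<bar>x\<bar>) n"
    have iff: "int e dvd x \<longleftrightarrow> e dvd nat \<bar>x\<bar>" for e
    proof -
      have "int e dvd x \<longleftrightarrow> int e dvd int (nat \<bar>x\<bar>)" by simp
      then show ?thesis by (simp only: int_dvd_int_iff)
    qed
    have "(\<Sum>e | e dvd n. (if int e dvd x then of_int (moebius e) * unit_exp n x else 0)) =
      (\<Sum>e | e dvd ?g. of_int (moebius e) * unit_exp n x)"
    proof -
      have "e dvd ?g \<longleftrightarrow> e dvd n \<and> int e dvd x" for e
        unfolding iff by (meson dvd_trans gcd_dvd1 gcd_dvd2 gcd_greatest)
      then have "{e. e dvd ?g} = {e. e dvd n} \<inter> {e. int e dvd x}" by blast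
      then show ?thesis using n by (simp add: sum.inter_restrict del: gcd_greatest_iff)
    qed
    also have "\<dots> = of_int (\<Sum>e | e dvd ?g. moebius e) * unit_exp n x"
      by (simp add: sum_distrib_right)
    also have "(\<Sum>e | e dvd ?g. moebius e) = (if ?g = 1 then 1 else 0)"
      by (rule sum_moebius_divisors) (use n in simp)
    also have "?g = 1 \<longleftrightarrow> coprime x (int n)"
      by (simp only: coprime_iff_gcd_nat)
    finally show "(if coprime x (int n) then 1 else 0) * unit_exp n x =
       (\<Sum>e | e dvd n. (if int e dvd x then of_int (moebius e) * unit_exp n x else 0))" by simp
  qed
  also have "\<dots> = (\<Sum>e | e dvd n. \<Sum>x\<in>X 1. (if int e dvd x then of_int (moebius e) * unit_exp n x else 0))"
    by (rule sum.swap)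
  also have "\<dots> = (\<Sum>e | e dvd n. of_int (moebius e) * (\<Sum>x\<in>X e. unit_exp n x))"
  proof (rule sum.cong[OF refl])
    fix e
    have "X e = X 1 \<inter> {x. int e dvd x}" by (auto simp: X_def)
    then have "(\<Sum>x\<in>X e. unit_exp n x) = (\<Sum>x\<in>X 1. if int e dvd x then unit_exp n x else 0)"
      by (simp only: sum.inter_restrict[OF finX] mem_Collect_eq)
    then show "(\<Sum>x\<in>X 1. (if int e dvd x then of_int (moebius e) * unit_exp n x else 0)) = of_int (moebius e) * (\<Sum>x\<in>X e. unit_exp n x)"
      by (simp only: sum_distrib_left if_distrib[of "(*) _"] mult_zero_right)
  qed
  also have "\<dots> = (\<Sum>e | e dvd n. if e = n div q then of_int (moebius (n div q)) * unit_exp n (y * crt_unit n (n div q)) else 0)"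
    by (rule sum.cong[OF refl]) (simp add: W)
  also have "\<dots> = of_int (moebius (n div q)) * unit_exp n (y * crt_unit n (n div q))"
  proof -
    have "n div q dvd n" by (rule dvdI[of _ _ q]) (use q in simp)
    then show ?thesis using n by simp
  qed
  finally show ?thesis .
qed

theorem moebius_exp_eq_divisor_count_sum:
  assumes y: "coprime y (int n)"
  shows "(\<Sum>x\<in>unit_residues n. of_nat (card {q. q dvd n \<and> [x = y] (mod int q)}) * unit_exp n x) = moebius_exp n y"
proof -
  have n: "n > 0" by (rule squarefree_pos)
  have "(\<Sum>x\<in>unit_residues n. of_nat (card {q. q dvd n \<and> [x = y] (mod int q)}) * unit_exp n x) =
    (\<Sum>x\<in>unit_residues n. \<Sum>q | q dvd n. if [x = y] (mod int q) then unit_exp n x else 0)"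
  proof (rule sum.cong[OF refl])
    fix x
    have "(\<Sum>q | q dvd n. if [x = y] (mod int q) then unit_exp n x else 0) = (\<Sum>q\<in>{q. q dvd n} \<inter> {q. [x = y] (mod int q)}. unit_exp n x)"
      using n by (subst sum.inter_restrict) simp_all
    then show "of_nat (card {q. q dvd n \<and> [x = y] (mod int q)}) * unit_exp n x = (\<Sum>q | q dvd n. if [x = y] (mod int q) then unit_exp n x else 0)"
      by (simp add: Collect_conj_eq)
  qed
  also have "\<dots> = (\<Sum>q | q dvd n. \<Sum>x\<in>unit_residues n. if [x = y] (mod int q) then unit_exp n x else 0)"
    by (rule sum.swap)
  also have "\<dots> = (\<Sum>q | q dvd n. of_int (moebius (n div q)) * unit_exp n (y * crt_unit n (n div q)))"
  proof (rule sum.cong[OF refl])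
    fix q assume "q \<in> {q. q dvd n}"
    then have q: "q dvd n" by simp
    have "(\<Sum>x\<in>unit_residues n. if [x = y] (mod int q) then unit_exp n x else 0) = (\<Sum>x\<in>unit_residues n \<inter> {x. [x = y] (mod int q)}. unit_exp n x)"
      by (subst sum.inter_restrict) simp_all
    also have "\<dots> = (\<Sum>x | x \<in> unit_residues n \<and> [x = y] (mod int q). unit_exp n x)"
      by (simp add: Collect_conj_eq)
    finally show "(\<Sum>x\<in>unit_residues n. if [x = y] (mod int q) then unit_exp n x else 0) = of_int (moebius (n div q)) * unit_exp n (y * crt_unit n (n div q))"
      using sum_unit_exp_in_class[OF y q] by simp
  qed
  also have "\<dots> = moebius_exp n y"
    unfolding moebius_exp_def
    by (rule sum.reindex_bij_witness[where i = "\<lambda>d. n div d" and j = "\<lambda>d. n div d"])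
       (use n in \<open>auto simp: div_div_eq_right div_dvd_iff_mult\<close>)
  finally show ?thesis .
qed

end

section \<open>Sums over units and over representatives up to sign\<close>

lemma sum_unit_residues_mult:
  fixes F :: "int \<Rightarrow> 'a :: comm_monoid_add"
  assumes n: "n > 0" and c: "coprime c (int n)" and F: "\<And>x y. [x = y] (mod int n) \<Longrightarrow> F x = F y"
  shows "(\<Sum>x\<in>unit_residues n. F (c * x)) = (\<Sum>x\<in>unit_residues n. F x)"
proof -
  let ?c' = "modular_inverse (int n) c"
  have cc: "[c * ?c' = 1] (mod int n)" by (rule cong_modular_inverse1[OF c])
  have c': "coprime ?c' (int n)" using c by simp
  have mod_unit: "(a * x) mod int n \<in> unit_residues n" if "coprime a (int n)" "x \<in> unit_residues n" for a x
    using that n by (simp add: unit_residues_def)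
  have cancel: "(a * ((b * x) mod int n)) mod int n = x" if "[a * b = 1] (mod int n)" "x \<in> unit_residues n" for a b x
  proof -
    have "[a * b * x = 1 * x] (mod int n)" by (rule cong_mult[OF that(1) cong_refl])
    moreover have "x mod int n = x" using that(2) by (simp add: unit_residues_def)
    ultimately show ?thesis by (simp add: cong_def mod_mult_right_eq mult.assoc)
  qed
  show ?thesis
  proof (rule sum.reindex_bij_witness[where i = "\<lambda>x. (?c' * x) mod int n" and j = "\<lambda>x. (c * x) mod int n"])
    fix x assume x: "x \<in> unit_residues n"
    show "(?c' * ((c * x) mod int n)) mod int n = x"
      by (rule cancel[OF _ x]) (use cc in \<open>simp only: mult.commute\<close>)
    show "(c * ((?c' * x) mod int n)) mod int n = x" by (rule cancel[OF cc x])
    show "(c * x) mod int n \<in> unit_residues n" "(?c' * x) mod int n \<in> unit_residues n"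
      by (rule mod_unit[OF c x], rule mod_unit[OF c' x])
    show "F ((c * x) mod int n) = F (c * x)" by (rule F) (simp add: cong_def)
  qed
qed

lemma sum_unit_residues_inverse:
  fixes F :: "int \<Rightarrow> 'a :: comm_monoid_add"
  assumes n: "n > 1"
  shows "(\<Sum>x\<in>unit_residues n. F (modular_inverse (int n) x)) = (\<Sum>x\<in>unit_residues n. F x)"
proof (rule sum.reindex_bij_witness[where i = "modular_inverse (int n)" and j = "modular_inverse (int n)"])
  fix x assume "x \<in> unit_residues n"
  then have x: "0 \<le> x" "x < int n" "coprime x (int n)" by (auto simp: unit_residues_def)
  show "modular_inverse (int n) (modular_inverse (int n) x) = x"
    "modular_inverse (int n) (modular_inverse (int n) x) = x"
    by (rule modular_inverse_int_eqI; use x cong_modular_inverse2[OF x(3)] in simp)+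
  show "modular_inverse (int n) x \<in> unit_residues n" "modular_inverse (int n) x \<in> unit_residues n"
    using x n by (simp_all add: unit_residues_def modular_inverse_int_nonneg modular_inverse_int_less)
qed (rule refl)

text \<open>
  For \<open>n \<ge> 3\<close> the bound \<open>n / 2\<close> is never attained by a unit, so no representative is its own negative.
\<close>

lemma index_setD:
  assumes "x \<in> index_set n" "n \<ge> 3"
  shows "1 \<le> x" "2 * x < int n" "coprime x (int n)"
proof -
  have x: "1 \<le> x" "real_of_int x \<le> real n / 2" "coprime x (int n)" using assms by (auto simp: index_set_def)
  have "real_of_int (2 * x) \<le> real_of_int (int n)" using x(2) by simp
  then have le: "2 * x \<le> int n" by (simp only: of_int_le_iff)
  moreover have "2 * x \<noteq> int n"
  proof
    assume "2 * x = int n"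
    then have "x dvd int n" by (metis dvd_triv_right)
    then have "is_unit x" using x(3) coprime_absorb_left by blast
    then have "x = 1" using x(1) by simp
    then show False using \<open>2 * x = int n\<close> assms(2) by simp
  qed
  ultimately show "1 \<le> x" "2 * x < int n" "coprime x (int n)" using x by auto
qed

lemma finite_index_set [simp]: "finite (index_set n)"
  by (rule finite_subset[of _ "{1..int n}"]) (auto simp: index_set_def)

lemma sum_unit_residues_pairs:
  fixes F :: "int \<Rightarrow> 'a :: comm_monoid_add"
  assumes n: "n \<ge> 3" and F: "\<And>x y. [x = y] (mod int n) \<Longrightarrow> F x = F y"
  shows "(\<Sum>x\<in>unit_residues n. F x) = (\<Sum>x\<in>index_set n. F x + F (- x))"
proof -
  have un: "unit_residues n = index_set n \<union> (\<lambda>x. int n - x) ` index_set n"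
  proof (intro equalityI subsetI)
    fix x assume "x \<in> unit_residues n"
    then have x: "0 \<le> x" "x < int n" "coprime x (int n)" by (auto simp: unit_residues_def)
    have "x \<noteq> 0" using x(3) n by auto
    show "x \<in> index_set n \<union> (\<lambda>x. int n - x) ` index_set n"
    proof (cases "2 * x \<le> int n")
      case True
      then have "real_of_int (2 * x) \<le> real_of_int (int n)" by (simp only: of_int_le_iff)
      then show ?thesis using x \<open>x \<noteq> 0\<close> by (simp add: index_set_def)
    next
      case False
      then have "2 * (int n - x) \<le> int n" by simp
      then have "real_of_int (2 * (int n - x)) \<le> real_of_int (int n)" by (simp only: of_int_le_iff)
      moreover have "coprime (int n - x) (int n)" using x(3) by (simp add: coprime_iff_gcd_eq_1 gcd_diff2)
      ultimately have "int n - x \<in> index_set n" using x by (simp add: index_set_def)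
      then show ?thesis by force
    qed
  next
    fix x assume "x \<in> index_set n \<union> (\<lambda>x. int n - x) ` index_set n"
    then show "x \<in> unit_residues n"
    proof
      assume "x \<in> index_set n"
      from index_setD[OF this n] show ?thesis by (simp add: unit_residues_def)
    next
      assume "x \<in> (\<lambda>x. int n - x) ` index_set n"
      then obtain y where y: "x = int n - y" "y \<in> index_set n" by blast
      have "coprime (int n - y) (int n)" using index_setD(3)[OF y(2) n] by (simp add: coprime_iff_gcd_eq_1 gcd_diff2)
      with index_setD[OF y(2) n] show ?thesis by (simp add: unit_residues_def y)
    qed
  qed
  have "index_set n \<inter> (\<lambda>x. int n - x) ` index_set n = {}"
  proof (rule ccontr)
    assume "\<not> ?thesis"
    then obtain y where y: "int n - y \<in> index_set n" "y \<in> index_set n" by blast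
    show False using index_setD(2)[OF y(1) n] index_setD(2)[OF y(2) n] by simp
  qed
  then have "(\<Sum>x\<in>unit_residues n. F x) = (\<Sum>x\<in>index_set n. F x) + (\<Sum>x\<in>(\<lambda>x. int n - x) ` index_set n. F x)"
    unfolding un by (intro sum.union_disjoint) auto
  also have "(\<Sum>x\<in>(\<lambda>x. int n - x) ` index_set n. F x) = (\<Sum>x\<in>index_set n. F (int n - x))"
    by (subst sum.reindex) (auto simp: inj_on_def)
  also have "\<dots> = (\<Sum>x\<in>index_set n. F (- x))"
    by (intro sum.cong refl F) (simp add: cong_iff_dvd_diff)
  finally show ?thesis by (simp add: sum.distrib)
qed

section \<open>The Bernoulli matrix as a convolution\<close>

lemma finite_fourier_inversion:
  fixes f :: "int \<Rightarrow> complex"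
  assumes n: "n > 0" and k: "0 \<le> k" "k < int n"
  shows "f k = (\<Sum>a\<in>{0..<int n}. unit_exp n (a * k) * (\<Sum>l\<in>{0..<int n}. unit_exp n (- (a * l)) * f l)) / of_nat n"
proof -
  have "(\<Sum>a\<in>{0..<int n}. unit_exp n (a * k) * (\<Sum>l\<in>{0..<int n}. unit_exp n (- (a * l)) * f l)) =
    (\<Sum>a\<in>{0..<int n}. \<Sum>l\<in>{0..<int n}. unit_exp n (a * (k - l)) * f l)"
    unfolding sum_distrib_left
    by (intro sum.cong refl) (simp add: right_diff_distrib mult.assoc [symmetric] flip: unit_exp_add)
  also have "\<dots> = (\<Sum>l\<in>{0..<int n}. (\<Sum>a\<in>{0..<int n}. unit_exp n (a * (k - l))) * f l)"
    by (subst sum.swap) (simp only: sum_distrib_right)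
  also have "\<dots> = (\<Sum>l\<in>{0..<int n}. if l = k then of_nat n * f l else 0)"
  proof (rule sum.cong[OF refl])
    fix l assume "l \<in> {0..<int n}"
    then have l: "0 \<le> l" "l < int n" by auto
    have "l = k" if "int n dvd k - l"
    proof (rule ccontr)
      assume "l \<noteq> k"
      then have "int n \<le> \<bar>k - l\<bar>" using dvd_imp_le_int[of "k - l" "int n"] that by simp
      then show False using k l by linarith
    qed
    then have "int n dvd k - l \<longleftrightarrow> l = k" by auto
    then show "(\<Sum>a\<in>{0..<int n}. unit_exp n (a * (k - l))) * f l = (if l = k then of_nat n * f l else 0)"
      by (simp add: sum_unit_exp[OF n])
  qed
  also have "\<dots> = of_nat n * f k" using k by simp
  finally show ?thesis using n by simp
qed

text \<open>
  The value that the residue class of \<open>k\<close> contributes to the Bernoulli matrix. The class of \<open>0\<close> is represented by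
  \<open>n\<close>, which is left out for odd \<open>r\<close>.
\<close>

definition bernoulli_value :: "nat \<Rightarrow> nat \<Rightarrow> int \<Rightarrow> real" where
  "bernoulli_value r n k = (if k = 0 then (if odd r then 0 else bernoulli_poly r 1) else bernoulli_poly r (real_of_int k / real n))"

text \<open>
  Only \<open>B_1\<close> takes different values at \<open>0\<close> and \<open>1\<close>, and the odd Bernoulli numbers beyond it vanish. For
  \<open>r = 1\<close> the correction \<open>1 / 2\<close> cancels the constant in the Fourier transform of the Bernoulli values.
\<close>

lemma bernoulli_value_0:
  assumes "r \<ge> 1"
  shows "bernoulli_value r n 0 = bernoulli_poly r 0 + (if r = 1 then 1 / 2 else 0)"
  using bernoulli_poly_1[of r] bernoulli_poly_reflect[of r] assms
  by (auto simp: bernoulli_value_def)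

lemma bernoulli_value_dft:
  assumes n: "n \<ge> 3" and r: "r \<ge> 1" and a: "a \<in> unit_residues n"
  shows "(\<Sum>l\<in>{0..<int n}. unit_exp n (- (a * l)) * of_real (bernoulli_value r n l)) =
    - of_nat n * fact r / (2 * of_real pi * \<i>) ^ r * Lsum r (residue_indicator n a)"
proof -
  define m where "m = nat a"
  have a': "0 \<le> a" "a < int n" "coprime a (int n)" using a by (auto simp: unit_residues_def)
  have am: "a = int m" using a' by (simp add: m_def)
  have "a \<noteq> 0" using a'(3) n by auto
  then have m: "0 < m" "m < n" "coprime m n" using a' am by auto
  have "{0..<int n} = int ` {..<n}" by (simp add: image_int_atLeastLessThan lessThan_atLeast0)
  then have "(\<Sum>l\<in>{0..<int n}. unit_exp n (- (a * l)) * of_real (bernoulli_value r n l)) =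
     (\<Sum>k<n. unit_exp n (- (a * int k)) * of_real (bernoulli_value r n (int k)))"
    by (simp add: sum.reindex)
  also have "\<dots> = (\<Sum>k<n. cis (- (2 * pi * real m * real k / real n)) * of_real (bernoulli_poly r (real k / real n)) +
       (if k = 0 then (if r = 1 then 1 / 2 else 0) else 0))"
  proof (rule sum.cong[OF refl])
    fix k
    have "unit_exp n (- (a * int k)) = cis (- (2 * pi * real m * real k / real n))"
      unfolding unit_exp_def am by (rule arg_cong[of _ _ cis]) simp
    then show "unit_exp n (- (a * int k)) * of_real (bernoulli_value r n (int k)) =
        cis (- (2 * pi * real m * real k / real n)) * of_real (bernoulli_poly r (real k / real n)) + (if k = 0 then (if r = 1 then 1 / 2 else 0) else 0)"
      using bernoulli_value_0[OF r, of n] by (cases "k = 0") (simp_all add: bernoulli_value_def[of r n "int k"])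
  qed
  also have "\<dots> = (\<Sum>k<n. cis (- (2 * pi * real m * real k / real n)) * of_real (bernoulli_poly r (real k / real n))) + (if r = 1 then 1 / 2 else 0)"
    using n by (simp add: sum.distrib)
  also have "(\<Sum>k<n. cis (- (2 * pi * real m * real k / real n)) * of_real (bernoulli_poly r (real k / real n))) =
     fact r * (- (if r = 1 then 1 / 2 else 0) - of_nat n / (2 * of_real pi * \<i>) ^ r * Lsum r (residue_indicator n a))"
    unfolding am by (rule bernoulli_dft[OF m r])
  finally show ?thesis by (cases "r = 1") (simp_all add: algebra_simps)
qed

text \<open>
  The factor that relates the Bernoulli matrix to the sums \<open>Lsum\<close>: the normalisation of the matrix times the
  constant of the Fourier expansion of the Bernoulli polynomials.
\<close>

definition theta :: "nat \<Rightarrow> nat \<Rightarrow> complex" where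
  "theta n r = - ((- 1) ^ r * 2 ^ r * of_nat n ^ (r - 1) / of_nat r * fact r / (2 * of_real pi * \<i>) ^ r)"

text \<open>
  The Bernoulli matrix entry as a function on the units, in convolution form.
\<close>

definition beta :: "nat \<Rightarrow> nat \<Rightarrow> int \<Rightarrow> complex" where
  "beta n r x = theta n r * (\<Sum>a\<in>unit_residues n. Lsum r (residue_indicator n a) * moebius_exp n (a * x))"

text \<open>
  By the Chinese remainder theorem the conditions on \<open>k\<close> describe one residue class modulo \<open>n\<close>.
\<close>

lemma B_tilde_inner_sum:
  assumes n: "n \<ge> 3" and sf: "squarefree n" and d: "d dvd n" and j: "coprime j (int n)"
  shows "(\<Sum>k | k \<in> {1..n_tilde n r} \<and> gcd k n = d \<and> [int k = j] (mod int (n div d)). bernoulli_poly r (real k / real n)) =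
     bernoulli_value r n ((j * crt_unit n d) mod int n)"
proof -
  have n0: "n > 0" using n by simp
  define t where "t = (j * crt_unit n d) mod int n"
  have t: "0 \<le> t" "t < int n" using n0 by (simp_all add: t_def)
  have tc: "[t = j * crt_unit n d] (mod int n)" by (simp add: t_def cong_def)
  have "n div d dvd n" by (rule dvdI[of _ _ d]) (use d in simp)
  then have dn: "int d dvd int n" "int (n div d) dvd int n" using d by simp_all
  have iff: "gcd k n = d \<and> [int k = j] (mod int (n div d)) \<longleftrightarrow> [int k = t] (mod int n)" for k
  proof
    assume *: "gcd k n = d \<and> [int k = j] (mod int (n div d))"
    then have "d dvd k" by auto
    then have "[int k = 0] (mod int d)" by (simp add: cong_0_iff)
    with * have "[int k = j * crt_unit n d] (mod int n)" by (intro crt_unit_unique[OF sf d]) auto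
    then show "[int k = t] (mod int n)" using tc cong_sym cong_trans by blast
  next
    assume *: "[int k = t] (mod int n)"
    then have k: "[int k = j * crt_unit n d] (mod int n)" using tc cong_trans by blast
    have "[int k = j * crt_unit n d] (mod int d)" "[int k = j * crt_unit n d] (mod int (n div d))"
      using cong_dvd_modulus[OF k] dn by simp_all
    moreover have "[j * crt_unit n d = j * 0] (mod int d)"
      by (rule cong_mult[OF cong_refl crt_unit(1)[OF sf d]])
    moreover have "[j * crt_unit n d = j * 1] (mod int (n div d))"
      by (rule cong_mult[OF cong_refl crt_unit(2)[OF sf d]])
    ultimately have "[int k = j * 0] (mod int d)" "[int k = j * 1] (mod int (n div d))"
      by (blast intro: cong_trans)+
    then have kd: "[int k = 0] (mod int d)" and kj: "[int k = j] (mod int (n div d))" by simp_all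
    have "d dvd k" using kd by (simp add: cong_0_iff)
    have "coprime j (int (n div d))" using j dn(2) by (metis coprime_mult_right_iff dvd_def)
    then have "coprime (int k) (int (n div d))" using kj cong_imp_coprime cong_sym by blast
    then have "coprime k (n div d)" by simp
    then have "coprime (gcd k n) (n div d)" by (meson coprime_divisors dvd_refl gcd_dvd1)
    moreover have "gcd k n dvd d * (n div d)" using d by simp
    ultimately have "gcd k n dvd d" by (simp add: coprime_dvd_mult_left_iff)
    moreover have "d dvd gcd k n" using \<open>d dvd k\<close> d by simp
    ultimately show "gcd k n = d \<and> [int k = j] (mod int (n div d))" using kj by (simp add: dvd_antisym)
  qed
  let ?S = "{k. k \<in> {1..n_tilde n r} \<and> [int k = t] (mod int n)}"
  have le: "n - 1 \<le> n_tilde n r" "n_tilde n r \<le> n" by (simp_all add: n_tilde_def)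
  have small: "int k = t" if "k < n" "[int k = t] (mod int n)" for k
    using that t by (simp add: cong_def)
  have "(\<Sum>k\<in>?S. bernoulli_poly r (real k / real n)) = bernoulli_value r n t"
  proof (cases "t = 0")
    case False
    have "?S = {nat t}"
    proof (intro equalityI subsetI)
      fix k assume k: "k \<in> ?S"
      have "k \<noteq> n"
      proof
        assume "k = n"
        then have "[int n = t] (mod int n)" using k by simp
        then show False using t False by (simp add: cong_def)
      qed
      then have "k < n" using k le by auto
      then have "int k = t" using small k by blast
      then show "k \<in> {nat t}" by simp
    next
      fix k assume "k \<in> {nat t}"
      then show "k \<in> ?S" using t False le by (simp add: cong_def nat_less_iff) linarith
    qed
    then show ?thesis using False t by (simp add: bernoulli_value_def)
  next
    case True
    have "?S = (if odd r then {} else {n})"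
    proof (intro equalityI subsetI)
      fix k assume k: "k \<in> ?S"
      then have "\<not> k < n" using small[of k] True by auto
      then have "k = n" using k le by auto
      then show "k \<in> (if odd r then {} else {n})" using k n by (auto simp: n_tilde_def split: if_splits)
    next
      fix k assume "k \<in> (if odd r then {} else {n})"
      then show "k \<in> ?S" using True n by (auto simp: n_tilde_def cong_def split: if_splits)
    qed
    then show ?thesis using True n by (simp add: bernoulli_value_def)
  qed
  then show ?thesis by (simp only: iff t_def)
qed

text \<open>
  Fourier inversion of the Bernoulli values turns the alternating sum over \<open>d\<close> into \<open>moebius_exp\<close>, which
  discards all frequencies that are not units; at the units the Fourier coefficients are the sums \<open>Lsum\<close>.
\<close>

theorem B_tilde_eq_beta:
  assumes n: "n \<ge> 3" and sf: "squarefree n" and r: "r \<ge> 1" and j: "coprime j (int n)"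
  shows "complex_of_real (B_tilde n r j) = beta n r j"
proof -
  have n0: "n > 0" using n by simp
  define K :: complex where "K = (- 1) ^ r * 2 ^ r * of_nat n ^ (r - 1) / of_nat r"
  define hB where "hB = (\<lambda>a. \<Sum>l\<in>{0..<int n}. unit_exp n (- (a * l)) * complex_of_real (bernoulli_value r n l))"
  have val: "complex_of_real (bernoulli_value r n ((j * c) mod int n)) = (\<Sum>a\<in>{0..<int n}. hB a * unit_exp n ((a * j) * c)) / of_nat n" for c
  proof -
    have "complex_of_real (bernoulli_value r n ((j * c) mod int n)) = (\<Sum>a\<in>{0..<int n}. unit_exp n (a * ((j * c) mod int n)) * hB a) / of_nat n"
      unfolding hB_def by (rule finite_fourier_inversion[OF n0]) (use n0 in simp_all)
    moreover have "unit_exp n (a * ((j * c) mod int n)) = unit_exp n ((a * j) * c)" for a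
      by (rule unit_exp_cong[OF n0]) (simp add: cong_def mod_mult_right_eq mult.assoc)
    ultimately show ?thesis by (simp only: mult.commute[of "hB _"])
  qed
  have "B_tilde n r j = (- 1) ^ r * 2 ^ r * real n ^ (r - 1) / real r *
      (\<Sum>d | d dvd n. real_of_int (moebius d) * bernoulli_value r n ((j * crt_unit n d) mod int n))"
    unfolding B_tilde_def
    by (intro arg_cong2[where f = "(*)"] refl sum.cong) (rule B_tilde_inner_sum[OF n sf _ j], simp)
  then have "complex_of_real (B_tilde n r j) = K * (\<Sum>d | d dvd n. of_int (moebius d) * complex_of_real (bernoulli_value r n ((j * crt_unit n d) mod int n)))"
    by (simp add: K_def)
  also have "\<dots> = K * (\<Sum>d | d dvd n. \<Sum>a\<in>{0..<int n}. hB a * (of_int (moebius d) * unit_exp n ((a * j) * crt_unit n d))) / of_nat n"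
    by (simp add: val sum_distrib_left sum_divide_distrib mult_ac)
  also have "(\<Sum>d | d dvd n. \<Sum>a\<in>{0..<int n}. hB a * (of_int (moebius d) * unit_exp n ((a * j) * crt_unit n d))) =
     (\<Sum>a\<in>{0..<int n}. hB a * moebius_exp n (a * j))"
    unfolding moebius_exp_def by (subst sum.swap) (simp only: sum_distrib_left)
  also have "\<dots> = (\<Sum>a\<in>unit_residues n. hB a * moebius_exp n (a * j))"
    by (rule sum_unit_residues[OF sf]) (simp add: moebius_exp_eq_0[OF sf])
  also have "\<dots> = (\<Sum>a\<in>unit_residues n. (- of_nat n * fact r / (2 * of_real pi * \<i>) ^ r) * (Lsum r (residue_indicator n a) * moebius_exp n (a * j)))"
    by (intro sum.cong refl) (simp add: hB_def bernoulli_value_dft[OF n r])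
  also have "\<dots> = (- of_nat n * fact r / (2 * of_real pi * \<i>) ^ r) * (\<Sum>a\<in>unit_residues n. Lsum r (residue_indicator n a) * moebius_exp n (a * j))"
    by (simp only: sum_distrib_left)
  also have "K * \<dots> / of_nat n = theta n r * (\<Sum>a\<in>unit_residues n. Lsum r (residue_indicator n a) * moebius_exp n (a * j))"
    using n0 by (simp add: theta_def K_def)
  also have "\<dots> = beta n r j" by (simp only: beta_def)
  finally show ?thesis .
qed

abbreviation m_num :: "nat \<Rightarrow> nat \<Rightarrow> int \<Rightarrow> complex" where
  "m_num n r k \<equiv> Msum r (residue_indicator n k)"

section \<open>The inverse of the Bernoulli matrix\<close>

lemma residue_indicator_cong:
  assumes "[a = b] (mod int n)"
  shows "residue_indicator n a = residue_indicator n b"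
  using assms by (auto simp: residue_indicator_def fun_eq_iff cong_def)

lemma parity_part_residue_indicator_minus:
  "parity_part r (residue_indicator n (- a)) x = (- 1) ^ r * parity_part r (residue_indicator n a) x"
proof -
  have "[- u = v] (mod int n) \<longleftrightarrow> [u = - v] (mod int n)" for u v
  proof -
    have e: "- u - v = - (u - - v)" by simp
    show ?thesis unfolding cong_iff_dvd_diff e dvd_minus_iff ..
  qed
  then have "residue_indicator n (- a) x = residue_indicator n a (- x)" for x
    by (simp add: residue_indicator_def)
  then show ?thesis
    by (cases "even r") (simp_all add: parity_part_def)
qed

lemma Msum_minus:
  assumes n: "n > 0" and r: "r \<ge> 1" and a: "coprime a (int n)"
  shows "m_num n r (- a) = (- 1) ^ r * m_num n r a"
proof -
  have "Mterm r (residue_indicator n (- a)) = (\<lambda>m. (- 1) ^ r * Mterm r (residue_indicator n a) m)"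
    by (simp add: fun_eq_iff Mterm_def parity_part_residue_indicator_minus)
  then show ?thesis
    unfolding Msum_def by (simp only: suminf_mult[OF moebius_convolution_indicator(1)[OF n r a]])
qed

lemma Lsum_minus:
  assumes n: "n > 0" and r: "r \<ge> 1" and a: "coprime a (int n)"
  shows "Lsum r (residue_indicator n (- a)) = (- 1) ^ r * Lsum r (residue_indicator n a)"
proof -
  have "Lterm r (residue_indicator n (- a)) = (\<lambda>m. (- 1) ^ r * Lterm r (residue_indicator n a) m)"
    by (simp add: fun_eq_iff Lterm_def parity_part_residue_indicator_minus)
  then show ?thesis
    unfolding Lsum_def
    by (simp only: suminf_mult[OF Lterm_summable[OF n residue_indicator_in_residue_functions[OF a] r]])
qed

lemma Msum_expand:
  assumes n: "n > 0" and r: "r \<ge> 1" and f: "f \<in> residue_functions n"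
  shows "Msum r f = (\<Sum>a\<in>unit_residues n. f a * m_num n r a)"
proof -
  have sm: "summable (Mterm r (residue_indicator n a))" if "a \<in> unit_residues n" for a
    by (rule moebius_convolution_indicator(1)[OF n r unit_residues_coprime[OF that]])
  have "Mterm r f m = (\<Sum>a\<in>unit_residues n. f a * Mterm r (residue_indicator n a) m)" for m
    by (subst residue_functions_expand[OF n f])
       (simp add: Mterm_def parity_part_def sum_distrib_left sum_distrib_right sum.distrib [symmetric] algebra_simps)
  then have "Msum r f = (\<Sum>m. \<Sum>a\<in>unit_residues n. f a * Mterm r (residue_indicator n a) m)"
    by (simp only: Msum_def)
  also have "\<dots> = (\<Sum>a\<in>unit_residues n. \<Sum>m. f a * Mterm r (residue_indicator n a) m)"
    by (rule suminf_sum) (intro summable_mult sm)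
  also have "\<dots> = (\<Sum>a\<in>unit_residues n. f a * m_num n r a)"
    unfolding Msum_def by (intro sum.cong refl suminf_mult sm)
  finally show ?thesis .
qed

lemma minv_cong: "coprime x (int n) \<Longrightarrow> [x * y = 1] (mod int n) \<Longrightarrow> [modular_inverse (int n) x = y] (mod int n)"
proof -
  assume x: "coprime x (int n)" and xy: "[x * y = 1] (mod int n)"
  have "[x * modular_inverse (int n) x = x * y] (mod int n)"
    using cong_trans[OF cong_modular_inverse1[OF x] cong_sym[OF xy]] .
  then show ?thesis by (simp only: cong_mult_lcancel[OF x])
qed

lemma minv_minus: "coprime x (int n) \<Longrightarrow> [modular_inverse (int n) (- x) = - modular_inverse (int n) x] (mod int n)"
  by (rule minv_cong) (use cong_modular_inverse1[of x "int n"] in simp_all)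

lemma minv_cong_arg:
  assumes x: "coprime x (int n)" and xy: "[x = y] (mod int n)"
  shows "[modular_inverse (int n) x = modular_inverse (int n) y] (mod int n)"
proof (rule minv_cong[OF x])
  have "coprime y (int n)" using x xy cong_imp_coprime by blast
  then have "[y * modular_inverse (int n) y = 1] (mod int n)" by (rule cong_modular_inverse1)
  moreover have "[x * modular_inverse (int n) y = y * modular_inverse (int n) y] (mod int n)" by (rule cong_mult[OF xy cong_refl])
  ultimately show "[x * modular_inverse (int n) y = 1] (mod int n)" using cong_trans by blast
qed

context
  fixes n r :: nat
  assumes n3: "n \<ge> 3" and sf: "squarefree n" and r1: "r \<ge> 1"
begin

abbreviation minv :: "int \<Rightarrow> int" where "minv \<equiv> modular_inverse (int n)"

lemma modulus_pos: "n > 0" and modulus_gt_1: "n > 1"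
  using n3 by auto

lemma theta_nonzero: "theta n r \<noteq> 0"
  using modulus_pos r1 by (simp add: theta_def)

lemma beta_cong: "[x = y] (mod int n) \<Longrightarrow> beta n r x = beta n r y"
  unfolding beta_def
  by (intro arg_cong2[where f = "(*)"] refl sum.cong moebius_exp_cong[OF sf] cong_mult cong_refl)

lemma beta_minus: "beta n r (- x) = (- 1) ^ r * beta n r x"
proof -
  let ?F = "\<lambda>a. Lsum r (residue_indicator n a) * moebius_exp n (a * - x)"
  have "(\<Sum>a\<in>unit_residues n. ?F a) = (\<Sum>a\<in>unit_residues n. ?F (- 1 * a))"
  proof (rule sum_unit_residues_mult[OF modulus_pos, symmetric])
    fix a b assume ab: "[a = b] (mod int n)"
    show "?F a = ?F b"
      by (simp only: residue_indicator_cong[OF ab] moebius_exp_cong[OF sf cong_mult[OF ab cong_refl[of "- x"]]])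
  qed simp
  also have "\<dots> = (- 1) ^ r * (\<Sum>a\<in>unit_residues n. Lsum r (residue_indicator n a) * moebius_exp n (a * x))"
    unfolding sum_distrib_left
    by (intro sum.cong refl) (simp add: Lsum_minus[OF modulus_pos r1] unit_residues_coprime mult.assoc)
  finally show ?thesis by (simp add: beta_def)
qed

text \<open>
  The convolution identity with the test function \<open>x \<mapsto> moebius_exp n (x * y)\<close>: convolving with \<open>M\<close> removes
  the factor \<open>L\<close> from \<open>beta\<close>.
\<close>

lemma beta_m_num_sum:
  assumes y: "coprime y (int n)"
  shows "(\<Sum>k\<in>unit_residues n. beta n r (k * y) * m_num n r k) =
     2 * theta n r * (moebius_exp n y + (- 1) ^ r * moebius_exp n (- y))"
proof -
  define f where "f = (\<lambda>x. moebius_exp n (x * y))"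
  have f: "f \<in> residue_functions n"
    unfolding residue_functions_def f_def
    by (auto intro!: moebius_exp_cong[OF sf] cong_mult moebius_exp_eq_0[OF sf])
  have fa: "(\<lambda>x. f (a * x)) \<in> residue_functions n" for a
    unfolding residue_functions_def f_def
    by (auto intro!: moebius_exp_cong[OF sf] cong_mult moebius_exp_eq_0[OF sf])
  have "(\<Sum>k\<in>unit_residues n. beta n r (k * y) * m_num n r k) =
     (\<Sum>k\<in>unit_residues n. \<Sum>a\<in>unit_residues n. theta n r * (Lsum r (residue_indicator n a) * (f (a * k) * m_num n r k)))"
    by (simp add: beta_def f_def sum_distrib_left sum_distrib_right mult.assoc)
  also have "\<dots> = theta n r * (\<Sum>a\<in>unit_residues n. Lsum r (residue_indicator n a) * (\<Sum>k\<in>unit_residues n. f (a * k) * m_num n r k))"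
    by (subst sum.swap) (simp only: sum_distrib_left)
  also have "\<dots> = theta n r * (\<Sum>a\<in>unit_residues n. Lsum r (residue_indicator n a) * Msum r (\<lambda>x. f (a * x)))"
    by (simp only: Msum_expand[OF modulus_pos r1 fa])
  also have "\<dots> = theta n r * (2 * (f 1 + (- 1) ^ r * f (- 1)))"
    using moebius_convolution[OF modulus_pos r1 f] by simp
  finally show ?thesis by (simp add: f_def)
qed

text \<open>
  \<open>M\<close> inverts the factor \<open>L\<close> of \<open>beta\<close> and the exponential inverts the factor \<open>moebius_exp\<close>; their convolution
  therefore inverts \<open>beta\<close>, up to parity and a constant.
\<close>

definition gam :: "int \<Rightarrow> complex" where
  "gam v = (\<Sum>k\<in>unit_residues n. m_num n r k * unit_exp n (- (minv k * v)))"

lemma gam_cong: "[x = y] (mod int n) \<Longrightarrow> gam x = gam y"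
  unfolding gam_def
  by (intro arg_cong2[where f = "(*)"] refl sum.cong unit_exp_cong[OF modulus_pos])
     (simp add: cong_minus_minus_iff cong_mult cong_refl)

lemma gam_minus: "gam (- v) = (- 1) ^ r * gam v"
proof -
  let ?F = "\<lambda>k. if coprime k (int n) then m_num n r k * unit_exp n (- (minv k * - v)) else 0"
  have "gam (- v) = (\<Sum>k\<in>unit_residues n. ?F k)"
    unfolding gam_def by (intro sum.cong refl) (simp add: unit_residues_coprime)
  also have "\<dots> = (\<Sum>k\<in>unit_residues n. ?F (- 1 * k))"
  proof (rule sum_unit_residues_mult[OF modulus_pos, symmetric])
    fix a b assume ab: "[a = b] (mod int n)"
    have cop: "coprime a (int n) \<longleftrightarrow> coprime b (int n)"
      using ab cong_imp_coprime cong_sym by blast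
    show "?F a = ?F b"
    proof (cases "coprime a (int n)")
      case True
      have "unit_exp n (- (minv a * - v)) = unit_exp n (- (minv b * - v))"
        using minv_cong_arg[OF True ab] by (intro unit_exp_cong[OF modulus_pos]) (simp add: cong_mult cong_refl)
      then show ?thesis using cop residue_indicator_cong[OF ab] by simp
    qed (use cop in simp)
  qed simp
  also have "\<dots> = (\<Sum>k\<in>unit_residues n. (- 1) ^ r * (m_num n r k * unit_exp n (- (minv k * v))))"
  proof (rule sum.cong[OF refl])
    fix k assume "k \<in> unit_residues n"
    then have k: "coprime k (int n)" by (rule unit_residues_coprime)
    have "[minv (- k) * v = - minv k * v] (mod int n)" by (rule cong_mult[OF minv_minus[OF k] cong_refl])
    then have "unit_exp n (minv (- k) * v) = unit_exp n (- (minv k * v))" by (intro unit_exp_cong[OF modulus_pos]) simp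
    then show "?F (- 1 * k) = (- 1) ^ r * (m_num n r k * unit_exp n (- (minv k * v)))"
      using k by (simp add: Msum_minus[OF modulus_pos r1])
  qed
  also have "\<dots> = (- 1) ^ r * gam v" by (simp only: gam_def sum_distrib_left)
  finally show ?thesis .
qed

lemma beta_gam_sum:
  assumes z: "coprime z (int n)"
  shows "(\<Sum>w\<in>unit_residues n. beta n r w * gam (w * z)) =
     2 * theta n r * of_nat n * ((if [1 = z] (mod int n) then 1 else 0) + (- 1) ^ r * (if [- 1 = z] (mod int n) then 1 else 0))"
proof -
  have "(\<Sum>w\<in>unit_residues n. beta n r w * gam (w * z)) =
     (\<Sum>w\<in>unit_residues n. \<Sum>k\<in>unit_residues n. m_num n r k * (beta n r w * unit_exp n (- (minv k * (w * z)))))"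
    by (simp add: gam_def sum_distrib_left mult.left_commute)
  also have "\<dots> = (\<Sum>k\<in>unit_residues n. m_num n r k * (\<Sum>w\<in>unit_residues n. beta n r w * unit_exp n (- (minv k * (w * z)))))"
    by (subst sum.swap) (simp only: sum_distrib_left)
  also have "\<dots> = (\<Sum>k\<in>unit_residues n. m_num n r k * (\<Sum>y\<in>unit_residues n. beta n r (k * y) * unit_exp n (- (y * z))))"
  proof (rule sum.cong[OF refl], rule arg_cong2[where f = "(*)", OF refl])
    fix k assume "k \<in> unit_residues n"
    then have k: "coprime k (int n)" by (rule unit_residues_coprime)
    let ?F = "\<lambda>w. beta n r w * unit_exp n (- (minv k * (w * z)))"
    have "(\<Sum>w\<in>unit_residues n. ?F w) = (\<Sum>y\<in>unit_residues n. ?F (k * y))"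
    proof (rule sum_unit_residues_mult[OF modulus_pos k, symmetric])
      fix a b assume ab: "[a = b] (mod int n)"
      have "[- (minv k * (a * z)) = - (minv k * (b * z))] (mod int n)"
        unfolding cong_minus_minus_iff by (intro cong_mult cong_refl ab)
      then show "?F a = ?F b" using beta_cong[OF ab] unit_exp_cong[OF modulus_pos] by simp
    qed
    also have "\<dots> = (\<Sum>y\<in>unit_residues n. beta n r (k * y) * unit_exp n (- (y * z)))"
    proof (intro sum.cong refl arg_cong2[where f = "(*)"] unit_exp_cong[OF modulus_pos])
      fix y
      have "[minv k * k * (y * z) = 1 * (y * z)] (mod int n)"
        by (rule cong_mult[OF cong_modular_inverse2[OF k] cong_refl])
      then show "[- (minv k * (k * y * z)) = - (y * z)] (mod int n)"
        unfolding cong_minus_minus_iff by (simp add: mult.assoc)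
    qed
    finally show "(\<Sum>w\<in>unit_residues n. ?F w) = (\<Sum>y\<in>unit_residues n. beta n r (k * y) * unit_exp n (- (y * z)))" .
  qed
  also have "\<dots> = (\<Sum>y\<in>unit_residues n. (\<Sum>k\<in>unit_residues n. beta n r (k * y) * m_num n r k) * unit_exp n (- (y * z)))"
    unfolding sum_distrib_left sum_distrib_right by (subst sum.swap) (simp only: mult_ac)
  also have "\<dots> = (\<Sum>y\<in>unit_residues n. 2 * theta n r * (moebius_exp n (y * 1) * unit_exp n (- (y * z)) +
      (- 1) ^ r * (moebius_exp n (y * - 1) * unit_exp n (- (y * z)))))"
  proof (rule sum.cong[OF refl])
    fix y assume "y \<in> unit_residues n"
    from beta_m_num_sum[OF unit_residues_coprime[OF this]]
    show "(\<Sum>k\<in>unit_residues n. beta n r (k * y) * m_num n r k) * unit_exp n (- (y * z)) =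
      2 * theta n r * (moebius_exp n (y * 1) * unit_exp n (- (y * z)) + (- 1) ^ r * (moebius_exp n (y * - 1) * unit_exp n (- (y * z))))"
      by (simp add: algebra_simps)
  qed
  also have "\<dots> = 2 * theta n r * ((\<Sum>y\<in>unit_residues n. moebius_exp n (y * 1) * unit_exp n (- (y * z))) +
      (- 1) ^ r * (\<Sum>y\<in>unit_residues n. moebius_exp n (y * - 1) * unit_exp n (- (y * z))))"
    by (simp only: sum_distrib_left [symmetric] sum.distrib)
  also have "\<dots> = 2 * theta n r * of_nat n * ((if [1 = z] (mod int n) then 1 else 0) + (- 1) ^ r * (if [- 1 = z] (mod int n) then 1 else 0))"
    unfolding moebius_exp_inversion[OF sf z] by (simp add: algebra_simps)
  finally show ?thesis .
qed

text \<open>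
  Distinct representatives are not congruent, nor negatives of each other, because they lie strictly
  between \<open>0\<close> and \<open>n / 2\<close>.
\<close>

lemma index_set_cong_iff:
  assumes i: "i \<in> index_set n" and j: "j \<in> index_set n"
  shows "[1 = minv j * i] (mod int n) \<longleftrightarrow> i = j" "\<not> [- 1 = minv j * i] (mod int n)"
proof -
  note i' = index_setD[OF i n3] and j' = index_setD[OF j n3]
  have mul: "[c = minv j * i] (mod int n) \<longleftrightarrow> [j * c = i] (mod int n)" for c
  proof
    assume "[c = minv j * i] (mod int n)"
    then have "[j * c = j * (minv j * i)] (mod int n)" by (rule cong_mult[OF cong_refl])
    moreover have "[j * minv j * i = 1 * i] (mod int n)"
      by (rule cong_mult[OF cong_modular_inverse1[OF j'(3)] cong_refl])
    then have "[j * (minv j * i) = i] (mod int n)" by (simp only: mult.assoc mult_1_left)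
    ultimately show "[j * c = i] (mod int n)" by (rule cong_trans)
  next
    assume "[j * c = i] (mod int n)"
    then have "[minv j * (j * c) = minv j * i] (mod int n)" by (rule cong_mult[OF cong_refl])
    moreover have "[minv j * j * c = 1 * c] (mod int n)"
      by (rule cong_mult[OF cong_modular_inverse2[OF j'(3)] cong_refl])
    then have "[c = minv j * (j * c)] (mod int n)" by (simp only: mult.assoc mult_1_left cong_sym_eq[of c])
    ultimately show "[c = minv j * i] (mod int n)" using cong_trans by blast
  qed
  have "[j = i] (mod int n) \<longleftrightarrow> i = j" using i' j' by (auto simp: cong_def)
  then show "[1 = minv j * i] (mod int n) \<longleftrightarrow> i = j" unfolding mul by simp
  show "\<not> [- 1 = minv j * i] (mod int n)"
  proof
    assume "[- 1 = minv j * i] (mod int n)"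
    then have "[- j = i] (mod int n)" unfolding mul by simp
    then have "int n dvd i + j" by (simp add: cong_iff_dvd_diff dvd_diff_commute)
    then have "int n \<le> i + j" using i' j' by (intro zdvd_imp_le) auto
    then show False using i' j' by simp
  qed
qed

text \<open>
  The quotient is real, being an entry of the inverse of a real matrix; taking the real part spares a proof
  of this.
\<close>

definition inv_mat :: "int \<Rightarrow> int \<Rightarrow> real" where
  "inv_mat l i = Re (gam (minv l * i) / (theta n r * of_nat n))"

lemma B_tilde_mat_eq_beta:
  assumes "j \<in> index_set n" "k \<in> index_set n"
  shows "complex_of_real (B_tilde_mat n r j k) = beta n r (j * minv k)"
proof -
  have cop: "coprime (j * minv k) (int n)"
    using index_setD(3)[OF assms(1) n3] index_setD(3)[OF assms(2) n3] by simp
  then have "coprime ((j * minv k) mod int n) (int n)" using modulus_pos by simp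
  from B_tilde_eq_beta[OF n3 sf r1 this]
  have "complex_of_real (B_tilde_mat n r j k) = beta n r ((j * minv k) mod int n)"
    by (simp add: B_tilde_mat_def)
  also have "\<dots> = beta n r (j * minv k)" by (rule beta_cong) (simp add: cong_def)
  finally show ?thesis .
qed

text \<open>
  A product of two factors of equal parity is even, so its sum over the units is twice the sum over the
  representatives up to sign.
\<close>

lemma half_sum:
  fixes F :: "int \<Rightarrow> complex"
  assumes "\<And>x y. [x = y] (mod int n) \<Longrightarrow> F x = F y" and even: "\<And>x. coprime x (int n) \<Longrightarrow> F (- x) = F x"
  shows "(\<Sum>x\<in>unit_residues n. F x) = 2 * (\<Sum>x\<in>index_set n. F x)"
proof -
  have "(\<Sum>x\<in>unit_residues n. F x) = (\<Sum>x\<in>index_set n. F x + F (- x))"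
    by (rule sum_unit_residues_pairs[OF n3]) (rule assms(1))
  also have "\<dots> = (\<Sum>x\<in>index_set n. 2 * F x)"
    by (intro sum.cong refl) (simp add: even index_setD(3)[OF _ n3])
  finally show ?thesis by (simp only: sum_distrib_left)
qed

lemma halve_equation: "x = 2 * a \<Longrightarrow> x = 2 * b * c * d \<Longrightarrow> a = b * c * (d :: complex)"
  by (simp add: mult.assoc)

lemma sign_sq: "(- 1) ^ r * ((- 1) ^ r * x) = (x :: complex)"
  by (cases "even r") simp_all

lemma beta_gam_half_sum:
  assumes i: "i \<in> index_set n" and j: "j \<in> index_set n"
  shows "(\<Sum>w\<in>unit_residues n. beta n r w * gam (w * (minv j * i))) = 2 * theta n r * of_nat n * (if i = j then 1 else 0)"
proof -
  have "coprime (minv j * i) (int n)" using index_setD(3)[OF i n3] index_setD(3)[OF j n3] by simp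
  from beta_gam_sum[OF this] show ?thesis using index_set_cong_iff[OF i j] by simp
qed

lemma beta_gam_cong:
  assumes "[a = b] (mod int n)"
  shows "beta n r a * gam (a * c) = beta n r b * gam (b * c)"
  using beta_cong[OF assms] gam_cong[OF cong_mult[OF assms cong_refl]] by simp

text \<open>
  Both products of the matrices become the sum of \<open>beta n r w * gam (w * z)\<close> over all units \<open>w\<close>, by doubling the
  range of summation and substituting \<open>w = j / l\<close> or \<open>w = l / j\<close>.
\<close>

lemma is_mat_inverse_inv_mat: "is_mat_inverse (index_set n) (B_tilde_mat n r) inv_mat"
proof -
  have re: "(\<Sum>l\<in>index_set n. B_tilde_mat n r (p l) (q l) * inv_mat (s l) (t l)) = (if P then 1 else 0)"
    if pq: "\<And>l. l \<in> index_set n \<Longrightarrow> p l \<in> index_set n \<and> q l \<in> index_set n"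
      and eq: "(\<Sum>l\<in>index_set n. beta n r (p l * minv (q l)) * gam (minv (s l) * t l)) = theta n r * of_nat n * (if P then 1 else 0)"
    for p q s t P
  proof -
    have "(\<Sum>l\<in>index_set n. B_tilde_mat n r (p l) (q l) * inv_mat (s l) (t l)) =
       Re (\<Sum>l\<in>index_set n. complex_of_real (B_tilde_mat n r (p l) (q l)) * (gam (minv (s l) * t l) / (theta n r * of_nat n)))"
      by (simp add: inv_mat_def del: times_divide_eq_right)
    also have "(\<Sum>l\<in>index_set n. complex_of_real (B_tilde_mat n r (p l) (q l)) * (gam (minv (s l) * t l) / (theta n r * of_nat n))) =
       (\<Sum>l\<in>index_set n. beta n r (p l * minv (q l)) * gam (minv (s l) * t l)) / (theta n r * of_nat n)"
      unfolding sum_divide_distrib by (intro sum.cong refl) (simp add: B_tilde_mat_eq_beta pq)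
    also have "\<dots> = (if P then 1 else 0)" unfolding eq using theta_nonzero modulus_pos by simp
    finally show ?thesis by simp
  qed
  have right: "(\<Sum>l\<in>index_set n. B_tilde_mat n r j l * inv_mat l i) = (if j = i then 1 else 0)"
    if i: "i \<in> index_set n" and j: "j \<in> index_set n" for i j
  proof (rule re)
    note ci = index_setD(3)[OF i n3] and cj = index_setD(3)[OF j n3]
    define F where "F = (\<lambda>l. if coprime l (int n) then beta n r (j * minv l) * gam (minv l * i) else 0)"
    have "(\<Sum>l\<in>unit_residues n. F l) = 2 * (\<Sum>l\<in>index_set n. F l)"
    proof (rule half_sum)
      fix x y assume xy: "[x = y] (mod int n)"
      have "coprime x (int n) \<longleftrightarrow> coprime y (int n)" using xy cong_imp_coprime cong_sym by blast
      moreover have "beta n r (j * minv x) * gam (minv x * i) = beta n r (j * minv y) * gam (minv y * i)" if "coprime x (int n)"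
        using beta_cong[OF cong_mult[OF cong_refl minv_cong_arg[OF that xy]]] gam_cong[OF cong_mult[OF minv_cong_arg[OF that xy] cong_refl]] by simp
      ultimately show "F x = F y" by (simp add: F_def)
    next
      fix x assume x: "coprime x (int n)"
      have "beta n r (j * minv (- x)) = beta n r (j * - minv x)" by (intro beta_cong cong_mult cong_refl minv_minus x)
      moreover have "gam (minv (- x) * i) = gam (- minv x * i)" by (intro gam_cong cong_mult cong_refl minv_minus x)
      ultimately show "F (- x) = F x"
        using x sign_sq[of "beta n r (j * minv x) * gam (minv x * i)"] by (simp add: F_def beta_minus gam_minus mult.left_commute mult.assoc)
    qed
    moreover have "(\<Sum>l\<in>index_set n. F l) = (\<Sum>l\<in>index_set n. beta n r (j * minv l) * gam (minv l * i))"
      by (intro sum.cong refl) (simp add: F_def index_setD(3)[OF _ n3])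
    moreover have "(\<Sum>l\<in>unit_residues n. F l) = 2 * theta n r * of_nat n * (if j = i then 1 else 0)"
    proof -
      have "(\<Sum>l\<in>unit_residues n. F l) = (\<Sum>l\<in>unit_residues n. beta n r (j * minv l) * gam (minv l * i))"
        by (intro sum.cong refl) (simp add: F_def unit_residues_coprime)
      also have "\<dots> = (\<Sum>x\<in>unit_residues n. beta n r (j * x) * gam (x * i))"
        by (rule sum_unit_residues_inverse[OF modulus_gt_1])
      also have "\<dots> = (\<Sum>x\<in>unit_residues n. beta n r (j * x) * gam (j * x * (minv j * i)))"
      proof (intro sum.cong refl arg_cong2[where f = "(*)"] gam_cong)
        fix x
        have "[j * minv j * (x * i) = 1 * (x * i)] (mod int n)" by (rule cong_mult[OF cong_modular_inverse1[OF cj] cong_refl])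
        then show "[x * i = j * x * (minv j * i)] (mod int n)" by (simp add: mult_ac cong_sym_eq)
      qed
      also have "\<dots> = (\<Sum>w\<in>unit_residues n. beta n r w * gam (w * (minv j * i)))"
        by (rule sum_unit_residues_mult[OF modulus_pos cj]) (rule beta_gam_cong)
      also have "\<dots> = 2 * theta n r * of_nat n * (if j = i then 1 else 0)"
        unfolding beta_gam_half_sum[OF i j] by (simp add: eq_commute)
      finally show ?thesis .
    qed
    ultimately show "(\<Sum>l\<in>index_set n. beta n r (j * minv l) * gam (minv l * i)) = theta n r * of_nat n * (if j = i then 1 else 0)"
      using halve_equation by metis
  qed (use i j in auto)
  have left: "(\<Sum>l\<in>index_set n. inv_mat i l * B_tilde_mat n r l j) = (if i = j then 1 else 0)"
    if i: "i \<in> index_set n" and j: "j \<in> index_set n" for i j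
  proof -
    note ci = index_setD(3)[OF i n3] and cj = index_setD(3)[OF j n3]
    have cj': "coprime (minv j) (int n)" using cj by simp
    define F where "F = (\<lambda>l. beta n r (l * minv j) * gam (minv i * l))"
    have "(\<Sum>l\<in>unit_residues n. F l) = 2 * (\<Sum>l\<in>index_set n. F l)"
    proof (rule half_sum)
      fix x y assume xy: "[x = y] (mod int n)"
      show "F x = F y"
        using beta_cong[OF cong_mult[OF xy cong_refl]] gam_cong[OF cong_mult[OF cong_refl xy]] by (simp add: F_def)
    next
      fix x
      show "F (- x) = F x"
        using sign_sq[of "beta n r (x * minv j) * gam (minv i * x)"] by (simp add: F_def beta_minus gam_minus mult.left_commute mult.assoc)
    qed
    moreover have "(\<Sum>l\<in>unit_residues n. F l) = 2 * theta n r * of_nat n * (if i = j then 1 else 0)"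
    proof -
      have "(\<Sum>l\<in>unit_residues n. F l) = (\<Sum>l\<in>unit_residues n. beta n r (minv j * l) * gam (minv j * l * (minv i * j)))"
        unfolding F_def
      proof (intro sum.cong refl arg_cong2[where f = "(*)"] gam_cong beta_cong)
        fix x
        show "[x * minv j = minv j * x] (mod int n)" by (simp add: mult.commute)
        have "[j * minv j * (minv i * x) = 1 * (minv i * x)] (mod int n)" by (rule cong_mult[OF cong_modular_inverse1[OF cj] cong_refl])
        then show "[minv i * x = minv j * x * (minv i * j)] (mod int n)" by (simp add: mult_ac cong_sym_eq)
      qed
      also have "\<dots> = (\<Sum>w\<in>unit_residues n. beta n r w * gam (w * (minv i * j)))"
        by (rule sum_unit_residues_mult[OF modulus_pos cj']) (rule beta_gam_cong)
      also have "\<dots> = 2 * theta n r * of_nat n * (if i = j then 1 else 0)"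
        unfolding beta_gam_half_sum[OF j i] by (simp add: eq_commute)
      finally show ?thesis .
    qed
    ultimately have "(\<Sum>l\<in>index_set n. F l) = theta n r * of_nat n * (if i = j then 1 else 0)"
      by (rule halve_equation)
    then have "(\<Sum>l\<in>index_set n. B_tilde_mat n r l j * inv_mat i l) = (if i = j then 1 else 0)"
      by (intro re) (use j in \<open>auto simp: F_def\<close>)
    then show ?thesis by (simp only: mult.commute)
  qed
  show ?thesis unfolding is_mat_inverse_def using left right by blast
qed

end

text \<open>
  A two-sided inverse is unique once its entries off the index set are fixed, so the description operator
  selects it.
\<close>

lemma mat_inverse_on_right_inverse:
  fixes A :: "'i \<Rightarrow> 'i \<Rightarrow> 'a :: semiring_1"
  assumes I: "finite I" and inv: "is_mat_inverse I A B" and ij: "i \<in> I" "j \<in> I"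
  shows "(\<Sum>l\<in>I. A i l * mat_inverse_on I A l j) = (if i = j then 1 else 0)"
proof -
  define B0 where "B0 = (\<lambda>i j. if i \<in> I \<and> j \<in> I then B i j else 0)"
  have B0: "is_mat_inverse I A B0 \<and> (\<forall>i j. i \<notin> I \<or> j \<notin> I \<longrightarrow> B0 i j = 0)"
    using inv by (auto simp: is_mat_inverse_def B0_def cong: sum.cong)
  have "mat_inverse_on I A = B0"
    unfolding mat_inverse_on_def
  proof (rule the_equality)
    show "is_mat_inverse I A B0 \<and> (\<forall>i j. i \<notin> I \<or> j \<notin> I \<longrightarrow> B0 i j = 0)" by (rule B0)
  next
    fix D assume D: "is_mat_inverse I A D \<and> (\<forall>i j. i \<notin> I \<or> j \<notin> I \<longrightarrow> D i j = 0)"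
    show "D = B0"
    proof (intro ext)
      fix i j
      show "D i j = B0 i j"
      proof (cases "i \<in> I \<and> j \<in> I")
        case True
        have "D i j = (\<Sum>l\<in>I. D i l * (if l = j then 1 else 0))"
          using True I by (simp add: if_distrib cong: if_cong)
        also have "\<dots> = (\<Sum>l\<in>I. D i l * (\<Sum>k\<in>I. A l k * B0 k j))"
          using B0 True by (intro sum.cong refl) (simp add: is_mat_inverse_def)
        also have "\<dots> = (\<Sum>l\<in>I. \<Sum>k\<in>I. D i l * A l k * B0 k j)"
          by (simp only: sum_distrib_left mult.assoc)
        also have "\<dots> = (\<Sum>k\<in>I. (\<Sum>l\<in>I. D i l * A l k) * B0 k j)"
          by (subst sum.swap) (simp only: sum_distrib_right)
        also have "\<dots> = (\<Sum>k\<in>I. (if i = k then 1 else 0) * B0 k j)"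
          using D True by (intro sum.cong refl) (simp add: is_mat_inverse_def)
        also have "\<dots> = B0 i j"
          using True I by (simp add: if_distrib[of "\<lambda>x. x * _"] cong: if_cong)
        finally show ?thesis .
      qed (use D B0 in auto)
    qed
  qed
  then show ?thesis using B0 ij by (simp add: is_mat_inverse_def)
qed

section \<open>The numbers s-hat and c-hat as exponential sums\<close>

lemma zeta_root_powi: "zeta_root n powi k = unit_exp n k"
proof -
  have "zeta_root n = cis (2 * pi / real n)"
    by (simp add: zeta_root_def cis_conv_exp mult_ac)
  then show ?thesis
    unfolding unit_exp_def by (simp add: cis_power_int mult_ac)
qed

text \<open>
  \<open>lam\<close> counts the divisors \<open>q \<ge> 3\<close>; the divisor \<open>1\<close> and, for even \<open>n\<close>, the divisor \<open>2\<close> always satisfy the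
  congruence. This is the role of \<open>rho\<close>.
\<close>

lemma divisor_count_eq_lam:
  assumes n: "n > 0" and k: "coprime k (int n)"
  shows "2 * card {q. q dvd n \<and> [k = 1] (mod int q)} = 2 * lam n k + rho n"
proof -
  let ?S = "{q. q dvd n \<and> [k = 1] (mod int q)}"
  have fin: "finite {q. q dvd n}" using n by simp
  have "int ` {q \<in> ?S. q \<ge> 3} = {q::int. q \<ge> 3 \<and> q dvd int n \<and> [k = 1] (mod q)}"
  proof (intro equalityI subsetI)
    fix q assume "q \<in> {q::int. q \<ge> 3 \<and> q dvd int n \<and> [k = 1] (mod q)}"
    then have "int (nat q) = q" "nat q \<ge> 3" "int (nat q) dvd int n" "[k = 1] (mod int (nat q))" by auto
    then show "q \<in> int ` {q \<in> ?S. q \<ge> 3}" by (metis (mono_tags, lifting) image_eqI int_dvd_int_iff mem_Collect_eq)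
  qed auto
  then have "lam n k = card (int ` {q \<in> ?S. q \<ge> 3})" by (simp add: lam_def)
  also have "\<dots> = card {q \<in> ?S. q \<ge> 3}" by (rule card_image) simp
  finally have 1: "lam n k = card {q \<in> ?S. q \<ge> 3}" .
  define A where "A = {q \<in> ?S. q \<ge> 3}"
  define B where "B = {q \<in> ?S. q < 3}"
  have un: "?S = A \<union> B" by (auto simp: A_def B_def)
  have "finite A" "finite B" by (rule finite_subset[OF _ fin], auto simp: A_def B_def)+
  then have "card ?S = card A + card B"
    unfolding un by (rule card_Un_disjoint) (auto simp: A_def B_def)
  moreover have "B = (if odd n then {1} else {1, 2})"
  proof -
    have "[k = 1] (mod 2)" if "even n"
    proof -
      have "odd k" using k that coprime_common_divisor[of k "int n" 2] by auto
      then show ?thesis by (simp add: cong_def odd_iff_mod_2_eq_one)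
    qed
    then have "q \<in> ?S \<and> q < 3 \<longleftrightarrow> q = 1 \<or> q = 2 \<and> even n" for q
    proof -
      have "q < 3 \<longleftrightarrow> q = 0 \<or> q = 1 \<or> q = 2" by auto
      then show ?thesis using n \<open>even n \<Longrightarrow> [k = 1] (mod 2)\<close> by auto
    qed
    then show ?thesis unfolding B_def by (auto split: if_splits)
  qed
  then have "2 * card B = rho n" by (simp add: rho_def)
  ultimately show ?thesis using 1 by (simp add: A_def)
qed

context
  fixes n :: nat
  assumes n3': "n \<ge> 3" and sf': "squarefree n"
begin

definition dcount :: "int \<Rightarrow> complex" where
  "dcount k = of_nat (card {q. q dvd n \<and> [k = 1] (mod int q)})"

lemma dcount_cong: "[x = y] (mod int n) \<Longrightarrow> dcount x = dcount y"
proof -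
  assume xy: "[x = y] (mod int n)"
  have "[x = 1] (mod int q) \<longleftrightarrow> [y = 1] (mod int q)" if "q dvd n" for q
  proof -
    have "[x = y] (mod int q)" using cong_dvd_modulus[OF xy] that by simp
    then show ?thesis using cong_sym cong_trans by blast
  qed
  then have "{q. q dvd n \<and> [x = 1] (mod int q)} = {q. q dvd n \<and> [y = 1] (mod int q)}" by blast
  then show ?thesis by (simp add: dcount_def)
qed

text \<open>
  The condition \<open>k l \<equiv> 1 (mod q)\<close> says that \<open>l\<close> lies in the class of the inverse of \<open>k\<close>.
\<close>

lemma dcount_sum:
  assumes k: "coprime k (int n)"
  shows "(\<Sum>l\<in>unit_residues n. dcount (k * l) * unit_exp n l) = moebius_exp n (modular_inverse (int n) k)"
proof -
  let ?k' = "modular_inverse (int n) k"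
  have k': "coprime ?k' (int n)" using k by simp
  have "[k * l = 1] (mod int q) \<longleftrightarrow> [l = ?k'] (mod int q)" if q: "q dvd n" for q l
  proof -
    have kk: "[k * ?k' = 1] (mod int q)" using cong_dvd_modulus[OF cong_modular_inverse1[OF k]] q by simp
    have kq: "coprime k (int q)" using k q by (meson coprime_divisors dvd_refl int_dvd_int_iff)
    have "[k * l = 1] (mod int q) \<longleftrightarrow> [k * l = k * ?k'] (mod int q)"
      using kk cong_sym cong_trans by blast
    also have "\<dots> \<longleftrightarrow> [l = ?k'] (mod int q)" by (rule cong_mult_lcancel[OF kq])
    finally show ?thesis .
  qed
  then have "dcount (k * l) = of_nat (card {q. q dvd n \<and> [l = ?k'] (mod int q)})" for l
    unfolding dcount_def by (intro arg_cong[of _ _ of_nat] arg_cong[of _ _ card]) blast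
  then show ?thesis
    using moebius_exp_eq_divisor_count_sum[OF sf' k'] by simp
qed

lemma dcount_pair_sum:
  assumes k: "coprime k (int n)" and e: "e = 1 \<or> e = - 1"
  shows "(\<Sum>l\<in>index_set n. (dcount (k * l) + e * dcount (- (k * l))) * (unit_exp n l + e * unit_exp n (- l))) =
    moebius_exp n (modular_inverse (int n) k) + e * moebius_exp n (- modular_inverse (int n) k)"
proof -
  have n0: "n > 0" using n3' by simp
  have k': "coprime (- k) (int n)" using k by simp
  define F where "F = (\<lambda>l. (dcount (k * l) + e * dcount (- (k * l))) * unit_exp n l)"
  have ee: "e * e = 1" using e by auto
  have "(\<Sum>l\<in>index_set n. (dcount (k * l) + e * dcount (- (k * l))) * (unit_exp n l + e * unit_exp n (- l))) =
    (\<Sum>l\<in>index_set n. F l + F (- l))"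
    by (intro sum.cong refl) (use e in \<open>auto simp: F_def algebra_simps\<close>)
  also have "\<dots> = (\<Sum>l\<in>unit_residues n. F l)"
  proof (rule sum_unit_residues_pairs[OF n3', symmetric])
    fix x y assume xy: "[x = y] (mod int n)"
    have "[- (k * x) = - (k * y)] (mod int n)" unfolding cong_minus_minus_iff by (rule cong_mult[OF cong_refl xy])
    then show "F x = F y"
      using dcount_cong[OF cong_mult[OF cong_refl xy]] dcount_cong unit_exp_cong[OF n0 xy] by (simp add: F_def)
  qed
  also have "\<dots> = (\<Sum>l\<in>unit_residues n. dcount (k * l) * unit_exp n l) + e * (\<Sum>l\<in>unit_residues n. dcount (- k * l) * unit_exp n l)"
    by (simp add: F_def distrib_right sum.distrib sum_distrib_left mult.assoc)
  also have "\<dots> = moebius_exp n (modular_inverse (int n) k) + e * moebius_exp n (modular_inverse (int n) (- k))"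
    by (simp only: dcount_sum[OF k] dcount_sum[OF k'])
  also have "moebius_exp n (modular_inverse (int n) (- k)) = moebius_exp n (- modular_inverse (int n) k)"
    by (rule moebius_exp_cong[OF sf']) (rule minv_minus[OF k])
  finally show ?thesis .
qed

lemma s_hat_eq:
  assumes k: "coprime k (int n)"
  shows "s_hat n k = - 1 / of_nat n * (moebius_exp n (modular_inverse (int n) k) - moebius_exp n (- modular_inverse (int n) k))"
proof -
  have n0: "n > 0" using n3' by simp
  have "(\<Sum>l\<in>index_set n. (of_nat (lam n (k * l)) - of_nat (lam n (- (k * l)))) * s_num n l) =
     (\<Sum>l\<in>index_set n. (dcount (k * l) + (- 1) * dcount (- (k * l))) * (unit_exp n l + (- 1) * unit_exp n (- l)))"
  proof (rule sum.cong[OF refl])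
    fix l assume "l \<in> index_set n"
    then have kl: "coprime (k * l) (int n)" "coprime (- (k * l)) (int n)" using k index_setD(3)[OF _ n3'] by simp_all
    have "of_nat (2 * card {q. q dvd n \<and> [k * l = 1] (mod int q)}) = (of_nat (2 * lam n (k * l) + rho n) :: complex)"
      "of_nat (2 * card {q. q dvd n \<and> [- (k * l) = 1] (mod int q)}) = (of_nat (2 * lam n (- (k * l)) + rho n) :: complex)"
      by (simp_all only: divisor_count_eq_lam[OF n0 kl(1)] divisor_count_eq_lam[OF n0 kl(2)])
    then have "2 * dcount (k * l) - 2 * dcount (- (k * l)) = 2 * of_nat (lam n (k * l)) - 2 * of_nat (lam n (- (k * l)))"
      by (simp add: dcount_def)
    then have "dcount (k * l) - dcount (- (k * l)) = of_nat (lam n (k * l)) - of_nat (lam n (- (k * l)))"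
      by (simp only: right_diff_distrib [symmetric] mult_cancel_left) simp
    then show "(of_nat (lam n (k * l)) - of_nat (lam n (- (k * l)))) * s_num n l =
        (dcount (k * l) + (- 1) * dcount (- (k * l))) * (unit_exp n l + (- 1) * unit_exp n (- l))"
      by (simp add: s_num_def zeta_root_powi)
  qed
  also have "\<dots> = moebius_exp n (modular_inverse (int n) k) + (- 1) * moebius_exp n (- modular_inverse (int n) k)"
    by (rule dcount_pair_sum[OF k]) simp
  finally show ?thesis by (simp add: s_hat_def)
qed

lemma c_hat_eq:
  assumes k: "coprime k (int n)"
  shows "c_hat n k = 1 / of_nat n * (moebius_exp n (modular_inverse (int n) k) + moebius_exp n (- modular_inverse (int n) k))"
proof -
  have n0: "n > 0" using n3' by simp
  have "(\<Sum>l\<in>index_set n. of_nat (lam n (k * l) + lam n (- (k * l)) + rho n) * c_num n l) =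
     (\<Sum>l\<in>index_set n. (dcount (k * l) + 1 * dcount (- (k * l))) * (unit_exp n l + 1 * unit_exp n (- l)))"
  proof (rule sum.cong[OF refl])
    fix l assume "l \<in> index_set n"
    then have kl: "coprime (k * l) (int n)" "coprime (- (k * l)) (int n)" using k index_setD(3)[OF _ n3'] by simp_all
    have "card {q. q dvd n \<and> [k * l = 1] (mod int q)} + card {q. q dvd n \<and> [- (k * l) = 1] (mod int q)} = lam n (k * l) + lam n (- (k * l)) + rho n"
      using divisor_count_eq_lam[OF n0 kl(1)] divisor_count_eq_lam[OF n0 kl(2)] by linarith
    then have "of_nat (lam n (k * l) + lam n (- (k * l)) + rho n) = dcount (k * l) + 1 * dcount (- (k * l))"
      by (simp add: dcount_def flip: of_nat_add)
    then show "of_nat (lam n (k * l) + lam n (- (k * l)) + rho n) * c_num n l =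
        (dcount (k * l) + 1 * dcount (- (k * l))) * (unit_exp n l + 1 * unit_exp n (- l))"
      by (simp add: c_num_def zeta_root_powi)
  qed
  also have "\<dots> = moebius_exp n (modular_inverse (int n) k) + 1 * moebius_exp n (- modular_inverse (int n) k)"
    by (rule dcount_pair_sum[OF k]) simp
  finally show ?thesis by (simp add: c_hat_def)
qed

end

section \<open>The inverse cotangent numbers\<close>

text \<open>
  The column \<open>s_hat\<close>, respectively \<open>c_hat\<close>, is the transposed Bernoulli matrix applied to the inverse cotangent
  numbers, because both sides are the part of matching parity of \<open>moebius_exp\<close> at the inverse of \<open>j\<close>. Pairing it
  with the first column of the inverse matrix isolates the number with index \<open>1\<close>.
\<close>

theorem theorem1:
  fixes n r :: nat
  assumes "n \<ge> 3" and "squarefree n" and "r \<ge> 1"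
  shows "ct_hat n r 1 =
    (if odd r
     then (\<Sum>j\<in>index_set n. of_real (B_hat n r j 1) * s_hat n j)
     else (\<Sum>j\<in>index_set n. of_real (B_hat n r j 1) * c_hat n j))"
proof -
  note n = assms(1) and sf = assms(2) and r = assms(3)
  have n0: "n > 0" using n by simp
  let ?inv = "modular_inverse (int n)"
  define \<kappa> :: complex where "\<kappa> = - (\<i> ^ r * of_real pi ^ r) / (fact (r - 1) * of_nat n ^ r)"
  define h where "h = (\<lambda>j. if odd r then s_hat n j else c_hat n j)"
  have ct: "ct_hat n r k = \<kappa> * m_num n r k" if "coprime k (int n)" for k
    using d_num_eq_Msum[OF n0 r that] by (simp add: ct_hat_def \<kappa>_def)
  have \<kappa>: "\<kappa> * theta n r = (- 1) ^ r / of_nat n"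
  proof -
    obtain k where k: "r = Suc k" using r by (cases r) auto
    have cancel: "- Y / (F * N ^ Suc k) * - (s * T * N ^ k / X * (X * F) / (T * Y)) = s / N"
      if "Y \<noteq> 0" "F \<noteq> 0" "N \<noteq> 0" "X \<noteq> 0" "T \<noteq> 0" for Y F N s T X :: complex
      using that by (simp add: field_simps)
    have pw: "(2 * of_real pi * \<i>) ^ Suc k = 2 ^ Suc k * (\<i> ^ Suc k * complex_of_real pi ^ Suc k)"
      by (simp only: power_mult_distrib mult_ac)
    show ?thesis
      unfolding \<kappa>_def theta_def k diff_Suc_1 fact_Suc pw
      by (rule cancel) (use n0 in \<open>simp_all del: of_nat_Suc power_Suc\<close>)
  qed
  have h_eq: "h j = (\<Sum>k\<in>index_set n. of_real (B_tilde_mat n r k j) * ct_hat n r k)" if j: "j \<in> index_set n" for j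
  proof -
    have cj: "coprime j (int n)" by (rule index_setD(3)[OF j n])
    then have cj': "coprime (?inv j) (int n)" by simp
    let ?F = "\<lambda>k. beta n r (k * ?inv j) * m_num n r k"
    have "(\<Sum>k\<in>unit_residues n. ?F k) = 2 * (\<Sum>k\<in>index_set n. ?F k)"
    proof (rule half_sum[OF n sf r])
      fix x y assume xy: "[x = y] (mod int n)"
      show "?F x = ?F y"
        using beta_cong[OF n sf r cong_mult[OF xy cong_refl]] residue_indicator_cong[OF xy] by simp
    next
      fix x assume "coprime x (int n)"
      then show "?F (- x) = ?F x"
        using beta_minus[OF n sf r, of "x * ?inv j"] by (cases "even r") (simp_all add: Msum_minus[OF n0 r])
    qed
    with beta_m_num_sum[OF n sf r cj'] have "2 * (\<Sum>k\<in>index_set n. ?F k) = 2 * (theta n r * (moebius_exp n (?inv j) + (- 1) ^ r * moebius_exp n (- ?inv j)))"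
      by simp
    then have half: "(\<Sum>k\<in>index_set n. ?F k) = theta n r * (moebius_exp n (?inv j) + (- 1) ^ r * moebius_exp n (- ?inv j))"
      by (simp only: mult_cancel_left) simp
    have "(\<Sum>k\<in>index_set n. of_real (B_tilde_mat n r k j) * ct_hat n r k) = (\<Sum>k\<in>index_set n. \<kappa> * ?F k)"
      by (intro sum.cong refl) (simp add: B_tilde_mat_eq_beta[OF n sf r _ j] ct index_setD(3)[OF _ n])
    also have "\<dots> = \<kappa> * (\<Sum>k\<in>index_set n. ?F k)" by (simp only: sum_distrib_left)
    also have "\<dots> = (\<kappa> * theta n r) * (moebius_exp n (?inv j) + (- 1) ^ r * moebius_exp n (- ?inv j))"
      by (simp only: half mult.assoc)
    also have "\<dots> = h j"
      unfolding \<kappa> h_def using s_hat_eq[OF n sf cj] c_hat_eq[OF n sf cj]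
      by (cases "odd r") (simp_all add: diff_divide_distrib)
    finally show ?thesis ..
  qed
  have one: "1 \<in> index_set n" using n by (simp add: index_set_def)
  have "(\<Sum>j\<in>index_set n. of_real (B_hat n r j 1) * h j) =
     (\<Sum>j\<in>index_set n. \<Sum>k\<in>index_set n. of_real (B_tilde_mat n r k j * B_hat n r j 1) * ct_hat n r k)"
    by (intro sum.cong refl) (simp add: h_eq sum_distrib_left mult_ac)
  also have "\<dots> = (\<Sum>k\<in>index_set n. of_real (\<Sum>j\<in>index_set n. B_tilde_mat n r k j * B_hat n r j 1) * ct_hat n r k)"
    by (subst sum.swap) (simp only: of_real_sum sum_distrib_right)
  also have "\<dots> = (\<Sum>k\<in>index_set n. of_real (if k = 1 then 1 else 0) * ct_hat n r k)"
    unfolding B_hat_def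
    by (intro sum.cong refl)
       (simp only: mat_inverse_on_right_inverse[OF finite_index_set is_mat_inverse_inv_mat[OF n sf r] _ one])
  also have "\<dots> = (\<Sum>k\<in>index_set n. if k = 1 then ct_hat n r k else 0)"
    by (intro sum.cong refl) simp
  also have "\<dots> = ct_hat n r 1" using one by simp
  finally show ?thesis by (cases "odd r") (simp_all add: h_def)
qed

end
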